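(* Consider the linear control system $\dot x(t)=Ax(t)+B\omega(t)$, $\omega\in\mathcal{U}$, in $\mathbb{R}^d$, with $A\in\mathbb{R}^{d\times d}$, $B\in\mathbb{R}^{d\times m}$, and assume that $(A,B)$ is controllable, $A$ is hyperbolic, and the control range $U$ is a compact neighborhood of the origin in $\mathbb{R}^m$. Let $D$ be the unique control set with nonvoid interior, and let $\lambda_1,\dots,\lambda_r$ be the distinct eigenvalues of $A$ with algebraic multiplicities $d_1,\dots,d_r$. Then for every compact set $K\subset D$ with nonempty interior and every $f\in C(U,\mathbb{R})$, \[ P_{inv}(f,K,D)=\min_{u\in U}f(u)+\sum_{j=1}^r d_j\max\{0,\operatorname{Re}\lambda_j\}. \]
   Context: $\mathcal{U}$ is the set of measurable $\omega:\mathbb{R}\to\mathbb{R}^m$ with $\omega(t)\in U$ a.e.; $\varphi(t,x,\omega)$ denotes the solution with initial value $x$. $A$ hyperbolic means no eigenvalue of $A$ has zero real part. A control set $D$ is a maximal set such that every $x\in D$ admits $\omega$ with $\varphi(t,x,\omega)\in D$ for all $t\ge0$ and $D\subset\overline{\{\varphi(t,x,\omega):t\ge0,\omega\in\mathcal{U}\}}$ for all $x\in D$. Invariance pressure: a set $\mathcal{S}\subset\mathcal{U}$ is $(\tau,K,Q)$-spanning if each $x\in K$ has $\omega\in\mathcal{S}$ with $\varphi([0,\tau],x,\omega)\subset Q$; $a_\tau(f,K,Q)=\inf_{\mathcal{S}}\sum_{\omega\in\mathcal{S}}e^{\int_0^\tau f(\omega(t))dt}$ over $(\tau,K,Q)$-spanning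 $\mathcal{S}$; $P_{inv}(f,K,Q)=\limsup_{\tau\to\infty}\frac1\tau\log a_\tau(f,K,Q)$. *)

theory Defs
  imports "HOL-Analysis.Analysis" "HOL-Computational_Algebra.Polynomial"
begin

definition admissible :: "(real^'m) set \<Rightarrow> (real \<Rightarrow> real^'m) set" where
  "admissible U = {\<omega>. \<omega> \<in> borel_measurable lebesgue \<and> (AE t in lebesgue. \<omega> t \<in> U)}"

definition is_solution ::
  "real^'d^'d \<Rightarrow> real^'m^'d \<Rightarrow> real^'d \<Rightarrow> (real \<Rightarrow> real^'m) \<Rightarrow> (real \<Rightarrow> real^'d) \<Rightarrow> bool" where
  "is_solution A B x \<omega> y \<longleftrightarrow> continuous_on {0..} y \<and>
     (\<forall>t\<ge>0. y t = x + integral {0..t} (\<lambda>s. A *v y s + B *v \<omega> s))"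

definition phi ::
  "real^'d^'d \<Rightarrow> real^'m^'d \<Rightarrow> real \<Rightarrow> real^'d \<Rightarrow> (real \<Rightarrow> real^'m) \<Rightarrow> real^'d" where
  "phi A B t x \<omega> = (THE v. \<exists>y. is_solution A B x \<omega> y \<and> y t = v)"

text \<open>Kalman rank condition: the columns of B, A B, ..., A^(d-1) B (A^k B = ((**) A ^^ k) B) span R^d.\<close>
definition controllable_pair :: "real^'d^'d \<Rightarrow> real^'m^'d \<Rightarrow> bool" where
  "controllable_pair A B \<longleftrightarrow>
     span {(((\<lambda>M. A ** M) ^^ k) B) *v u | k u. k < CARD('d)} = (UNIV :: (real^'d) set)"

definition char_poly_c :: "real^'d^'d \<Rightarrow> complex poly" where
  "char_poly_c A = det (\<chi> i j. (if i = j then [:0, 1:] else 0) - [:complex_of_real (A $ i $ j):])"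

definition eigenvalues_c :: "real^'d^'d \<Rightarrow> complex set" where
  "eigenvalues_c A = {z. poly (char_poly_c A) z = 0}"

definition alg_mult :: "real^'d^'d \<Rightarrow> complex \<Rightarrow> nat" where
  "alg_mult A z = order z (char_poly_c A)"

definition hyperbolic :: "real^'d^'d \<Rightarrow> bool" where
  "hyperbolic A \<longleftrightarrow> (\<forall>z\<in>eigenvalues_c A. Re z \<noteq> 0)"

definition orbit_pos ::
  "real^'d^'d \<Rightarrow> real^'m^'d \<Rightarrow> (real^'m) set \<Rightarrow> real^'d \<Rightarrow> (real^'d) set" where
  "orbit_pos A B U x = {phi A B t x \<omega> | t \<omega>. t \<ge> 0 \<and> \<omega> \<in> admissible U}"

definition control_set_props ::
  "real^'d^'d \<Rightarrow> real^'m^'d \<Rightarrow> (real^'m) set \<Rightarrow> (real^'d) set \<Rightarrow> bool" where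
  "control_set_props A B U D \<longleftrightarrow>
     (\<forall>x\<in>D. \<exists>\<omega>\<in>admissible U. \<forall>t\<ge>0. phi A B t x \<omega> \<in> D) \<and>
     (\<forall>x\<in>D. D \<subseteq> closure (orbit_pos A B U x))"

definition control_set ::
  "real^'d^'d \<Rightarrow> real^'m^'d \<Rightarrow> (real^'m) set \<Rightarrow> (real^'d) set \<Rightarrow> bool" where
  "control_set A B U D \<longleftrightarrow> D \<noteq> {} \<and> control_set_props A B U D \<and>
     (\<forall>D'. D \<subseteq> D' \<and> control_set_props A B U D' \<longrightarrow> D' = D)"

definition spanning ::
  "real^'d^'d \<Rightarrow> real^'m^'d \<Rightarrow> (real^'m) set \<Rightarrow> real \<Rightarrow> (real^'d) set \<Rightarrow> (real^'d) set
    \<Rightarrow> (real \<Rightarrow> real^'m) set \<Rightarrow> bool" where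
  "spanning A B U \<tau> K Q S \<longleftrightarrow> S \<subseteq> admissible U \<and>
     (\<forall>x\<in>K. \<exists>\<omega>\<in>S. \<forall>t\<in>{0..\<tau>}. phi A B t x \<omega> \<in> Q)"

text \<open>a_tau(f,K,Q), with values in [0,oo] (sums over possibly infinite spanning sets).\<close>
definition a_tau ::
  "real^'d^'d \<Rightarrow> real^'m^'d \<Rightarrow> (real^'m) set \<Rightarrow> (real^'m \<Rightarrow> real) \<Rightarrow> real \<Rightarrow> (real^'d) set
    \<Rightarrow> (real^'d) set \<Rightarrow> ennreal" where
  "a_tau A B U f \<tau> K Q = (INF S \<in> {S. spanning A B U \<tau> K Q S}.
      infsum (\<lambda>\<omega>. ennreal (exp (integral {0..\<tau>} (\<lambda>t. f (\<omega> t))))) S)"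

definition log_enn :: "ennreal \<Rightarrow> ereal" where
  "log_enn a = (if a = \<infinity> then \<infinity> else if a = 0 then - \<infinity> else ereal (ln (enn2real a)))"

definition P_inv ::
  "real^'d^'d \<Rightarrow> real^'m^'d \<Rightarrow> (real^'m) set \<Rightarrow> (real^'m \<Rightarrow> real) \<Rightarrow> (real^'d) set
    \<Rightarrow> (real^'d) set \<Rightarrow> ereal" where
  "P_inv A B U f K Q = Limsup at_top (\<lambda>\<tau>::real. ereal (1 / \<tau>) * log_enn (a_tau A B U f \<tau> K Q))"

end

theory Submission
  imports Defs "HOL-Computational_Algebra.Fundamental_Theorem_Algebra"
begin

text \<open>Let \<open>h\<close> be the sum of the positive real parts of the eigenvalues and let \<open>P\<close> be the projection onto
  the unstable subspace along the stable one, so that \<open>e\<^sup>t\<^sup>A P + (I - P) = e\<^sup>t\<^sup>A\<^sup>P\<close> has determinant \<open>e\<^sup>t\<^sup>h\<close>.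

  Lower bound: \<open>D\<close> is bounded, so two points of \<open>K\<close> that the same control keeps in \<open>D\<close> up to time \<open>\<tau>\<close> differ by
  a vector \<open>z\<close> with \<open>e\<^sup>\<tau>\<^sup>A\<^sup>P z\<close> bounded. The points served by one control thus fill a volume of order \<open>e\<^sup>-\<^sup>\<tau>\<^sup>h\<close>, and
  every control costs at least \<open>\<tau> min f\<close>.

  Upper bound: run the constant control \<open>u0\<close> that minimises \<open>f\<close>, except on a fraction \<open>\<epsilon>\<close> of the time where the
  control is \<open>0\<close>. Hyperbolicity gives a periodic point \<open>p\<close> of this regime, and on the fraction \<open>\<epsilon>\<close> small
  perturbations of \<open>0\<close> realise every small correction of the state. For \<open>n\<close> periods, about \<open>e\<^sup>n\<^sup>h\<close> corrections in the
  unstable directions suffice to bring back every point of a neighbourhood of \<open>p\<close>, and this is iterated.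
  Staying in \<open>D\<close> is automatic because \<open>D\<close> consists of the points of the closure of the orbit of \<open>0\<close> that can be
  steered to \<open>0\<close>: a trajectory that starts in \<open>D\<close> and ends at a point controllable to \<open>0\<close> never leaves \<open>D\<close>.\<close>

section \<open>The flow of a linear differential equation\<close>

text \<open>The minimiser \<open>u0\<close> may lie on the boundary of \<open>U\<close>, where there
  is no room for perturbations. Corrections are therefore made around the interior point 0, at an
  excess cost of at most 2 F \<epsilon> per unit of time, where F bounds |f|. The number of
  corrections for n periods carries a constant factor V that is independent of n. Iteration
  multiplies these factors, so n is fixed beforehand with (ln V) / n small. The description of
  \<open>D\<close> by the point 0 rests on the invertibility of 1 - e^(TA) for T > 0: each control
  on [0, T] has exactly one periodic point, and replacing the control by 0 on a growing part of the
  period moves this point continuously to 0. While some time with zero control is left, a periodic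
  point and its neighbours can be steered to each other, and connectedness transports this relation
  along the path. \<open>D\<close> is bounded because states reachable from 0 have bounded stable
  part and states controllable to 0 have bounded unstable part. Volumes need only the determinant of
  the flow of A P, which is computed from eigenvalues by Liouville's formula without any normal
  form.\<close>

typedef (overloaded) 'a::euclidean_space endo = "UNIV :: ('a \<Rightarrow>\<^sub>L 'a) set"
  morphisms blinfun_of_endo Endo ..

setup_lifting type_definition_endo

instantiation endo :: (euclidean_space) real_vector
begin

lift_definition zero_endo :: "'a endo" is "0" .
lift_definition plus_endo :: "'a endo \<Rightarrow> 'a endo \<Rightarrow> 'a endo" is "(+)" .
lift_definition minus_endo :: "'a endo \<Rightarrow> 'a endo \<Rightarrow> 'a endo" is "(-)" .
lift_definition uminus_endo :: "'a endo \<Rightarrow> 'a endo" is "uminus" .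
lift_definition scaleR_endo :: "real \<Rightarrow> 'a endo \<Rightarrow> 'a endo" is "(*\<^sub>R)" .

instance
proof
  fix x y z :: "'a endo" and a b :: real
  show "x + y + z = x + (y + z)" by transfer simp
  show "x + y = y + x" by transfer simp
  show "0 + x = x" by transfer simp
  show "- x + x = 0" by transfer simp
  show "x - y = x + - y" by transfer simp
  show "a *\<^sub>R (x + y) = a *\<^sub>R x + a *\<^sub>R y" by transfer (simp add: scaleR_right_distrib)
  show "(a + b) *\<^sub>R x = a *\<^sub>R x + b *\<^sub>R x" by transfer (simp add: scaleR_left_distrib)
  show "a *\<^sub>R b *\<^sub>R x = (a * b) *\<^sub>R x" by transfer simp
  show "1 *\<^sub>R x = x" by transfer simp
qed

end

instantiation endo :: (euclidean_space) real_normed_vector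
begin

lift_definition norm_endo :: "'a endo \<Rightarrow> real" is "norm" .
lift_definition dist_endo :: "'a endo \<Rightarrow> 'a endo \<Rightarrow> real" is "dist" .
lift_definition sgn_endo :: "'a endo \<Rightarrow> 'a endo" is "sgn" .
definition uniformity_endo :: "('a endo \<times> 'a endo) filter"
  where "uniformity_endo = (INF e\<in>{0 <..}. principal {(x, y). dist x y < e})"
definition open_endo :: "'a endo set \<Rightarrow> bool"
  where "open_endo S = (\<forall>x\<in>S. \<forall>\<^sub>F (x', y) in uniformity. x' = x \<longrightarrow> y \<in> S)"

instance
proof
  fix x y z :: "'a endo" and a b :: real
  show "dist x y = norm (x - y)" by transfer (simp add: dist_norm)
  show "sgn x = x /\<^sub>R norm x" by transfer (simp add: sgn_div_norm)
  show "(norm x = 0) = (x = 0)" by transfer simp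
  show "norm (x + y) \<le> norm x + norm y" by transfer (rule norm_triangle_ineq)
  show "norm (a *\<^sub>R x) = \<bar>a\<bar> * norm x" by transfer simp
qed (simp_all add: uniformity_endo_def open_endo_def)

end

text \<open>Composition is the product. Together with completeness this gives a Banach algebra, in
  which the exponential series \<open>exp\<close> is available.\<close>

instantiation endo :: (euclidean_space) real_normed_algebra_1
begin

lift_definition times_endo :: "'a endo \<Rightarrow> 'a endo \<Rightarrow> 'a endo" is "blinfun_compose" .
lift_definition one_endo :: "'a endo" is "id_blinfun" .

instance
proof
  fix x y z :: "'a endo" and a b :: real
  show "x * y * z = x * (y * z)" by transfer (auto intro: blinfun_eqI)
  show "(x + y) * z = x * z + y * z" by transfer (auto intro: blinfun_eqI simp: blinfun.bilinear_simps)
  show "x * (y + z) = x * y + x * z" by transfer (auto intro: blinfun_eqI simp: blinfun.bilinear_simps)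
  show "1 * x = x" by transfer (auto intro: blinfun_eqI)
  show "x * 1 = x" by transfer (auto intro: blinfun_eqI)
  show "a *\<^sub>R x * y = a *\<^sub>R (x * y)" by transfer (auto intro: blinfun_eqI simp: blinfun.bilinear_simps)
  show "x * a *\<^sub>R y = a *\<^sub>R (x * y)" by transfer (auto intro: blinfun_eqI simp: blinfun.bilinear_simps)
  show "(0::'a endo) \<noteq> 1"
    by transfer (metis norm_blinfun_id norm_zero zero_neq_one)
  show "norm (x * y) \<le> norm x * norm y" by transfer (rule norm_blinfun_compose)
  show "norm (1::'a endo) = 1" by transfer simp
qed

end

instance endo :: (euclidean_space) banach
proof
  fix X :: "nat \<Rightarrow> 'a endo" assume X: "Cauchy X"
  have dist: "dist (blinfun_of_endo x) (blinfun_of_endo y) = dist x y" for x y :: "'a endo"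
    by transfer simp
  have "Cauchy (\<lambda>n. blinfun_of_endo (X n))"
    using X by (simp add: Cauchy_def dist)
  then obtain L where L: "(\<lambda>n. blinfun_of_endo (X n)) \<longlonglongrightarrow> L"
    using Cauchy_convergent_iff convergentD by blast
  have "X \<longlonglongrightarrow> Endo L"
    using L by (simp add: tendsto_iff dist_endo.rep_eq Endo_inverse)
  then show "convergent X" by (auto simp: convergent_def)
qed

lift_definition endo_apply :: "'a::euclidean_space endo \<Rightarrow> 'a \<Rightarrow> 'a" is blinfun_apply .

lemma bounded_bilinear_endo_apply: "bounded_bilinear endo_apply"
proof
  fix f g :: "'a endo" and x y :: 'a and r :: real
  show "endo_apply (f + g) x = endo_apply f x + endo_apply g x"
    by transfer (simp add: blinfun.bilinear_simps)
  show "endo_apply f (x + y) = endo_apply f x + endo_apply f y"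
    by transfer (simp add: blinfun.bilinear_simps)
  show "endo_apply (r *\<^sub>R f) x = r *\<^sub>R endo_apply f x"
    by transfer (simp add: blinfun.bilinear_simps)
  show "endo_apply f (r *\<^sub>R x) = r *\<^sub>R endo_apply f x"
    by transfer (simp add: blinfun.bilinear_simps)
  have "norm (endo_apply f x) \<le> norm f * norm x * 1" for f :: "'a endo" and x
    by transfer (simp add: norm_blinfun)
  then show "\<exists>K. \<forall>(f::'a endo) x. norm (endo_apply f x) \<le> norm f * norm x * K" by blast
qed

interpretation endo_apply: bounded_bilinear endo_apply
  by (rule bounded_bilinear_endo_apply)

lemma norm_endo_apply: "norm (endo_apply f x) \<le> norm f * norm x"
  by transfer (simp add: norm_blinfun)

lemma endo_apply_mult: "endo_apply (f * g) x = endo_apply f (endo_apply g x)"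
  by transfer simp

lemma endo_apply_one [simp]: "endo_apply 1 x = x"
  by transfer simp


lift_definition endo_of_matrix :: "real^'d^'d \<Rightarrow> (real^'d) endo" is "\<lambda>A. Blinfun ((*v) A)" .

lemma endo_apply_of_matrix [simp]: "endo_apply (endo_of_matrix A) x = A *v x"
  by transfer (simp add: bounded_linear_Blinfun_apply)

text \<open>The matrix exponential e^(tA), acting on vectors.\<close>

definition flow :: "real^'d^'d \<Rightarrow> real \<Rightarrow> real^'d \<Rightarrow> real^'d" where
  "flow A t = endo_apply (exp (t *\<^sub>R endo_of_matrix A))"

lemma flow_0 [simp]: "flow A 0 x = x"
  by (simp add: flow_def)

lemma flow_add: "flow A (s + t) x = flow A s (flow A t x)"
  by (simp add: flow_def scaleR_left_distrib exp_add_commuting flip: endo_apply_mult)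

lemma flow_minus_cancel [simp]: "flow A (- t) (flow A t x) = x" "flow A t (flow A (- t) x) = x"
  using flow_add[of A "-t" t x] flow_add[of A t "-t" x] by simp_all

lemma bounded_linear_flow: "bounded_linear (flow A t)"
  by (simp add: flow_def endo_apply.bounded_linear_right)

lemma linear_flow: "linear (flow A t)"
  by (rule bounded_linear.linear[OF bounded_linear_flow])

lemmas flow_simps = linear_add[OF linear_flow] linear_diff[OF linear_flow] linear_cmul[OF linear_flow]
  linear_0[OF linear_flow] linear_neg[OF linear_flow] 

lemma norm_flow_le: "norm (flow A t x) \<le> exp (\<bar>t\<bar> * norm (endo_of_matrix A)) * norm x"
proof -
  have "norm (exp (t *\<^sub>R endo_of_matrix A)) \<le> exp (\<bar>t\<bar> * norm (endo_of_matrix A))"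
    using norm_exp[of "t *\<^sub>R endo_of_matrix A"] by simp
  then show ?thesis
    unfolding flow_def by (meson norm_endo_apply mult_right_mono norm_ge_zero order_trans)
qed

lemma continuous_on_exp_endo: "continuous_on S (\<lambda>t. exp (t *\<^sub>R (a::'a::euclidean_space endo)))"
  by (rule continuous_at_imp_continuous_on) 
    (use has_vector_derivative_continuous exp_scaleR_has_vector_derivative_right in blast)

lemma continuous_on_flow:
  assumes "continuous_on S g" "continuous_on S h"
  shows "continuous_on S (\<lambda>s. flow A (g s) (h s))"
  unfolding flow_def
  by (intro endo_apply.continuous_on assms continuous_on_compose2[OF continuous_on_exp_endo assms(1)]) auto

lemma tendsto_flow:
  assumes "(g \<longlongrightarrow> a) F" "(h \<longlongrightarrow> b) F"
  shows "((\<lambda>s. flow A (g s) (h s)) \<longlongrightarrow> flow A a b) F"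
proof -
  have "isCont (\<lambda>t. exp (t *\<^sub>R endo_of_matrix A)) a"
    using continuous_on_exp_endo[of UNIV "endo_of_matrix A"] by (simp add: continuous_on_eq_continuous_at)
  then show ?thesis
    unfolding flow_def by (intro endo_apply.tendsto assms isCont_tendsto_compose[OF _ assms(1)])
qed

lemma flow_vector_derivative:
  "((\<lambda>t. flow A t x) has_vector_derivative A *v flow A t x) (at t within S)"
proof -
  have "((\<lambda>t. endo_apply (exp (t *\<^sub>R endo_of_matrix A)) x) has_vector_derivative
      endo_apply (endo_of_matrix A * exp (t *\<^sub>R endo_of_matrix A)) x) (at t within S)"
    by (intro bounded_linear.has_vector_derivative[OF endo_apply.bounded_linear_left]
        has_vector_derivative_at_within[OF exp_scaleR_has_vector_derivative_left])
  then show ?thesis by (simp add: flow_def endo_apply_mult)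
qed

text \<open>Product rule for e^(ctA) y(t). The case c = -1 transports a solution back to time 0, the
  case c = 1 is variation of constants.\<close>

lemma flow_has_vector_derivative_comp:
  assumes y: "(y has_vector_derivative y') (at t within S)"
  shows "((\<lambda>s. flow A (c * s) (y s)) has_vector_derivative
    flow A (c * t) (y' + c *\<^sub>R (A *v y t))) (at t within S)"
proof -
  have 1: "((\<lambda>t. exp ((c * t) *\<^sub>R endo_of_matrix A)) has_vector_derivative
      c *\<^sub>R (exp ((c * t) *\<^sub>R endo_of_matrix A) * endo_of_matrix A)) (at t within S)"
    by (rule vector_diff_chain_within[OF _ has_vector_derivative_at_within[OF exp_scaleR_has_vector_derivative_right], unfolded o_def])
      (auto intro!: derivative_eq_intros simp: has_real_derivative_iff_has_vector_derivative[symmetric])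
  show ?thesis
    using endo_apply.has_vector_derivative[OF 1 y]
    by (simp add: flow_def endo_apply_mult endo_apply.bilinear_simps algebra_simps)
qed

text \<open>The curve e^(-tA) y(t) has derivative zero. Allowing a convex domain covers both the
  whole line and the intervals on which control trajectories live.\<close>

lemma flow_unique:
  assumes S: "convex S" "0 \<in> S"
    and y: "\<And>t. t \<in> S \<Longrightarrow> (y has_vector_derivative A *v y t) (at t within S)"
    and t: "t \<in> S"
  shows "y t = flow A t (y 0)"
proof -
  have "((\<lambda>s. flow A (-1 * s) (y s)) has_vector_derivative 0) (at s within S)" if "s \<in> S" for s
    using flow_has_vector_derivative_comp[OF y[OF that], of A "-1"] by (simp add: flow_simps)
  then obtain c where "\<And>s. s \<in> S \<Longrightarrow> flow A (-1 * s) (y s) = c"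
    using has_vector_derivative_zero_constant[OF S(1)] by blast
  from this[OF t] this[OF S(2)] have "flow A (-1 * t) (y t) = flow A (-1 * 0) (y 0)" by metis
  then have "flow A (- t) (y t) = y 0" by simp
  then show ?thesis by (metis flow_minus_cancel(2))
qed

text \<open>Both sides solve x' = A x with the same initial value.\<close>

lemma matrix_flow_commute:
  assumes "A ** P = P ** A"
  shows "P *v flow A t x = flow A t (P *v x)"
proof -
  have "((\<lambda>t. P *v flow A t x) has_vector_derivative A *v (P *v flow A t x)) (at t within UNIV)" for t
    using bounded_linear.has_vector_derivative[OF matrix_vector_mul_bounded_linear flow_vector_derivative,
        of P A x t UNIV] assms
    by (simp add: matrix_vector_mul_assoc)
  from flow_unique[OF _ _ this, of t] show ?thesis by simp
qed

lemma matrix_flow: "A *v flow A t x = flow A t (A *v x)"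
  by (rule matrix_flow_commute) simp

lemma minus_matrix_vector_mult: "(- A) *v x = - (A *v (x::real^'n))"
  by (simp add: matrix_vector_mult_def vec_eq_iff sum_negf)

lemma flow_minus_matrix: "flow (- A) t x = flow A (- t) x"
proof -
  have "((\<lambda>t. flow A (- t) x) has_vector_derivative (-A) *v flow A (- t) x) (at t within UNIV)" for t
    using flow_has_vector_derivative_comp[of "\<lambda>_. x" 0 t UNIV A "-1"]
    by (simp add: flow_simps minus_matrix_vector_mult flip: matrix_flow)
  from flow_unique[OF _ _ this, of t] show ?thesis by simp
qed

section \<open>Exponential dichotomy\<close>

definition poly_vec :: "complex^'d^'d \<Rightarrow> complex^'d \<Rightarrow> complex poly \<Rightarrow> complex^'d" where
  "poly_vec M v p = fold_coeffs (\<lambda>a w. a *s v + M *v w) p 0"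

lemma poly_vec_0 [simp]: "poly_vec M v 0 = 0"
  by (simp add: poly_vec_def)

lemma poly_vec_pCons [simp]: "poly_vec M v (pCons a p) = a *s v + M *v poly_vec M v p"
  by (cases "p = 0 \<and> a = 0") (auto simp: poly_vec_def)

lemma poly_vec_add: "poly_vec M v (p + q) = poly_vec M v p + poly_vec M v q"
  by (induction p q rule: poly_induct2) (simp_all add: vec.scale_left_distrib matrix_vector_right_distrib)

lemma poly_vec_smult: "poly_vec M v (smult c p) = c *s poly_vec M v p"
  by (induction p) (simp_all add: vec.scale_right_distrib vector_scalar_commute)

lemma poly_vec_sum: "poly_vec M v (sum f S) = (\<Sum>i\<in>S. poly_vec M v (f i))"
  by (induction S rule: infinite_finite_induct) (simp_all add: poly_vec_add)

lemma poly_vec_in_subspace: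
  assumes "vec.subspace N" "\<And>v. v \<in> N \<Longrightarrow> M *v v \<in> N" "v \<in> N"
  shows "poly_vec M v p \<in> N"
  by (induction p) (auto simp: assms vec.subspace_0 vec.subspace_add vec.subspace_scale)

lemma scaleR_eq_vector_scale: "c *\<^sub>R (v::complex^'d) = complex_of_real c *s v"
  by (simp add: vec_eq_iff scaleR_conv_of_real[where x="_::complex"])

text \<open>The vectors v, M v, ..., M^n v outnumber the real dimension n of the space, so they
  satisfy a relation, even one with real coefficients.\<close>

lemma ex_annihilating_poly: "\<exists>p. p \<noteq> 0 \<and> poly_vec M v p = 0"
proof -
  define b where "b i = poly_vec M v (monom 1 i)" for i
  define n where "n = DIM(complex^'a)"
  show ?thesis
  \<comment> \<open>Dependence is a property of sets: if two of the vectors coincide, the set may be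
    too small, but the coincidence is itself a relation.\<close>
  proof (cases "inj_on b {..n}")
    case False
    then obtain i j where ij: "i \<noteq> j" "b i = b j" by (auto simp: inj_on_def)
    let ?p = "monom 1 i + smult (-1) (monom 1 j) :: complex poly"
    have "coeff ?p i = 1" using ij by simp
    then have "?p \<noteq> 0" by (metis coeff_0 zero_neq_one)
    moreover have "poly_vec M v ?p = 0"
      using ij unfolding poly_vec_add poly_vec_smult by (simp add: b_def)
    ultimately show ?thesis by blast
  next
    case True
    then have "card (b ` {..n}) > DIM(complex^'a)" by (simp add: card_image n_def)
    then have "dependent (b ` {..n})" by (rule dependent_biggerset)
    then obtain u k where u: "k \<le> n" "u (b k) \<noteq> 0" "(\<Sum>w\<in>b ` {..n}. u w *\<^sub>R w) = 0"
      by (auto simp: dependent_finite)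
    let ?p = "\<Sum>i\<le>n. smult (complex_of_real (u (b i))) (monom 1 i)"
    have "coeff ?p k = complex_of_real (u (b k))"
      using u(1) by (simp add: coeff_sum coeff_monom if_distrib cong: if_cong)
    then have "?p \<noteq> 0" using u(2) by (metis coeff_0 of_real_eq_0_iff)
    moreover have "poly_vec M v ?p = (\<Sum>i\<le>n. u (b i) *\<^sub>R b i)"
      by (simp add: poly_vec_sum poly_vec_smult scaleR_eq_vector_scale b_def)
    moreover have "\<dots> = 0"
      using u(3) True by (simp add: sum.reindex)
    ultimately show ?thesis by metis
  qed
qed

text \<open>Eigenvectors of a quotient without forming the quotient. Take p of least degree among
  the nonzero polynomials with p(M) v0 in Z and split off a root \<mu>; the cofactor q has smaller
  degree, so q(M) v0 is outside Z while M - \<mu> maps it into Z.\<close>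

lemma ex_eigenvector_mod_subspace:
  fixes M :: "complex^'d^'d"
  assumes N: "vec.subspace N" "\<And>v. v \<in> N \<Longrightarrow> M *v v \<in> N"
    and Z: "vec.subspace Z" and v0: "v0 \<in> N" "v0 \<notin> Z"
  shows "\<exists>v\<in>N - Z. \<exists>\<mu>. M *v v - \<mu> *s v \<in> Z"
proof -
  let ?P = "\<lambda>p. p \<noteq> 0 \<and> poly_vec M v0 p \<in> Z"
  have "\<exists>p. ?P p" using ex_annihilating_poly[of M v0] vec.subspace_0[OF Z] by metis
  then obtain p where p: "?P p" and least: "\<And>q. ?P q \<Longrightarrow> degree p \<le> degree q"
    using ex_has_least_nat[of ?P _ degree] by blast
  have "degree p > 0"
  proof (rule ccontr)
    assume "\<not> degree p > 0"
    then obtain c where c: "p = [:c:]" by (metis degree_0_id gr0I of_nat_0 degree_eq_zeroE)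
    with p have "c \<noteq> 0" "c *s v0 \<in> Z" by auto
    then have "inverse c *s (c *s v0) \<in> Z" using Z vec.subspace_scale by blast
    with \<open>c \<noteq> 0\<close> v0 show False by (simp add: vec.scale_scale)
  qed
  then obtain \<mu> where "poly p \<mu> = 0" using alg_closed_imp_poly_has_root by blast
  then obtain q where q: "p = [:-\<mu>, 1:] * q" by (auto simp: poly_eq_0_iff_dvd dvd_def)
  let ?v = "poly_vec M v0 q"
  have "p = smult (- \<mu>) q + pCons 0 q" using q by simp
  then have "poly_vec M v0 p = - \<mu> *s ?v + M *v ?v"
    by (metis poly_vec_add poly_vec_smult poly_vec_pCons vec.scale_zero_left add_0)
  then have "M *v ?v - \<mu> *s ?v \<in> Z" using p by (simp add: add.commute)
  moreover have "q \<noteq> 0" using p q by auto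
  moreover have "degree p = degree [:-\<mu>, 1:] + degree q"
    unfolding q using \<open>q \<noteq> 0\<close> by (intro degree_mult_eq) auto
  then have "degree q < degree p" by simp
  ultimately show ?thesis
    using least[of q] poly_vec_in_subspace[OF N v0(1)] by (meson DiffI linorder_not_less)
qed

section \<open>Complexification of matrices, vectors and the flow\<close>

definition cmat :: "real^'n^'m \<Rightarrow> complex^'n^'m" where
  "cmat A = (\<chi> i j. complex_of_real (A $ i $ j))"

definition cvec :: "real^'n \<Rightarrow> complex^'n" where "cvec x = (\<chi> i. complex_of_real (x $ i))"
definition Rev :: "complex^'n \<Rightarrow> real^'n" where "Rev v = (\<chi> i. Re (v $ i))"
definition Imv :: "complex^'n \<Rightarrow> real^'n" where "Imv v = (\<chi> i. Im (v $ i))"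

lemmas cvec_defs = cmat_def cvec_def Rev_def Imv_def

lemma Rev_Imv_cvec [simp]: "Rev (cvec x) = x" "Imv (cvec x) = 0"
  "Rev (\<i> *s cvec x) = 0" "Imv (\<i> *s cvec x) = x"
  by (simp_all add: cvec_defs vec_eq_iff)

lemma cvec_decomp: "cvec (Rev v) + \<i> *s cvec (Imv v) = v"
  by (simp add: cvec_defs vec_eq_iff complex_eq_iff)

lemma cmat_mult_vec: "cmat A *v cvec x = cvec (A *v x)"
  by (simp add: cvec_defs vec_eq_iff matrix_vector_mult_def)

lemma Rev_mat: "Rev (cmat A *v v) = A *v Rev v" and Imv_mat: "Imv (cmat A *v v) = A *v Imv v"
  by (simp_all add: cvec_defs vec_eq_iff matrix_vector_mult_def)

lemma linear_cvec: "linear cvec" "linear (\<lambda>x. \<i> *s cvec x)" "linear Rev" "linear Imv"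
  by (auto intro!: linearI simp: cvec_defs vec_eq_iff complex_eq_iff algebra_simps)

lemmas bounded_linear_cvec = linear_cvec[THEN linear_conv_bounded_linear[THEN iffD1]]

lemma norm_vector_scale: "norm (c *s (v::complex^'n)) = norm c * norm v"
  by (simp add: norm_vec_def L2_set_right_distrib norm_mult)

lemma norm_cvec [simp]: "norm (cvec x) = norm x"
  by (simp add: norm_vec_def cvec_def)

lemma norm_Rev: "norm (Rev v) \<le> norm v" and norm_Imv: "norm (Imv v) \<le> norm v"
  unfolding norm_vec_def Rev_def Imv_def
  by (auto intro!: L2_set_mono simp: abs_Re_le_cmod abs_Im_le_cmod)

lemma bounded_bilinear_vector_scale: "bounded_bilinear (\<lambda>c (v::complex^'n). c *s v)"
proof
  show "\<exists>K. \<forall>a (b::complex^'n). norm (a *s b) \<le> norm a * norm b * K"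
    by (rule exI[of _ 1]) (simp add: norm_vector_scale)
qed (simp_all add: vec_eq_iff complex_eq_iff algebra_simps)

text \<open>e^(tA) on complex vectors. Defining it through real and imaginary parts lets its
  properties be inherited from \<open>flow\<close>.\<close>

definition cflow :: "real^'d^'d \<Rightarrow> real \<Rightarrow> complex^'d \<Rightarrow> complex^'d" where
  "cflow A t v = cvec (flow A t (Rev v)) + \<i> *s cvec (flow A t (Imv v))"

lemma Rev_cflow [simp]: "Rev (cflow A t v) = flow A t (Rev v)"
  and Imv_cflow [simp]: "Imv (cflow A t v) = flow A t (Imv v)"
  by (simp_all add: cflow_def linear_add[OF linear_cvec(3)] linear_add[OF linear_cvec(4)])

lemma cvec_eqI: "Rev v = Rev w \<Longrightarrow> Imv v = Imv w \<Longrightarrow> v = w"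
  by (metis cvec_decomp)

lemma cflow_add: "cflow A t (v + w) = cflow A t v + cflow A t w"
  by (rule cvec_eqI) (simp_all add: linear_add[OF linear_cvec(3)] linear_add[OF linear_cvec(4)] flow_simps)

lemma Rev_scale: "Rev (c *s v) = Re c *\<^sub>R Rev v - Im c *\<^sub>R Imv v"
  and Imv_scale: "Imv (c *s v) = Re c *\<^sub>R Imv v + Im c *\<^sub>R Rev v"
  by (simp_all add: cvec_defs vec_eq_iff)

lemma cflow_scale: "cflow A t (c *s v) = c *s cflow A t v"
  by (rule cvec_eqI) (simp_all add: Rev_scale Imv_scale flow_simps)

lemma cflow_mat: "cflow A t (cmat A *v v) = cmat A *v cflow A t v"
  by (rule cvec_eqI) (simp_all add: Rev_mat Imv_mat matrix_flow)

lemma cflow_cvec: "cflow A t (cvec x) = cvec (flow A t x)"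
  by (rule cvec_eqI) (simp_all add: flow_simps)

lemma cflow_0 [simp]: "cflow A 0 v = v"
  by (rule cvec_eqI) simp_all

lemma cflow_zero [simp]: "cflow A t 0 = 0"
  using cflow_scale[of A t 0 0] by simp

lemma cflow_vector_derivative:
  "((\<lambda>t. cflow A t v) has_vector_derivative cmat A *v cflow A t v) (at t within S)"
proof -
  have "((\<lambda>t. cvec (flow A t (Rev v)) + \<i> *s cvec (flow A t (Imv v))) has_vector_derivative
      cvec (A *v flow A t (Rev v)) + \<i> *s cvec (A *v flow A t (Imv v))) (at t within S)"
    by (rule has_vector_derivative_add[OF
        bounded_linear.has_vector_derivative[OF bounded_linear_cvec(1) flow_vector_derivative]
        bounded_linear.has_vector_derivative[OF bounded_linear_cvec(2) flow_vector_derivative]])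
  then show ?thesis
    by (simp add: cflow_def matrix_vector_right_distrib cmat_mult_vec vector_scalar_commute)
qed

lemma vector_scale_exp_derivative:
  fixes y :: "real \<Rightarrow> complex^'n"
  assumes "(y has_vector_derivative y') (at t within S)"
  shows "((\<lambda>t. exp (\<mu> * of_real t) *s y t) has_vector_derivative
    exp (\<mu> * of_real t) *s (\<mu> *s y t + y')) (at t within S)"
proof -
  have "((\<lambda>z::complex. exp (\<mu> * z)) has_field_derivative exp (\<mu> * of_real t) * \<mu>) (at (of_real t))"
    by (auto intro!: derivative_eq_intros)
  then have "((\<lambda>t. exp (\<mu> * of_real t)) has_vector_derivative exp (\<mu> * of_real t) * \<mu>) (at t within S)"
    by (rule has_vector_derivative_real_field)
  from bounded_bilinear.has_vector_derivative[OF bounded_bilinear_vector_scale this assms]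
  show ?thesis by (simp add: vec.scale_right_distrib vec.scale_scale add.commute)
qed

text \<open>The real and the imaginary part of e^(\<mu>t) v both solve x' = A x, so uniqueness for
  the real flow applies to each.\<close>

lemma cflow_eigenvector:
  assumes "cmat A *v v = \<mu> *s v"
  shows "cflow A t v = exp (\<mu> * of_real t) *s v"
proof -
  let ?V = "\<lambda>t. exp (\<mu> * of_real t) *s v"
  have V: "(?V has_vector_derivative cmat A *v ?V t) (at t within UNIV)" for t
    using vector_scale_exp_derivative[of "\<lambda>_. v" 0 t UNIV \<mu>] assms by (simp add: vector_scalar_commute)
  have "Rev (?V t) = flow A t (Rev (?V 0))"
    using bounded_linear.has_vector_derivative[OF bounded_linear_cvec(3) V]
    by (intro flow_unique[where S=UNIV and y="\<lambda>t. Rev (?V t)"]) (simp_all only: Rev_mat convex_UNIV UNIV_I)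
  moreover have "Imv (?V t) = flow A t (Imv (?V 0))"
    using bounded_linear.has_vector_derivative[OF bounded_linear_cvec(4) V]
    by (intro flow_unique[where S=UNIV and y="\<lambda>t. Imv (?V t)"]) (simp_all only: Imv_mat convex_UNIV UNIV_I)
  ultimately show ?thesis by (intro cvec_eqI) simp_all
qed

section \<open>Subspaces of exponentially decaying vectors\<close>

abbreviation exp_decay :: "(real \<Rightarrow> 'a::real_normed_vector) \<Rightarrow> bool" where
  "exp_decay f \<equiv> \<exists>C \<alpha>. \<alpha> > 0 \<and> (\<forall>t\<ge>0. norm (f t) \<le> C * exp (- \<alpha> * t))"

text \<open>The stable subspace of A. Since the flow of -A is the flow of A backwards in time,
  \<open>decay (- A)\<close> is the unstable one.\<close>

definition decay :: "real^'d^'d \<Rightarrow> (real^'d) set" where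
  "decay A = {x. exp_decay (\<lambda>t. flow A t x)}"

definition cdecay :: "real^'d^'d \<Rightarrow> (complex^'d) set" where
  "cdecay A = {v. exp_decay (\<lambda>t. cflow A t v)}"

lemma exp_decay_sum:
  fixes f g :: "real \<Rightarrow> 'a::real_normed_vector"
  assumes "exp_decay f"
    and "exp_decay g"
  shows "exp_decay (\<lambda>t. f t + g t)"
proof -
  obtain C \<alpha> D \<beta> where f: "\<alpha> > 0" "\<And>t. t \<ge> 0 \<Longrightarrow> norm (f t) \<le> C * exp (- \<alpha> * t)"
    and g: "\<beta> > 0" "\<And>t. t \<ge> 0 \<Longrightarrow> norm (g t) \<le> D * exp (- \<beta> * t)"
    using assms by blast
  have C: "C \<ge> 0" "D \<ge> 0"
    using order_trans[OF norm_ge_zero f(2)[of 0]] order_trans[OF norm_ge_zero g(2)[of 0]] by simp_all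
  have "norm (f t + g t) \<le> (C + D) * exp (- min \<alpha> \<beta> * t)" if t: "t \<ge> 0" for t
  proof -
    have "norm (f t) \<le> C * exp (- min \<alpha> \<beta> * t)"
      using f(2)[OF t] C t by (elim order_trans) (auto intro!: mult_left_mono mult_right_mono)
    moreover have "norm (g t) \<le> D * exp (- min \<alpha> \<beta> * t)"
      using g(2)[OF t] C t by (elim order_trans) (auto intro!: mult_left_mono mult_right_mono)
    ultimately show ?thesis
      using norm_triangle_ineq[of "f t" "g t"] by (simp add: distrib_right)
  qed
  then show ?thesis using f(1) g(1) by (metis min_less_iff_conj)
qed

lemma exp_decay_bound:
  fixes f :: "real \<Rightarrow> 'a::real_normed_vector" and g :: "real \<Rightarrow> 'b::real_normed_vector"
  assumes "exp_decay f"
    and "\<And>t. t \<ge> 0 \<Longrightarrow> norm (g t) \<le> K * norm (f t)" "K \<ge> 0"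
  shows "exp_decay g"
proof -
  obtain C \<alpha> where f: "\<alpha> > 0" "\<And>t. t \<ge> 0 \<Longrightarrow> norm (f t) \<le> C * exp (- \<alpha> * t)"
    using assms(1) by blast
  have "norm (g t) \<le> (K * C) * exp (- \<alpha> * t)" if "t \<ge> 0" for t
    using assms(2)[OF that] mult_left_mono[OF f(2)[OF that] assms(3)] by (simp add: mult.assoc)
  with f(1) show ?thesis by blast
qed

lemma vec_subspace_cdecay: "vec.subspace (cdecay A)"
  unfolding vec.subspace_def
proof (intro conjI ballI allI)
  show "0 \<in> cdecay A" by (auto simp: cdecay_def intro!: exI[of _ 0] exI[of _ 1])
  fix v w c assume v: "v \<in> cdecay A"
  { assume w: "w \<in> cdecay A"
    show "v + w \<in> cdecay A"
      using v w unfolding cdecay_def cflow_add mem_Collect_eq by (rule exp_decay_sum) }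
  show "c *s v \<in> cdecay A"
    using v unfolding cdecay_def cflow_scale mem_Collect_eq
    by (rule exp_decay_bound[where K="norm c"]) (simp_all add: norm_vector_scale)
qed

lemma linear_cmat: "linear (\<lambda>v. cmat A *v v - c *s v)"
proof -
  have "linear ((*v) (cmat A))" "linear ((*s) c :: complex^'a \<Rightarrow> complex^'a)"
    by (auto intro!: linearI simp: matrix_vector_right_distrib scaleR_eq_vector_scale vector_scalar_commute
        vec.scale_right_distrib vec.scale_scale mult.commute)
  then show ?thesis by (rule linear_compose_sub)
qed

lemma cdecay_mat: "v \<in> cdecay A \<Longrightarrow> cmat A *v v \<in> cdecay A"
proof -
  assume v: "v \<in> cdecay A"
  have "bounded_linear ((*v) (cmat A))"
    using linear_cmat[of A 0] by (simp add: linear_conv_bounded_linear)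
  from bounded_linear.pos_bounded[OF this]
  obtain K where "K > 0" "\<And>w. norm (cmat A *v w) \<le> norm w * K" by blast
  then show ?thesis
    using v unfolding cdecay_def cflow_mat mem_Collect_eq
    by (elim exp_decay_bound[where K=K]) (simp_all add: mult.commute)
qed

lemma cmat_minus_mult: "cmat (- A) *v v = - (cmat A *v v)"
  by (simp add: vec_eq_iff matrix_vector_mult_def cmat_def sum_negf)

lemma cdecay_minus_mat: "v \<in> cdecay (- A) \<Longrightarrow> cmat A *v v \<in> cdecay (- A)"
  using vec.subspace_neg[OF vec_subspace_cdecay cdecay_mat[of v "- A"]] by (simp add: cmat_minus_mult)

lemma cdecay_iff: "v \<in> cdecay A \<longleftrightarrow> Rev v \<in> decay A \<and> Imv v \<in> decay A"
proof
  assume v: "v \<in> cdecay A"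
  have "Rev v \<in> decay A"
    using v unfolding cdecay_def decay_def mem_Collect_eq
    by (rule exp_decay_bound[where K=1]) (metis Rev_cflow norm_Rev mult_1, simp)
  moreover have "Imv v \<in> decay A"
    using v unfolding cdecay_def decay_def mem_Collect_eq
    by (rule exp_decay_bound[where K=1]) (metis Imv_cflow norm_Imv mult_1, simp)
  ultimately show "Rev v \<in> decay A \<and> Imv v \<in> decay A" ..
next
  assume v: "Rev v \<in> decay A \<and> Imv v \<in> decay A"
  have "exp_decay (\<lambda>t. cvec (flow A t (Rev v)))"
    using v by (simp add: decay_def)
  moreover have "exp_decay (\<lambda>t. \<i> *s cvec (flow A t (Imv v)))"
    using v by (simp add: decay_def norm_vector_scale)
  ultimately show "v \<in> cdecay A"
    unfolding cdecay_def mem_Collect_eq cflow_def by (rule exp_decay_sum)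
qed

lemma cvec_cdecay_iff: "cvec x \<in> cdecay A \<longleftrightarrow> x \<in> decay A"
  by (simp add: cdecay_def decay_def cflow_cvec)

lemma tendsto_exp_minus:
  fixes \<alpha> :: real
  assumes "\<alpha> > 0"
  shows "((\<lambda>t. exp (- \<alpha> * t)) \<longlongrightarrow> 0) at_top"
proof -
  have "LIM t at_top. \<alpha> * t :> at_top"
    by (rule filterlim_tendsto_pos_mult_at_top[OF tendsto_const assms filterlim_ident])
  then have "LIM t at_top. - \<alpha> * t :> at_bot" unfolding filterlim_uminus_at_top by simp
  then show ?thesis by (rule filterlim_compose[OF exp_at_bot])
qed

text \<open>If Re \<mu> were nonnegative, the trajectory e^(\<mu>t) v would never be shorter than
  v.\<close>

lemma eigenvalue_cdecay_neg:
  assumes "v \<in> cdecay A" "v \<noteq> 0" "cmat A *v v = \<mu> *s v"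
  shows "Re \<mu> < 0"
proof (rule ccontr)
  assume "\<not> Re \<mu> < 0"
  obtain C \<alpha> where C: "\<alpha> > 0" "\<And>t. t \<ge> 0 \<Longrightarrow> norm (cflow A t v) \<le> C * exp (- \<alpha> * t)"
    using assms(1) by (auto simp: cdecay_def)
  have le: "norm v \<le> C * exp (- \<alpha> * t)" if t: "t \<ge> 0" for t
  proof -
    have "norm v \<le> exp (Re \<mu> * t) * norm v"
      using \<open>\<not> Re \<mu> < 0\<close> t by (simp add: mult_le_cancel_right1)
    also have "\<dots> = norm (cflow A t v)"
      by (simp add: cflow_eigenvector[OF assms(3)] norm_vector_scale)
    finally show ?thesis using C(2)[OF t] by simp
  qed
  have "((\<lambda>t. C * exp (- \<alpha> * t)) \<longlongrightarrow> C * 0) at_top"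
    by (intro tendsto_mult_left tendsto_exp_minus C(1))
  then have "norm v \<le> C * 0"
    by (rule tendsto_lowerbound) (rule eventually_at_top_linorderI[of 0], erule le, simp)
  with assms(2) show False by simp
qed

text \<open>Put s = (A - \<mu>) x. Then z(t) = e^(-\<mu>t) e^(tA) x has derivative e^(-\<mu>t)
  e^(tA) s, of norm at most C e^(\<beta>t). Integrating this bound and multiplying by e^(\<mu>t)
  leaves decay at rate \<alpha>.\<close>

lemma cdecay_resolvent:
  assumes s: "cmat A *v x - \<mu> *s x \<in> cdecay A" and \<mu>: "Re \<mu> < 0"
  shows "x \<in> cdecay A"
proof -
  let ?s = "cmat A *v x - \<mu> *s x"
  obtain C \<alpha>' where C': "\<alpha>' > 0" "\<And>t. t \<ge> 0 \<Longrightarrow> norm (cflow A t ?s) \<le> C * exp (- \<alpha>' * t)"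
    using s by (auto simp: cdecay_def)
  have C: "C \<ge> 0" using order_trans[OF norm_ge_zero C'(2)[of 0]] by simp
  \<comment> \<open>The rate is lowered to at most half of -Re \<mu>, so that \<beta> is positive;
    this avoids the resonance in which integration would produce a factor t.\<close>
  define \<alpha> where "\<alpha> = min \<alpha>' (- Re \<mu> / 2)"
  define \<beta> where "\<beta> = - Re \<mu> - \<alpha>"
  have \<alpha>: "\<alpha> > 0" "\<beta> > 0" "\<alpha> \<le> \<alpha>'" using C'(1) \<mu> by (auto simp: \<alpha>_def \<beta>_def min_def)
  have bd: "norm (cflow A t ?s) \<le> C * exp (- \<alpha> * t)" if "t \<ge> 0" for t
    using C'(2)[OF that] by (rule order_trans) (use \<alpha> C that in \<open>auto intro!: mult_left_mono mult_right_mono\<close>)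
  define z where "z t = exp (- \<mu> * of_real t) *s cflow A t x" for t
  have z': "(z has_vector_derivative exp (- \<mu> * of_real t) *s cflow A t ?s) (at t within S)" for t S
  proof -
    have "cflow A t ?s = - \<mu> *s cflow A t x + cmat A *v cflow A t x"
      using cflow_add[of A t "cmat A *v x" "(-\<mu>) *s x"]
      unfolding cflow_scale cflow_mat by simp
    then show ?thesis
      unfolding z_def using vector_scale_exp_derivative[OF cflow_vector_derivative, of "-\<mu>"] by simp
  qed
  have ub: "norm (cflow A t x) \<le> (norm x + C / \<beta>) * exp (- \<alpha> * t)" if t: "t \<ge> 0" for t
  proof (cases "t = 0")
    case True
    then show ?thesis using C \<alpha> by simp
  next
    case False
    have "norm (z t - z 0) \<le> C / \<beta> * exp (\<beta> * t) - C / \<beta> * exp (\<beta> * 0)"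
    proof (rule differentiable_bound_general[where f'="\<lambda>t. exp (- \<mu> * of_real t) *s cflow A t ?s"
          and \<phi>'="\<lambda>t. C * exp (\<beta> * t)"])
      show "0 < t" using False t by simp
      show "continuous_on {0..t} z"
        using z' by (rule continuous_on_vector_derivative)
      show "continuous_on {0..t} (\<lambda>t. C / \<beta> * exp (\<beta> * t))" by (intro continuous_intros)
      fix r assume r: "0 < r" "r < t"
      show "(z has_vector_derivative exp (- \<mu> * of_real r) *s cflow A r ?s) (at r)" by (rule z')
      show "((\<lambda>t. C / \<beta> * exp (\<beta> * t)) has_vector_derivative C * exp (\<beta> * r)) (at r)"
        using \<alpha> by (auto intro!: derivative_eq_intros simp flip: has_real_derivative_iff_has_vector_derivative)
      have "norm (exp (- \<mu> * of_real r) *s cflow A r ?s) \<le> exp (- Re \<mu> * r) * (C * exp (- \<alpha> * r))"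
        unfolding norm_vector_scale using bd[of r] r by (intro mult_mono) auto
      also have "\<dots> = C * exp (\<beta> * r)" by (simp add: \<beta>_def algebra_simps flip: exp_add)
      finally show "norm (exp (- \<mu> * of_real r) *s cflow A r ?s) \<le> C * exp (\<beta> * r)" .
    qed
    moreover have "C / \<beta> \<ge> 0" using C \<alpha> by simp
    ultimately have zt: "norm (z t) \<le> norm x + C / \<beta> * exp (\<beta> * t)"
      using norm_triangle_ineq[of "z t - z 0" "z 0"] by (simp add: z_def)
    have "cflow A t x = exp (\<mu> * of_real t) *s z t"
      by (simp add: z_def vec.scale_scale flip: exp_add)
    then have "norm (cflow A t x) = exp (Re \<mu> * t) * norm (z t)" by (simp add: norm_vector_scale)
    also have "\<dots> \<le> exp (Re \<mu> * t) * (norm x + C / \<beta> * exp (\<beta> * t))"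
      using zt by (intro mult_left_mono) auto
    also have "\<dots> = exp (Re \<mu> * t) * norm x + C / \<beta> * exp (- \<alpha> * t)"
      by (simp add: \<beta>_def algebra_simps flip: exp_add)
    also have "exp (Re \<mu> * t) * norm x \<le> exp (- \<alpha> * t) * norm x"
      using \<alpha> t mult_right_mono[of "Re \<mu>" "- \<alpha>" t] by (intro mult_right_mono) (auto simp: \<beta>_def)
    finally show ?thesis by (simp add: algebra_simps)
  qed
  with \<alpha>(1) show ?thesis unfolding cdecay_def by blast
qed

lemma injective_on_subspace_surj:
  fixes f :: "'a::euclidean_space \<Rightarrow> 'a"
  assumes "linear f" "subspace W" "f ` W \<subseteq> W" "\<And>u. u \<in> W \<Longrightarrow> f u = 0 \<Longrightarrow> u = 0"
  shows "f ` W = W"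
proof (rule subspace_dim_equal)
  have "inj_on f (span W)"
    using assms by (subst linear_inj_on_iff_eq_0) (auto simp: span_eq_iff[THEN iffD2])
  then show "dim W \<le> dim (f ` W)" using dim_image_eq[OF assms(1)] by simp
qed (use assms linear_subspace_image in auto)

lemma subspace_of_vec_subspace: "vec.subspace W \<Longrightarrow> subspace (W :: (complex^'d) set)"
  by (auto simp: subspace_def vec.subspace_def scaleR_eq_vector_scale)

lemma shifted_cmat_surj:
  assumes "vec.subspace W" "\<And>v. v \<in> W \<Longrightarrow> cmat A *v v \<in> W"
    and "\<And>v. v \<in> W \<Longrightarrow> cmat A *v v = \<mu> *s v \<Longrightarrow> v = 0" and "w \<in> W"
  shows "\<exists>u\<in>W. cmat A *v u - \<mu> *s u = w"
proof -
  have "(\<lambda>v. cmat A *v v - \<mu> *s v) ` W = W"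
    using assms by (intro injective_on_subspace_surj linear_cmat subspace_of_vec_subspace)
      (auto intro!: vec.subspace_diff vec.subspace_scale)
  then show ?thesis using assms(4) by (metis (no_types, lifting) imageE)
qed

text \<open>Since Re \<mu> < 0, \<mu> is no eigenvalue on the unstable subspace, and A - \<mu> is
  onto there. Hence w = (A - \<mu>) u with u unstable, and (A - \<mu>)(v - u) = s decays, so that v
  - u decays as well.\<close>

lemma mod_sum_decay_neg:
  assumes "cmat A *v v - \<mu> *s v = s + w" "s \<in> cdecay A" "w \<in> cdecay (- A)" "Re \<mu> < 0"
  shows "\<exists>s\<in>cdecay A. \<exists>w\<in>cdecay (- A). v = s + w"
proof -
  have "u = 0" if "u \<in> cdecay (- A)" "cmat A *v u = \<mu> *s u" for u
    using eigenvalue_cdecay_neg[OF that(1), of "-\<mu>"] that(2) assms(4) by (auto simp: cmat_minus_mult)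
  then obtain u where u: "u \<in> cdecay (- A)" "cmat A *v u - \<mu> *s u = w"
    using shifted_cmat_surj[OF vec_subspace_cdecay cdecay_minus_mat _ assms(3)] by metis
  have eq: "cmat A *v (v - u) - \<mu> *s (v - u) = s"
    using u(2) assms(1) by (simp add: matrix_vector_mult_diff_distrib vec.scale_right_diff_distrib algebra_simps)
  have "cmat A *v (v - u) - \<mu> *s (v - u) \<in> cdecay A" by (subst eq) (rule assms(2))
  then have "v - u \<in> cdecay A" using assms(4) by (rule cdecay_resolvent)
  moreover have "v = (v - u) + u" by simp
  ultimately show ?thesis using u(1) by blast
qed

lemma poly_det: "poly (det (M :: complex poly^'n^'n)) z = det (\<chi> i j. poly (M $ i $ j) z)"
  by (simp add: det_def poly_sum poly_prod)

lemma poly_char_poly_c: "poly (char_poly_c A) z = det (mat z - cmat A)"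
  unfolding char_poly_c_def poly_det
  by (rule arg_cong[where f=det]) (simp add: vec_eq_iff mat_def cmat_def)

lemma mat_scale: "mat z *v v = z *s (v :: complex^'n)"
  by (simp add: vec_eq_iff mat_def matrix_vector_mult_def if_distrib[of "\<lambda>x. x * _"] cong: if_cong)

lemma det_eq_0_iff_kernel:
  fixes M :: "'a::field^'n^'n"
  shows "det M = 0 \<longleftrightarrow> (\<exists>v. v \<noteq> 0 \<and> M *v v = 0)"
  using invertible_det_nz[of M] invertible_left_inverse[of M] matrix_left_invertible_ker[of M] by auto

lemma eigenvector_imp_eigenvalue:
  assumes "cmat A *v v = \<mu> *s v" "v \<noteq> 0"
  shows "\<mu> \<in> eigenvalues_c A"
  unfolding eigenvalues_c_def poly_char_poly_c mem_Collect_eq det_eq_0_iff_kernel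
  using assms by (intro exI[of _ v]) (simp add: matrix_vector_mult_diff_rdistrib mat_scale)

text \<open>If the sum Z of the two subspaces were proper, there would be an eigenvector modulo Z
  outside Z; each possible sign of Re \<mu> pulls it back into Z.\<close>

lemma cdecay_sum_eq_UNIV:
  assumes "hyperbolic A"
  shows "\<exists>s\<in>cdecay A. \<exists>w\<in>cdecay (- A). v = s + w"
proof (rule ccontr)
  define Z where "Z = {s + w |s w. s \<in> cdecay A \<and> w \<in> cdecay (- A)}"
  assume "\<not> ?thesis"
  then have v: "v \<notin> Z" by (auto simp: Z_def)
  have Z: "vec.subspace Z"
    unfolding Z_def by (intro vec.subspace_sums vec_subspace_cdecay)
  have ZA: "cmat A *v z \<in> Z" if "z \<in> Z" for z
    using that cdecay_mat cdecay_minus_mat by (fastforce simp: Z_def matrix_vector_right_distrib)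
  obtain u \<mu> where u: "u \<notin> Z" "cmat A *v u - \<mu> *s u \<in> Z"
    using ex_eigenvector_mod_subspace[of UNIV "cmat A" Z v] Z v by auto
  then obtain s w where sw: "cmat A *v u - \<mu> *s u = s + w" "s \<in> cdecay A" "w \<in> cdecay (- A)"
    by (auto simp: Z_def)
  consider "Re \<mu> < 0" | "Re \<mu> > 0" | "Re \<mu> = 0" by linarith
  then show False
  proof cases
    case 1
    with mod_sum_decay_neg[OF sw] u(1) show False by (auto simp: Z_def)
  next
    \<comment> \<open>Passing to -A exchanges the two subspaces and the sign of \<mu>.\<close>
    case 2
    have "cmat (-A) *v u - (-\<mu>) *s u = (-w) + (-s)"
      using sw(1) by (simp add: cmat_minus_mult algebra_simps)
    moreover have "- w \<in> cdecay (- A)" "- s \<in> cdecay (- (- A))"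
      using sw vec.subspace_neg[OF vec_subspace_cdecay] by auto
    ultimately obtain s' w' where "s' \<in> cdecay (- A)" "w' \<in> cdecay A" "u = s' + w'"
      using mod_sum_decay_neg[of "-A" u "-\<mu>" "-w" "-s"] 2 by auto
    then show False using u(1) by (auto simp: Z_def add.commute)
  next
    \<comment> \<open>Hyperbolicity makes A - \<mu> injective, hence onto on the invariant subspace
      Z. So u has the same image as some z in Z and equals it.\<close>
    case 3
    then have inj: "x = 0" if "cmat A *v x = \<mu> *s x" for x
      using eigenvector_imp_eigenvalue[OF that] assms by (auto simp: hyperbolic_def)
    obtain z where z: "z \<in> Z" "cmat A *v z - \<mu> *s z = cmat A *v u - \<mu> *s u"
      using shifted_cmat_surj[OF Z ZA _ u(2)] inj by metis
    then have "cmat A *v (u - z) = \<mu> *s (u - z)"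
      by (simp add: matrix_vector_mult_diff_distrib vec.scale_right_diff_distrib algebra_simps)
    with inj have "u - z = 0" by blast
    with u(1) z(1) show False by simp
  qed
qed

text \<open>The intersection is invariant, so if it were nonzero it would contain an eigenvector,
  whose eigenvalue would have both negative and positive real part.\<close>

lemma decay_Int_decay_minus:
  assumes "x \<in> decay A" "x \<in> decay (- A)"
  shows "x = 0"
proof (rule ccontr)
  assume "x \<noteq> 0"
  then have x: "cvec x \<noteq> 0" by (metis norm_cvec norm_eq_zero)
  let ?N = "cdecay A \<inter> cdecay (- A)"
  have "\<exists>v\<in>?N - {0}. \<exists>\<mu>. cmat A *v v - \<mu> *s v \<in> {0}"
    using x assms by (intro ex_eigenvector_mod_subspace[of _ _ _ "cvec x"] vec.subspace_inter vec_subspace_cdecay)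
      (auto simp: cdecay_mat cdecay_minus_mat cvec_cdecay_iff)
  then obtain v \<mu> where v: "v \<in> cdecay A" "v \<in> cdecay (- A)" "v \<noteq> 0" "cmat A *v v = \<mu> *s v" by auto
  have "Re \<mu> < 0" using v by (intro eigenvalue_cdecay_neg[of v A])
  moreover have "Re (- \<mu>) < 0" using v by (intro eigenvalue_cdecay_neg[of v "- A"]) (auto simp: cmat_minus_mult)
  ultimately show False by simp
qed

lemma subspace_decay: "subspace (decay A)"
  using vec_subspace_cdecay[of A, unfolded vec.subspace_def]
  by (auto simp: subspace_def linear_0[OF linear_cvec(1)] linear_add[OF linear_cvec(1)]
      linear_cmul[OF linear_cvec(1)] scaleR_eq_vector_scale simp flip: cvec_cdecay_iff)

lemma decay_mat: "x \<in> decay A \<Longrightarrow> A *v x \<in> decay A"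
  and decay_minus_mat: "x \<in> decay (- A) \<Longrightarrow> A *v x \<in> decay (- A)"
  using cdecay_mat[of "cvec x" A] cdecay_minus_mat[of "cvec x" A]
  by (simp_all add: cvec_cdecay_iff cmat_mult_vec)

text \<open>The space is the direct sum of the two invariant subspaces. Linearity, idempotence and
  commutation with A all follow from uniqueness of the decomposition.\<close>

lemma ex_unstable_projection:
  fixes A :: "real^'d^'d"
  assumes "hyperbolic A"
  obtains P :: "real^'d^'d" where "A ** P = P ** A" "P ** P = P"
    "\<And>x. P *v x \<in> decay (- A)" "\<And>x. x - P *v x \<in> decay A"
proof -
  have ex: "\<exists>w. w \<in> decay (- A) \<and> x - w \<in> decay A" for x
  proof -
    obtain s w where sw: "s \<in> cdecay A" "w \<in> cdecay (- A)" "cvec x = s + w"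
      using cdecay_sum_eq_UNIV[OF assms] by blast
    then have "x = Rev s + Rev w" by (metis Rev_Imv_cvec(1) linear_add linear_cvec(3))
    with sw(1,2) show ?thesis by (intro exI[of _ "Rev w"]) (simp add: cdecay_iff)
  qed
  define p where "p x = (SOME w. w \<in> decay (- A) \<and> x - w \<in> decay A)" for x
  have p: "p x \<in> decay (- A)" "x - p x \<in> decay A" for x
    using someI_ex[OF ex[of x]] by (auto simp: p_def)
  have uniq: "p x = w" if "w \<in> decay (- A)" "x - w \<in> decay A" for x w
  proof -
    have "p x - w \<in> decay (- A)" using p(1) that(1) subspace_decay subspace_diff by blast
    moreover have "(x - w) - (x - p x) \<in> decay A" using p(2) that(2) subspace_decay subspace_diff by blast
    then have "p x - w \<in> decay A" by simp
    ultimately show ?thesis using decay_Int_decay_minus by fastforce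
  qed
  have "linear p"
  proof (rule linearI)
    fix x y :: "real^'d" and c :: real
    have "(x - p x) + (y - p y) \<in> decay A" using p(2) subspace_decay subspace_add by blast
    then show "p (x + y) = p x + p y"
      by (intro uniq subspace_add subspace_decay p) (simp add: algebra_simps)
    have "c *\<^sub>R (x - p x) \<in> decay A" using p(2) subspace_decay subspace_scale by blast
    then show "p (c *\<^sub>R x) = c *\<^sub>R p x"
      by (intro uniq subspace_scale subspace_decay p) (simp add: algebra_simps)
  qed
  then have P: "matrix p *v x = p x" for x by (simp add: matrix_works)
  show ?thesis
  proof (rule that[of "matrix p"])
    have "A *v p x = p (A *v x)" for x
      using decay_mat[OF p(2)[of x]]
      by (intro uniq[symmetric] decay_minus_mat p) (simp add: matrix_vector_mult_diff_distrib)
    then show "A ** matrix p = matrix p ** A"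
      by (simp add: matrix_eq P flip: matrix_vector_mul_assoc)
    have "p (p x) = p x" for x
      using uniq[OF p(1)[of x], of "p x"] subspace_0[OF subspace_decay[of A]] by simp
    then show "matrix p ** matrix p = matrix p"
      by (simp add: matrix_eq P flip: matrix_vector_mul_assoc)
  qed (use p in \<open>simp_all add: P\<close>)
qed

section \<open>Growth of volume along the unstable directions\<close>

definition pencil :: "complex^'n^'n \<Rightarrow> complex^'n^'n \<Rightarrow> complex poly" where
  "pencil X Y = det (\<chi> i j. [:Y $ i $ j, X $ i $ j:])"

definition affine_mat :: "complex^'n^'n \<Rightarrow> complex^'n^'n \<Rightarrow> complex \<Rightarrow> complex^'n^'n" where
  "affine_mat X Y z = (\<chi> i j. Y $ i $ j + z * X $ i $ j)"

lemma poly_pencil: "poly (pencil X Y) z = det (affine_mat X Y z)"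
  unfolding pencil_def poly_det affine_mat_def by simp

lemma affine_mat_mult: "affine_mat X Y z *v v = Y *v v + z *s (X *v v)"
  by (simp add: affine_mat_def vec_eq_iff matrix_vector_mult_def sum.distrib distrib_right
      sum_distrib_left mult.assoc)

lemma cmat_mult: "cmat (X ** Y) *v v = cmat X *v (cmat Y *v v)"
  by (rule cvec_eqI) (simp_all add: Rev_mat Imv_mat flip: matrix_vector_mul_assoc)

text \<open>Complex polynomials are determined by their values, so a factorisation of complex
  matrices at every z suffices.\<close>

lemma poly_eq_mult_if_det_eq:
  assumes "\<And>z v. N z *v v = affine_mat X1 Y1 z *v (affine_mat X2 Y2 z *v v)"
    and "\<And>z. poly p z = det (N z)"
  shows "p = pencil X1 Y1 * pencil X2 Y2"
proof (rule poly_ext)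
  fix z
  have "N z = affine_mat X1 Y1 z ** affine_mat X2 Y2 z"
    using assms(1)[of z] by (simp add: matrix_eq matrix_vector_mul_assoc)
  then show "poly p z = poly (pencil X1 Y1 * pencil X2 Y2) z"
    by (simp add: assms(2) poly_pencil det_mul)
qed

lemma det_affine_eq_0E:
  assumes "poly (pencil X Y) z = 0"
  obtains v where "v \<noteq> 0" "Y *v v + z *s (X *v v) = 0"
  using assms unfolding poly_pencil det_eq_0_iff_kernel affine_mat_mult by blast

text \<open>The matrix zP + (1 - P) - AP is z - A on the range of P and the identity on the kernel,
  so its determinant is the characteristic polynomial of A on the unstable subspace.
  \<open>stable_poly\<close> does the same for the kernel, and \<open>idem_poly\<close> is z to the
  power of the dimension of the kernel.\<close>

abbreviation "unstable_poly A P \<equiv> pencil (cmat P) (mat 1 - cmat P - cmat (A ** P))"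
abbreviation "stable_poly A P \<equiv> pencil (mat 1 - cmat P) (cmat P - cmat A + cmat (A ** P))"
abbreviation "idem_poly P \<equiv> pencil (mat 1 - cmat P) (cmat P)"

context
  fixes A P :: "real^'d^'d"
  assumes comm: "A ** P = P ** A" and idem: "P ** P = P"
begin

lemma cmat_comm: "cmat P *v (cmat A *v v) = cmat A *v (cmat P *v v)"
  by (metis cmat_mult comm)

lemma cmat_idem: "cmat P *v (cmat P *v v) = cmat P *v v"
  by (metis cmat_mult idem)

lemmas cmat_split_simps = affine_mat_mult cmat_mult cmat_comm cmat_idem mat_scale
  matrix_vector_mult_diff_rdistrib matrix_vector_mult_add_rdistrib matrix_vector_mult_diff_distrib
  matrix_vector_right_distrib vector_scalar_commute vec.scale_right_distrib vec.scale_right_diff_distrib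

lemma char_poly_split:
  "char_poly_c A = unstable_poly A P * stable_poly A P"
  "char_poly_c (A ** P) = unstable_poly A P * idem_poly P"
  by (rule poly_eq_mult_if_det_eq[OF _ poly_char_poly_c], simp add: cmat_split_simps)+

lemma pencil_idem_root:
  assumes "poly (idem_poly P) z = 0"
  shows "z = 0"
proof (rule ccontr)
  assume "z \<noteq> 0"
  obtain v where v: "v \<noteq> 0" "cmat P *v v + z *s ((mat 1 - cmat P) *v v) = 0"
    using det_affine_eq_0E[OF assms] by blast
  then have eq: "cmat P *v v + z *s (v - cmat P *v v) = 0"
    by (simp add: cmat_split_simps)
  then have "cmat P *v (cmat P *v v + z *s (v - cmat P *v v)) = 0" by simp
  then have "cmat P *v v = 0" by (simp add: cmat_split_simps)
  with eq have "z *s v = 0" by simp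
  with \<open>z \<noteq> 0\<close> v(1) show False by simp
qed

context
  assumes dec: "\<And>x. P *v x \<in> decay (- A)" "\<And>x. x - P *v x \<in> decay A"
begin

text \<open>A root gives a kernel vector v of the pencil; applying P to the equation shows that v
  lies in the range of P and is an eigenvector of A there.\<close>

lemma pencil_unstable_root:
  assumes "poly (unstable_poly A P) z = 0"
  shows "Re z > 0"
proof -
  obtain v where v: "v \<noteq> 0" and eq': "(mat 1 - cmat P - cmat (A ** P)) *v v + z *s (cmat P *v v) = 0"
    using det_affine_eq_0E[OF assms] by blast
  then have eq: "v - cmat P *v v - cmat A *v (cmat P *v v) + z *s (cmat P *v v) = 0"
    by (simp add: cmat_split_simps)
  then have "cmat P *v (v - cmat P *v v - cmat A *v (cmat P *v v) + z *s (cmat P *v v)) = 0" by simp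
  then have 1: "z *s (cmat P *v v) = cmat A *v (cmat P *v v)" by (simp add: cmat_split_simps)
  with eq have 2: "cmat P *v v = v" by simp
  with 1 have Av: "cmat A *v v = z *s v" by simp
  have "v \<in> cdecay (- A)"
    unfolding cdecay_iff using dec(1) by (metis 2 Rev_mat Imv_mat)
  moreover have "cmat (- A) *v v = (- z) *s v" using Av by (simp add: cmat_minus_mult)
  ultimately have "Re (- z) < 0" using v by (intro eigenvalue_cdecay_neg)
  then show ?thesis by simp
qed

lemma pencil_stable_root:
  assumes "poly (stable_poly A P) z = 0"
  shows "Re z < 0"
proof -
  obtain v where v: "v \<noteq> 0"
    and eq': "(cmat P - cmat A + cmat (A ** P)) *v v + z *s ((mat 1 - cmat P) *v v) = 0"
    using det_affine_eq_0E[OF assms] by blast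
  then have eq: "cmat P *v v - cmat A *v v + cmat A *v (cmat P *v v) + z *s (v - cmat P *v v) = 0"
    by (simp add: cmat_split_simps)
  then have "cmat P *v (cmat P *v v - cmat A *v v + cmat A *v (cmat P *v v) + z *s (v - cmat P *v v)) = 0"
    by simp
  then have 2: "cmat P *v v = 0" by (simp add: cmat_split_simps)
  with eq have Av: "cmat A *v v = z *s v" by simp
  have "P *v Rev v = 0" "P *v Imv v = 0"
    using 2 linear_0[OF linear_cvec(3)] linear_0[OF linear_cvec(4)] by (metis Rev_mat, metis Imv_mat)
  then have "v \<in> cdecay A"
    unfolding cdecay_iff using dec(2)[of "Rev v"] dec(2)[of "Imv v"] by simp
  then show ?thesis using v Av by (rule eigenvalue_cdecay_neg)
qed

end

end

section \<open>Liouville's formula for the determinant of the flow\<close>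

lemma det_mat: "det (mat c :: 'a::comm_ring_1^'n^'n) = c ^ CARD('n)"
  by (subst det_diagonal) (simp_all add: mat_def)

text \<open>Intended for identities obtained by the substitution of 1 / s, where s = 0 has to be
  left out. Multiplying by the indeterminate makes both sides agree at 0 too.\<close>

lemma poly_eqI_nonzero:
  fixes p q :: "complex poly"
  assumes "\<And>z. z \<noteq> 0 \<Longrightarrow> poly p z = poly q z"
  shows "p = q"
proof -
  have "poly ([:0, 1:] * p) z = poly ([:0, 1:] * q) z" for z
    using assms by (cases "z = 0") auto
  then have "[:0, 1:] * p = [:0, 1:] * q" by (rule poly_ext)
  then show ?thesis by (simp only: mult_cancel_left) simp
qed

text \<open>Up to the sign of s, det (1 + s M) is the reversed characteristic polynomial. Degree and
  leading coefficient of the latter are not read off the determinant but deduced from the value 1 of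
  the reversed polynomial at 0.\<close>

lemma det_minus_scaled_char_poly:
  fixes M :: "real^'n^'n"
  defines "\<chi>' \<equiv> char_poly_c M"
  shows "\<chi>' \<noteq> 0"
    and "det (affine_mat (cmat M) (mat 1) s) = (\<Prod>\<mu> | poly \<chi>' \<mu> = 0. (1 + s * \<mu>) ^ order \<mu> \<chi>')"
proof -
  define R where "R = pencil (- cmat M) (mat 1)"
  have R0: "poly R 0 = 1"
  proof -
    have "affine_mat (- cmat M) (mat 1) 0 = mat 1" by (simp add: affine_mat_def vec_eq_iff)
    then show ?thesis by (simp add: R_def poly_pencil)
  qed
  have R: "poly R s = s ^ CARD('n) * poly \<chi>' (1 / s)" if "s \<noteq> 0" for s
  proof -
    have "affine_mat (- cmat M) (mat 1) s = mat s ** (mat (1 / s) - cmat M)"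
      using that unfolding matrix_eq affine_mat_mult
      by (auto simp: mat_scale matrix_vector_mult_diff_rdistrib vec.scale_right_diff_distrib vec.scale_scale
          simp flip: matrix_vector_mul_assoc)
        (simp add: vec_eq_iff matrix_vector_mult_def sum_negf)
    then show ?thesis
      by (simp add: R_def poly_pencil det_mul det_mat \<chi>'_def poly_char_poly_c)
  qed
  show nz: "\<chi>' \<noteq> 0"
  proof
    assume "\<chi>' = 0"
    then have "R = 0" using R by (intro poly_eqI_nonzero) auto
    with R0 show False by simp
  qed
  define c where "c = lead_coeff \<chi>'"
  define Rt where "Rt = {\<mu>. poly \<chi>' \<mu> = 0}"
  define k where "k = (\<Sum>\<mu>\<in>Rt. order \<mu> \<chi>')"
  define Q where "Q = (\<Prod>\<mu>\<in>Rt. [:1, - \<mu>:] ^ order \<mu> \<chi>')"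
  have fin: "finite Rt" using nz by (simp add: Rt_def poly_roots_finite)
  have \<chi>'s: "s ^ k * poly \<chi>' (1 / s) = c * poly Q s" if "s \<noteq> 0" for s
  proof -
    have "poly \<chi>' (1 / s) = c * (\<Prod>\<mu>\<in>Rt. (1 / s - \<mu>) ^ order \<mu> \<chi>')"
      by (subst complex_poly_decompose[symmetric]) (simp add: poly_prod c_def Rt_def)
    moreover have "s ^ k * (\<Prod>\<mu>\<in>Rt. (1 / s - \<mu>) ^ order \<mu> \<chi>') = poly Q s"
      using that unfolding k_def Q_def power_sum poly_prod prod.distrib[symmetric]
      by (intro prod.cong) (auto simp: algebra_simps simp flip: power_mult_distrib)
    ultimately show ?thesis by simp
  qed
  have eq: "R * [:0, 1:] ^ k = smult c ([:0, 1:] ^ CARD('n) * Q)"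
  proof (rule poly_eqI_nonzero)
    fix s :: complex assume s: "s \<noteq> 0"
    show "poly (R * [:0, 1:] ^ k) s = poly (smult c ([:0, 1:] ^ CARD('n) * Q)) s"
      using \<chi>'s[OF s] s by (simp add: R[OF s] mult.commute)
  qed
  have Q0: "poly Q 0 = 1" by (simp add: Q_def poly_prod)
  have c: "c \<noteq> 0" using nz by (simp add: c_def)
  \<comment> \<open>R and Q do not vanish at 0, so the order of the root 0 counts the explicit
    factors on each side; this identifies the number of roots k with the dimension.\<close>
  have "order 0 (R * [:0, 1:] ^ k) = k"
    using R0 order_power_n_n[of "0::complex" k] by (subst order_mult) (auto simp: order_0I)
  moreover have "order 0 (smult c ([:0, 1:] ^ CARD('n) * Q)) = CARD('n)"
    using Q0 c order_power_n_n[of "0::complex" "CARD('n)"]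
    by (subst order_smult, simp, subst order_mult) (auto simp: order_0I)
  ultimately have "k = CARD('n)" by (simp add: eq)
  with eq have "[:0, 1:] ^ k * R = [:0, 1:] ^ k * smult c Q" by (simp add: mult.commute)
  then have RQ: "R = smult c Q" by (simp only: mult_cancel_left) auto
  with R0 Q0 have "c = 1" by simp
  then have "poly R (- s) = (\<Prod>\<mu>\<in>Rt. (1 + s * \<mu>) ^ order \<mu> \<chi>')"
    by (simp add: RQ Q_def poly_prod)
  moreover have "affine_mat (- cmat M) (mat 1) (- s) = affine_mat (cmat M) (mat 1) s"
    by (simp add: affine_mat_def vec_eq_iff)
  ultimately show "det (affine_mat (cmat M) (mat 1) s) = (\<Prod>\<mu> | poly \<chi>' \<mu> = 0. (1 + s * \<mu>) ^ order \<mu> \<chi>')"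
    by (simp add: R_def poly_pencil Rt_def)
qed

text \<open>The trace of M. Non-real eigenvalues come in conjugate pairs of equal multiplicity, so
  the real parts suffice.\<close>

definition eig_sum :: "real^'n^'n \<Rightarrow> real" where
  "eig_sum M = (\<Sum>z\<in>eigenvalues_c M. real (alg_mult M z) * Re z)"

lemma finite_eigenvalues_c: "finite (eigenvalues_c M)"
  unfolding eigenvalues_c_def by (rule poly_roots_finite[OF det_minus_scaled_char_poly(1)])

lemma det_cmat: "det (cmat X) = complex_of_real (det X)"
  by (simp add: det_def cmat_def)

lemma det_one_plus_derivative:
  fixes M :: "real^'n^'n"
  shows "((\<lambda>s. det (mat 1 + s *\<^sub>R M)) has_real_derivative eig_sum M) (at 0)"
proof -
  let ?E = "eigenvalues_c M" and ?o = "\<lambda>\<mu>. order \<mu> (char_poly_c M)"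
  let ?F = "\<lambda>s. \<Prod>\<mu>\<in>?E. (1 + s * \<mu>) ^ ?o \<mu>"
  have "(?F has_field_derivative ?F 0 * (\<Sum>\<mu>\<in>?E. (of_nat (?o \<mu>) * \<mu>) / (1 + 0 * \<mu>) ^ ?o \<mu>)) (at 0)"
  proof (rule has_field_derivative_prod')
    show "((\<lambda>s. (1 + s * \<mu>) ^ ?o \<mu>) has_field_derivative of_nat (?o \<mu>) * \<mu>) (at 0)" for \<mu>
      by (auto intro!: derivative_eq_intros)
  qed simp
  then have F: "(?F has_field_derivative (\<Sum>\<mu>\<in>?E. of_nat (?o \<mu>) * \<mu>)) (at (of_real 0))" by simp
  have "((\<lambda>s. Re (?F (of_real s))) has_vector_derivative Re (\<Sum>\<mu>\<in>?E. of_nat (?o \<mu>) * \<mu>)) (at 0)"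
    by (rule bounded_linear.has_vector_derivative[OF bounded_linear_Re has_vector_derivative_real_field[OF F]])
  moreover have "det (mat 1 + s *\<^sub>R M) = Re (?F (of_real s))" for s
  proof -
    have "cmat (mat 1 + s *\<^sub>R M) = affine_mat (cmat M) (mat 1) (of_real s)"
      by (simp add: cmat_def affine_mat_def vec_eq_iff mat_def)
    then have "complex_of_real (det (mat 1 + s *\<^sub>R M)) = ?F (of_real s)"
      unfolding eigenvalues_c_def by (metis det_cmat det_minus_scaled_char_poly(2))
    then show ?thesis by (metis Re_complex_of_real)
  qed
  ultimately show ?thesis
    by (simp add: has_real_derivative_iff_has_vector_derivative eig_sum_def alg_mult_def)
qed

lemma det_has_real_derivative:
  fixes F :: "real \<Rightarrow> real^'n^'n"
  assumes "\<And>i j. ((\<lambda>s. F s $ i $ j) has_real_derivative F' $ i $ j) (at a)"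
  shows "((\<lambda>s. det (F s)) has_real_derivative
    (\<Sum>p | p permutes UNIV. of_int (sign p) *
      (\<Sum>i\<in>UNIV. F' $ i $ p i * (\<Prod>j\<in>UNIV - {i}. F a $ j $ p j)))) (at a)"
  unfolding det_def by (intro DERIV_sum DERIV_cmult has_field_derivative_prod assms)

text \<open>The derivative of a determinant depends only on the entries and their first derivatives,
  so e^(sM) can be replaced by 1 + s M at s = 0.\<close>

lemma det_derivative_cong:
  fixes F G :: "real \<Rightarrow> real^'n^'n"
  assumes "\<And>i j. ((\<lambda>s. F s $ i $ j) has_real_derivative F' $ i $ j) (at a)"
    and "\<And>i j. ((\<lambda>s. G s $ i $ j) has_real_derivative F' $ i $ j) (at a)"
    and "F a = G a" and D: "((\<lambda>s. det (F s)) has_real_derivative D) (at a)"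
  shows "((\<lambda>s. det (G s)) has_real_derivative D) (at a)"
  using det_has_real_derivative[of F F' a] det_has_real_derivative[of G F' a] DERIV_unique[OF D] assms
  by simp

text \<open>Liouville's formula. The group law makes g multiplicative, so g' = g'(0) g, and g'(0) is
  the first-order coefficient of det (1 + s M).\<close>

lemma det_flow: "det (matrix (flow M t)) = exp (t * eig_sum M)"
proof -
  define g where "g t = det (matrix (flow M t))" for t
  let ?c = "eig_sum M"
  have g0: "(g has_real_derivative ?c) (at 0)"
    unfolding g_def
  proof (rule det_derivative_cong[OF _ _ _ det_one_plus_derivative])
    fix i j
    show "((\<lambda>s. (mat 1 + s *\<^sub>R M) $ i $ j) has_real_derivative M $ i $ j) (at 0)"
      by (auto intro!: derivative_eq_intros)
    have "((\<lambda>s. flow M s (axis j 1) $ i) has_vector_derivative (M *v flow M 0 (axis j 1)) $ i) (at 0)"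
      by (rule bounded_linear.has_vector_derivative[OF bounded_linear_vec_nth flow_vector_derivative])
    moreover have "(M *v axis j 1) $ i = M $ i $ j"
      by (simp add: matrix_vector_mult_basis column_def)
    ultimately show "((\<lambda>s. matrix (flow M s) $ i $ j) has_real_derivative M $ i $ j) (at 0)"
      by (simp add: matrix_def has_real_derivative_iff_has_vector_derivative)
  next
    have "flow M 0 = (\<lambda>x. x)" by auto
    then show "mat 1 + 0 *\<^sub>R M = matrix (flow M 0)"
      by (simp add: matrix_id_mat_1[unfolded id_def])
  qed
  have g_add: "g (s + t) = g s * g t" for s t
  proof -
    have "flow M (s + t) = flow M s \<circ> flow M t" by (auto simp: flow_add)
    then show ?thesis
      by (simp add: g_def matrix_compose linear_flow det_mul)
  qed
  have gt: "(g has_real_derivative g t * ?c) (at t)" for t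
  proof -
    have "((\<lambda>s. g t * g (s + - t)) has_real_derivative g t * ?c) (at t)"
      using g0 DERIV_shift[of g ?c t "- t"] by (intro DERIV_cmult) simp
    moreover have "g t * g (s + - t) = g s" for s by (simp flip: g_add)
    ultimately show ?thesis by simp
  qed
  have "((\<lambda>t. g t * exp (- (t * ?c))) has_real_derivative 0) (at t)" for t
    by (auto intro!: derivative_eq_intros gt simp: algebra_simps)
  then have "g t * exp (- (t * ?c)) = g 0 * exp (- (0 * ?c))"
    using DERIV_isconst_all by blast
  moreover have "g 0 = 1"
  proof -
    have "flow M 0 = (\<lambda>x. x)" by auto
    then show ?thesis by (simp add: g_def matrix_id_mat_1[unfolded id_def])
  qed
  ultimately show ?thesis by (simp add: g_def exp_minus field_simps)
qed

text \<open>Comparing both factorisations, eigenvalues with positive real part keep their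
  multiplicity in A P, those with negative real part disappear, and the new eigenvalue 0 has weight
  zero in the sum.\<close>

lemma eig_sum_unstable:
  fixes A P :: "real^'d^'d"
  assumes comm: "A ** P = P ** A" and idem: "P ** P = P"
    and dec: "\<And>x. P *v x \<in> decay (- A)" "\<And>x. x - P *v x \<in> decay A"
  shows "eig_sum (A ** P) = (\<Sum>z\<in>eigenvalues_c A. real (alg_mult A z) * max 0 (Re z))"
proof -
  note split = char_poly_split[OF comm idem]
  note nz = det_minus_scaled_char_poly(1)
  have ord: "real (alg_mult (A ** P) z) * Re z = real (alg_mult A z) * max 0 (Re z)" for z
  proof (cases "Re z > 0")
    case True
    then have "order z (idem_poly P) = 0"
      "order z (stable_poly A P) = 0"
      using pencil_stable_root[OF comm idem dec, of z] pencil_idem_root[OF comm idem, of z]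
      by (force intro!: order_0I)+
    then have "alg_mult A z = alg_mult (A ** P) z"
      using nz[of A] nz[of "A ** P"] unfolding alg_mult_def split by (simp add: order_mult)
    then show ?thesis using True by simp
  next
    case False
    show ?thesis
    proof (cases "Re z = 0")
      case False
      then have "order z (idem_poly P) = 0"
        "order z (unstable_poly A P) = 0"
        using pencil_unstable_root[OF comm idem dec, of z] pencil_idem_root[OF comm idem, of z]
          \<open>\<not> Re z > 0\<close> by (force intro!: order_0I)+
      then have "alg_mult (A ** P) z = 0"
        using nz[of "A ** P"] unfolding alg_mult_def split by (simp add: order_mult)
      then show ?thesis using \<open>\<not> Re z > 0\<close> by simp
    qed simp
  qed
  have zero: "alg_mult M z = 0" if "z \<notin> eigenvalues_c M" for M :: "real^'d^'d" and z
    using that by (simp add: alg_mult_def eigenvalues_c_def order_0I)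
  \<comment> \<open>The two spectra differ, so the comparison takes place on their union, where
    surplus points have multiplicity zero.\<close>
  have "eig_sum (A ** P) = (\<Sum>z\<in>eigenvalues_c (A ** P) \<union> eigenvalues_c A. real (alg_mult (A ** P) z) * Re z)"
    unfolding eig_sum_def by (rule sum.mono_neutral_left) (auto simp: zero finite_eigenvalues_c)
  also have "\<dots> = (\<Sum>z\<in>eigenvalues_c A. real (alg_mult A z) * max 0 (Re z))"
    unfolding ord by (rule sum.mono_neutral_right) (auto simp: zero finite_eigenvalues_c)
  finally show ?thesis .
qed


section \<open>Uniform exponential estimates\<close>

lemma exp_decay_finite_sum:
  fixes f :: "'b \<Rightarrow> real \<Rightarrow> 'a::real_normed_vector"
  assumes "finite S" "\<And>i. i \<in> S \<Longrightarrow> exp_decay (f i)"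
  shows "exp_decay (\<lambda>t. \<Sum>i\<in>S. f i t)"
  using assms
proof (induction S rule: finite_induct)
  case empty
  then show ?case by (auto intro!: exI[of _ 0] exI[of _ 1])
next
  case (insert i S)
  show ?case
    unfolding sum.insert[OF insert.hyps]
    by (rule exp_decay_sum[OF insert.prems[OF insertI1] insert.IH[OF insert.prems[OF insertI2]]])
qed

text \<open>Decay on the finitely many basis vectors bounds the operator norm of T t.\<close>

lemma uniform_decay:
  fixes T :: "real \<Rightarrow> 'a::euclidean_space \<Rightarrow> 'b::real_normed_vector"
  assumes lin: "\<And>t. linear (T t)"
    and dec: "\<And>x. exp_decay (\<lambda>t. T t x)"
  shows "\<exists>C \<alpha>. C \<ge> 0 \<and> \<alpha> > 0 \<and> (\<forall>t\<ge>0. \<forall>x. norm (T t x) \<le> C * exp (- \<alpha> * t) * norm x)"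
proof -
  have "exp_decay (\<lambda>t. \<Sum>b\<in>Basis. norm (T t b))"
    by (rule exp_decay_finite_sum) (use dec in simp_all)
  then obtain C \<alpha> where \<alpha>: "\<alpha> > 0"
    and C: "\<And>t. t \<ge> 0 \<Longrightarrow> (\<Sum>b\<in>Basis. norm (T t b)) \<le> C * exp (- \<alpha> * t)"
    by (auto simp: abs_of_nonneg sum_nonneg)
  have "norm (T t x) \<le> C * exp (- \<alpha> * t) * norm x" if t: "t \<ge> 0" for t x
  proof -
    have "T t x = T t (\<Sum>b\<in>Basis. (x \<bullet> b) *\<^sub>R b)" by (simp add: euclidean_representation)
    also have "\<dots> = (\<Sum>b\<in>Basis. (x \<bullet> b) *\<^sub>R T t b)"
      by (simp add: linear_sum[OF lin] linear_cmul[OF lin])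
    also have "norm \<dots> \<le> (\<Sum>b\<in>Basis. norm x * norm (T t b))"
      by (intro sum_norm_le) (simp add: Basis_le_norm mult_right_mono)
    also have "\<dots> \<le> norm x * (C * exp (- \<alpha> * t))"
      unfolding sum_distrib_left[symmetric] by (intro mult_left_mono C t) simp
    finally show ?thesis by (simp add: mult.commute)
  qed
  moreover have "C \<ge> 0"
    using C[of 0] sum_nonneg[of Basis "\<lambda>b. norm (T 0 b)"] by simp
  ultimately show ?thesis using \<alpha> by blast
qed

locale hyperbolic_splitting =
  fixes A P :: "real^'d^'d" and C \<alpha> :: real
  assumes comm: "A ** P = P ** A" and idem: "P ** P = P"
    and C: "C \<ge> 0" and \<alpha>: "\<alpha> > 0"
    and stable: "\<And>t x. t \<ge> 0 \<Longrightarrow> norm (flow A t (x - P *v x)) \<le> C * exp (- \<alpha> * t) * norm x"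
    and unstable: "\<And>t x. t \<ge> 0 \<Longrightarrow> norm (flow A (- t) (P *v x)) \<le> C * exp (- \<alpha> * t) * norm x"
begin

lemma P_idem: "P *v (P *v x) = P *v x"
  by (simp add: matrix_vector_mul_assoc idem)

lemma P_flow: "P *v flow A t x = flow A t (P *v x)"
  by (rule matrix_flow_commute[OF comm])

text \<open>The flow of A P expands the unstable component like e^(tA) and freezes the stable one.
  All volume counts use this map, since it sees the expansion without the contraction.\<close>

lemma flow_unstable_part: "flow (A ** P) t x = flow A t (P *v x) + (x - P *v x)"
proof -
  let ?y = "\<lambda>t. flow A t (P *v x) + (x - P *v x)"
  have "(?y has_vector_derivative (A ** P) *v ?y t) (at t within UNIV)" for t
  proof -
    have "(?y has_vector_derivative A *v flow A t (P *v x) + 0) (at t within UNIV)"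
      by (intro has_vector_derivative_add flow_vector_derivative has_vector_derivative_const)
    moreover have "(A ** P) *v ?y t = A *v flow A t (P *v x)"
      by (simp add: matrix_vector_right_distrib matrix_vector_mult_diff_distrib P_flow P_idem
          flip: matrix_vector_mul_assoc)
    ultimately show ?thesis by simp
  qed
  from flow_unique[OF _ _ this, of t] show ?thesis by simp
qed

end

lemma ex_hyperbolic_splitting:
  fixes A :: "real^'d^'d"
  assumes "hyperbolic A"
  obtains P C \<alpha> where "hyperbolic_splitting A P C \<alpha>"
    "eig_sum (A ** P) = (\<Sum>z\<in>eigenvalues_c A. real (alg_mult A z) * max 0 (Re z))"
proof -
  obtain P :: "real^'d^'d" where P: "A ** P = P ** A" "P ** P = P"
    and dec: "\<And>x. P *v x \<in> decay (- A)" "\<And>x. x - P *v x \<in> decay A"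
    using ex_unstable_projection[OF assms] by blast
  have lin: "linear (\<lambda>x. flow A t (P *v x))" "linear (\<lambda>x. flow A t (x - P *v x))" for t
    by (auto intro!: linearI simp: flow_simps matrix_vector_right_distrib algebra_simps matrix_vector_mult_scaleR)
  have "\<exists>C \<alpha>. C \<ge> 0 \<and> \<alpha> > 0 \<and> (\<forall>t\<ge>0. \<forall>x. norm (flow A t (x - P *v x)) \<le> C * exp (- \<alpha> * t) * norm x)"
    by (rule uniform_decay[OF lin(2)]) (use dec(2) in \<open>simp add: decay_def\<close>)
  then obtain C \<alpha> where s: "C \<ge> 0" "\<alpha> > 0"
    "\<forall>t\<ge>0. \<forall>x. norm (flow A t (x - P *v x)) \<le> C * exp (- \<alpha> * t) * norm x" by blast
  have "\<exists>C \<alpha>. C \<ge> 0 \<and> \<alpha> > 0 \<and> (\<forall>t\<ge>0. \<forall>x. norm (flow A (- t) (P *v x)) \<le> C * exp (- \<alpha> * t) * norm x)"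
    by (rule uniform_decay[OF lin(1)]) (use dec(1) in \<open>simp add: decay_def flow_minus_matrix\<close>)
  then obtain D \<beta> where u: "D \<ge> 0" "\<beta> > 0"
    "\<forall>t\<ge>0. \<forall>x. norm (flow A (- t) (P *v x)) \<le> D * exp (- \<beta> * t) * norm x" by blast
  have mono: "D * exp (- \<beta> * t) * r \<le> D' * exp (- \<beta>' * t) * r"
    if "t \<ge> 0" "r \<ge> 0" "0 \<le> D" "D \<le> D'" "\<beta>' \<le> \<beta>" for t r D D' \<beta> \<beta>' :: real
    using that by (intro mult_right_mono mult_mono) (auto intro: mult_right_mono)
  have "hyperbolic_splitting A P (max C D) (min \<alpha> \<beta>)"
  proof
    fix t :: real and x :: "real^'d" assume t: "t \<ge> 0"
    show "norm (flow A t (x - P *v x)) \<le> max C D * exp (- min \<alpha> \<beta> * t) * norm x"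
      using s(3)[rule_format, OF t] mono[OF t norm_ge_zero s(1), of "max C D" "min \<alpha> \<beta>" \<alpha>]
      by (rule order_trans) simp_all
    show "norm (flow A (- t) (P *v x)) \<le> max C D * exp (- min \<alpha> \<beta> * t) * norm x"
      using u(3)[rule_format, OF t] mono[OF t norm_ge_zero u(1), of "max C D" "min \<alpha> \<beta>" \<beta>]
      by (rule order_trans) simp_all
  qed (use P s u in auto)
  then show ?thesis using eig_sum_unstable[OF P dec] by (rule that)
qed

section \<open>Solutions of the control system\<close>

lemma admissible_iff_negligible:
  "w \<in> admissible U \<longleftrightarrow> w \<in> borel_measurable lebesgue \<and> (\<exists>N. negligible N \<and> {t. w t \<notin> U} \<subseteq> N)"
  by (simp add: admissible_def eventually_ae_filter_negligible)

lemma admissible_const: "u \<in> U \<Longrightarrow> (\<lambda>_. u) \<in> admissible U"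
  by (simp add: admissible_def)

lemma admissible_shift:
  assumes "w \<in> admissible U"
  shows "(\<lambda>t. w (t + s)) \<in> admissible U"
proof -
  from assms obtain N where w: "w \<in> borel_measurable lebesgue" "negligible N" "{t. w t \<notin> U} \<subseteq> N"
    by (auto simp: admissible_iff_negligible)
  have "(\<lambda>t::real. t + s) \<in> lebesgue \<rightarrow>\<^sub>M lebesgue"
    using lebesgue_affine_measurable[of "\<lambda>_::real. 1" s] by (simp add: add.commute)
  then have "(\<lambda>t. w (t + s)) \<in> borel_measurable lebesgue"
    using w(1) by (rule measurable_compose)
  moreover have "{t. w (t + s) \<notin> U} \<subseteq> (\<lambda>t. - s + t) ` N"
  proof
    fix t assume "t \<in> {t. w (t + s) \<notin> U}"
    then have "t + s \<in> N" using w(3) by auto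
    then show "t \<in> (\<lambda>t. - s + t) ` N" by (rule rev_image_eqI) simp
  qed
  ultimately show ?thesis
    unfolding admissible_iff_negligible using negligible_translation[OF w(2), of "- s"] by blast
qed

text \<open>The second control starts with its own clock at 0; at the switching time s itself it is
  already in force.\<close>

definition conc :: "real \<Rightarrow> (real \<Rightarrow> 'a) \<Rightarrow> (real \<Rightarrow> 'a) \<Rightarrow> real \<Rightarrow> 'a" where
  "conc s w1 w2 = (\<lambda>t. if t < s then w1 t else w2 (t - s))"

lemma conc_shift_self: "conc s w (\<lambda>t. w (t + s)) = w"
  by (auto simp: conc_def)

lemma admissible_conc:
  assumes "w1 \<in> admissible U" "w2 \<in> admissible U"
  shows "conc s w1 w2 \<in> admissible U"
proof -
  have 2: "(\<lambda>t. w2 (t - s)) \<in> admissible U"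
    using admissible_shift[OF assms(2), of "-s"] by simp
  have "{x \<in> space lebesgue. x < s} \<in> sets lebesgue" by simp
  then have "(\<lambda>t. if t < s then w1 t else w2 (t - s)) \<in> borel_measurable lebesgue"
    using assms(1) 2 by (intro measurable_If) (auto simp: admissible_def)
  moreover have "AE t in lebesgue. (if t < s then w1 t else w2 (t - s)) \<in> U"
    using assms(1) 2 by (auto simp: admissible_def elim!: AE_mp)
  ultimately show ?thesis by (simp add: admissible_def conc_def)
qed

text \<open>f is continuous only on U, and w may leave U on a null set. Tietze's theorem extends f
  to the whole space with the same bound, and the composition with the extension is
  measurable.\<close>

lemma admissible_integral:
  fixes f :: "real^'m \<Rightarrow> 'e::euclidean_space"
  assumes w: "w \<in> admissible U" and U: "compact U" and f: "continuous_on U f"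
    and b: "b \<ge> 0" "\<And>u. u \<in> U \<Longrightarrow> norm (f u) \<le> b"
  shows "(\<lambda>t. f (w t)) integrable_on {s..t}"
    and "s \<le> t \<Longrightarrow> norm (integral {s..t} (\<lambda>t. f (w t))) \<le> b * (t - s)"
proof -
  obtain g where g: "continuous_on UNIV g" "\<And>u. u \<in> U \<Longrightarrow> g u = f u" "\<And>u. norm (g u) \<le> b"
    using Tietze[of U f UNIV b] f b U by (auto simp: compact_imp_closed)
  obtain N where N: "w \<in> borel_measurable lebesgue" "negligible N" "{t. w t \<notin> U} \<subseteq> N"
    using w by (auto simp: admissible_iff_negligible)
  have eq: "f (w r) = g (w r)" if "r \<in> {s..t} - N" for r
    using N(3) g(2) that by (metis DiffE mem_Collect_eq subsetD)
  have "(\<lambda>t. g (w t)) \<in> borel_measurable lebesgue"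
    using N(1) borel_measurable_continuous_onI[OF g(1)] by (rule measurable_compose)
  then have "(\<lambda>t. g (w t)) \<in> borel_measurable (lebesgue_on {s..t})"
    by (rule measurable_restrict_space1)
  then have "(\<lambda>t. g (w t)) absolutely_integrable_on {s..t}"
    by (rule measurable_bounded_by_integrable_imp_absolutely_integrable[where g="\<lambda>_. b"])
      (use g(3) in auto)
  then have int: "(\<lambda>t. g (w t)) integrable_on {s..t}"
    by (simp add: absolutely_integrable_on_def)
  then show "(\<lambda>t. f (w t)) integrable_on {s..t}"
    using N(2) eq by (rule integrable_spike)
  assume st: "s \<le> t"
  have "integral {s..t} (\<lambda>t. f (w t)) = integral {s..t} (\<lambda>t. g (w t))"
    using N(2) eq by (intro integral_spike[of N]) auto
  moreover have "norm (integral {s..t} (\<lambda>t. g (w t))) \<le> integral {s..t} (\<lambda>_. b)"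
    using int g(3) by (intro integral_norm_bound_integral) auto
  ultimately show "norm (integral {s..t} (\<lambda>t. f (w t))) \<le> b * (t - s)"
    using st by (simp add: mult.commute)
qed

lemma continuous_on_atLeast_if_Icc:
  fixes f :: "real \<Rightarrow> 'a::topological_space"
  assumes "\<And>T. continuous_on {a..T} f"
  shows "continuous_on {a..} f"
  unfolding continuous_on_eq_continuous_within
proof
  fix x assume x: "x \<in> {a..}"
  have "continuous (at x within {a..x+1}) f"
    using assms[of "x+1"] x by (auto simp: continuous_on_eq_continuous_within)
  moreover have "at x within {a..x+1} = at x within {a..}"
    using x by (intro at_within_nhd[of _ "{..<x+1}"]) auto
  ultimately show "continuous (at x within {a..}) f" by simp
qed

lemma is_solutionD:
  assumes "is_solution A B x w y" "0 \<le> t"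
  shows "integral {0..t} (\<lambda>s. A *v y s + B *v w s) = y t - x"
proof -
  have "y t = x + integral {0..t} (\<lambda>s. A *v y s + B *v w s)"
    using assms unfolding is_solution_def by blast
  then show ?thesis by simp
qed

section \<open>Existence, uniqueness and concatenation of trajectories\<close>

locale control_system =
  fixes A :: "real^'d^'d" and B :: "real^'m^'d" and U :: "(real^'m) set"
  assumes compact_U: "compact U" and zero_U: "0 \<in> interior U"
begin

abbreviation "adm \<equiv> admissible U"
abbreviation "\<phi> \<equiv> phi A B"

lemma zero_in_U: "0 \<in> U"
  using zero_U interior_subset by blast

lemma adm_zero: "(\<lambda>_. 0) \<in> adm"
  by (rule admissible_const[OF zero_in_U])

definition KB :: real where "KB = (SOME b. b \<ge> 0 \<and> (\<forall>u\<in>U. norm (B *v u) \<le> b))"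

lemma KB: "KB \<ge> 0" "u \<in> U \<Longrightarrow> norm (B *v u) \<le> KB"
proof -
  have "bounded ((*v) B ` U)"
    using compact_U by (intro compact_imp_bounded compact_continuous_image linear_continuous_on) auto
  then have "\<exists>b. b \<ge> 0 \<and> (\<forall>u\<in>U. norm (B *v u) \<le> b)"
    by (metis (no_types, lifting) bounded_pos image_eqI less_imp_le)
  from someI_ex[OF this] show "KB \<ge> 0" "u \<in> U \<Longrightarrow> norm (B *v u) \<le> KB"
    by (auto simp: KB_def)
qed

definition \<Omega> :: "(real \<Rightarrow> real^'m) \<Rightarrow> real \<Rightarrow> real^'d" where
  "\<Omega> w t = integral {0..t} (\<lambda>s. B *v w s)"

lemma integrable_B: "w \<in> adm \<Longrightarrow> (\<lambda>s. B *v w s) integrable_on {a..b}"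
  by (rule admissible_integral(1)[OF _ compact_U _ KB]) (auto intro: linear_continuous_on)

lemma norm_\<Omega>:
  assumes "w \<in> adm" "t \<ge> 0"
  shows "norm (\<Omega> w t) \<le> KB * t"
proof -
  have "norm (integral {0..t} (\<lambda>s. B *v w s)) \<le> KB * (t - 0)"
    by (rule admissible_integral(2)[OF _ compact_U _ KB]) (use assms in \<open>auto intro: linear_continuous_on\<close>)
  then show ?thesis by (simp add: \<Omega>_def)
qed

lemma continuous_\<Omega>: "w \<in> adm \<Longrightarrow> continuous_on {0..T} (\<Omega> w)"
  unfolding \<Omega>_def[abs_def] by (intro indefinite_integral_continuous_1 integrable_B)

text \<open>For z = y - \<open>\<Omega> w\<close> the equation reads z' = A z + A
  \<open>\<Omega> w\<close> with z(0) = x; the second summand is its variation-of-constants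
  solution.\<close>

definition sol :: "real^'d \<Rightarrow> (real \<Rightarrow> real^'m) \<Rightarrow> real \<Rightarrow> real^'d" where
  "sol x w t = \<Omega> w t + flow A t (x + integral {0..t} (\<lambda>s. flow A (- s) (A *v \<Omega> w s)))"

lemma continuous_matrix_mult: "continuous_on S g \<Longrightarrow> continuous_on S (\<lambda>s. M *v g s)"
  for M :: "real^'a^'b"
  by (intro bounded_linear.continuous_on[OF matrix_vector_mul_bounded_linear])

lemma continuous_sol_integrand:
  "w \<in> adm \<Longrightarrow> continuous_on {0..T} (\<lambda>s. flow A (- s) (A *v \<Omega> w s))"
  by (intro continuous_on_flow continuous_matrix_mult continuous_\<Omega> continuous_intros)

lemma continuous_sol: "w \<in> adm \<Longrightarrow> continuous_on {0..T} (sol x w)"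
  unfolding sol_def[abs_def]
  by (intro continuous_on_add continuous_on_flow continuous_\<Omega> continuous_on_id continuous_on_const
      indefinite_integral_continuous_1 integrable_continuous_real continuous_sol_integrand)

text \<open>Subtracting \<^term>\<open>\<Omega> w\<close> turns the integral equation, whose integrand is only measurable,
  into a differential equation with continuous right-hand side.\<close>

lemma is_solution_sol:
  assumes w: "w \<in> adm"
  shows "is_solution A B x w (sol x w)"
  unfolding is_solution_def
proof (intro conjI allI impI)
  show "continuous_on {0..} (sol x w)"
    by (rule continuous_on_atLeast_if_Icc) (rule continuous_sol[OF w])
  fix T :: real assume T: "T \<ge> 0"
  define z where "z t = flow A t (x + integral {0..t} (\<lambda>s. flow A (- s) (A *v \<Omega> w s)))" for t
  have "(z has_vector_derivative A *v sol x w t) (at t within {0..T})" if t: "t \<in> {0..T}" for t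
  proof -
    have "((\<lambda>t. x + integral {0..t} (\<lambda>s. flow A (- s) (A *v \<Omega> w s))) has_vector_derivative
        0 + flow A (- t) (A *v \<Omega> w t)) (at t within {0..T})"
      by (intro has_vector_derivative_add has_vector_derivative_const
          integral_has_vector_derivative continuous_sol_integrand w t)
    from flow_has_vector_derivative_comp[OF this, of A 1]
    show ?thesis
      by (simp add: z_def[abs_def] sol_def flow_simps matrix_vector_right_distrib matrix_flow)
  qed
  then have "((\<lambda>t. A *v sol x w t) has_integral (z T - z 0)) {0..T}"
    by (rule fundamental_theorem_of_calculus[OF T])
  moreover have "z 0 = x" by (simp add: z_def)
  ultimately have "((\<lambda>t. A *v sol x w t + B *v w t) has_integral (z T - x + \<Omega> w T)) {0..T}"
    unfolding \<Omega>_def by (intro has_integral_add integrable_integral integrable_B w) auto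
  then have "integral {0..T} (\<lambda>t. A *v sol x w t + B *v w t) = z T - x + \<Omega> w T"
    by (rule integral_unique)
  then show "sol x w T = x + integral {0..T} (\<lambda>t. A *v sol x w t + B *v w t)"
    by (simp add: sol_def z_def)
qed

text \<open>In the difference d of two solutions the control cancels. What remains, d(t) =
  \<integral> A d, has a continuous integrand, so d solves the homogeneous equation with d(0) =
  0.\<close>

lemma is_solution_unique:
  assumes w: "w \<in> adm" and y: "is_solution A B x w y1" "is_solution A B x w y2" and T: "T \<ge> 0"
  shows "y1 T = y2 T"
proof -
  define d where "d t = y1 t - y2 t" for t
  have cont: "continuous_on {0..T} y" if "is_solution A B x w y" for y
    using that unfolding is_solution_def by (meson atLeastAtMost_iff atLeast_iff continuous_on_subset subsetI)
  have int: "(\<lambda>s. A *v y s + B *v w s) integrable_on {0..t}" if "is_solution A B x w y" "t \<le> T" for y t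
    using cont[OF that(1)] that(2)
    by (intro integrable_add integrable_B w integrable_continuous_real continuous_matrix_mult)
      (auto elim: continuous_on_subset)
  have d: "d t = integral {0..t} (\<lambda>s. A *v d s)" if t: "t \<in> {0..T}" for t
  proof -
    have "d t = integral {0..t} (\<lambda>s. A *v y1 s + B *v w s) - integral {0..t} (\<lambda>s. A *v y2 s + B *v w s)"
      using t by (simp add: is_solutionD[OF y(1)] is_solutionD[OF y(2)] d_def)
    also have "\<dots> = integral {0..t} (\<lambda>s. A *v d s)"
      using int[OF y(1)] int[OF y(2)] t
      by (subst integral_diff[symmetric]) (auto simp: d_def matrix_vector_mult_diff_distrib)
    finally show ?thesis .
  qed
  have contd: "continuous_on {0..T} (\<lambda>s. A *v d s)"
    unfolding d_def by (intro continuous_matrix_mult continuous_on_diff cont y)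
  have "(d has_vector_derivative A *v d t) (at t within {0..T})" if t: "t \<in> {0..T}" for t
    by (rule has_vector_derivative_transform[OF t _ integral_has_vector_derivative[OF contd t]]) (rule d)
  then have "d T = flow A T (d 0)"
    using T by (intro flow_unique[of "{0..T}"]) auto
  also have "d 0 = 0" using d[of 0] T by simp
  finally show ?thesis by (simp add: d_def flow_simps)
qed

text \<open>Uniqueness makes the description \<open>THE\<close> in \<open>phi\<close> well defined;
  everything known about \<open>phi\<close> passes through this rule.\<close>

lemma phi_eq:
  assumes "w \<in> adm" "is_solution A B x w y" "t \<ge> 0"
  shows "\<phi> t x w = y t"
  unfolding phi_def using assms is_solution_unique by (intro the_equality) blast+

lemma phi_eq_sol: "w \<in> adm \<Longrightarrow> t \<ge> 0 \<Longrightarrow> \<phi> t x w = sol x w t"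
  by (rule phi_eq[OF _ is_solution_sol])

lemma is_solution_phi:
  assumes "w \<in> adm"
  shows "is_solution A B x w (\<lambda>t. \<phi> t x w)"
proof -
  note sol = is_solution_sol[OF assms, of x]
  have "continuous_on {0..} (\<lambda>t. \<phi> t x w)"
    using sol unfolding is_solution_def
    by (elim conjE continuous_on_eq) (simp add: phi_eq_sol[OF assms])
  moreover have "\<phi> t x w = x + integral {0..t} (\<lambda>s. A *v \<phi> s x w + B *v w s)" if "t \<ge> 0" for t
  proof -
    have "integral {0..t} (\<lambda>s. A *v \<phi> s x w + B *v w s) = integral {0..t} (\<lambda>s. A *v sol x w s + B *v w s)"
      by (rule integral_cong) (simp add: phi_eq_sol[OF assms])
    then show ?thesis using is_solutionD[OF sol that] that by (simp add: phi_eq_sol[OF assms])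
  qed
  ultimately show ?thesis by (simp add: is_solution_def)
qed

lemma phi_0: "w \<in> adm \<Longrightarrow> \<phi> 0 x w = x"
  by (simp add: phi_eq_sol sol_def \<Omega>_def)

lemma phi_affine: "w \<in> adm \<Longrightarrow> t \<ge> 0 \<Longrightarrow> \<phi> t x w = flow A t x + \<phi> t 0 w"
  by (simp add: phi_eq_sol sol_def flow_simps)

lemma phi_diff: "w \<in> adm \<Longrightarrow> t \<ge> 0 \<Longrightarrow> \<phi> t x w - \<phi> t y w = flow A t (x - y)"
  using phi_affine[of w t x] phi_affine[of w t y] by (simp add: flow_simps)

lemma phi_zero_control: "t \<ge> 0 \<Longrightarrow> \<phi> t x (\<lambda>_. 0) = flow A t x"
  by (simp add: phi_eq_sol[OF adm_zero] sol_def \<Omega>_def flow_simps)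

lemma continuous_phi: "w \<in> adm \<Longrightarrow> continuous_on {0..} (\<lambda>t. \<phi> t x w)"
  using is_solution_phi[of w x] unfolding is_solution_def by blast

lemma continuous_phi_init:
  assumes "w \<in> adm" "t \<ge> 0"
  shows "continuous_on S (\<lambda>x. \<phi> t x w)"
proof -
  have eq: "(\<lambda>x. \<phi> t x w) = (\<lambda>x. flow A t x + \<phi> t 0 w)" by (rule ext) (rule phi_affine[OF assms])
  show ?thesis unfolding eq by (intro continuous_intros continuous_on_flow)
qed

lemma is_solution_conc:
  assumes w: "w1 \<in> adm" "w2 \<in> adm" and s: "s \<ge> 0"
  shows "is_solution A B x (conc s w1 w2) (\<lambda>t. if t \<le> s then \<phi> t x w1 else \<phi> (t - s) (\<phi> s x w1) w2)"
    (is "is_solution _ _ _ _ ?y")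
  unfolding is_solution_def
proof (intro conjI allI impI)
  have "continuous_on ({0..s} \<union> {s..}) ?y"
  proof (intro continuous_on_cases)
    show "continuous_on {0..s} (\<lambda>t. \<phi> t x w1)"
      using continuous_phi[OF w(1)] by (rule continuous_on_subset) auto
    show "continuous_on {s..} (\<lambda>t. \<phi> (t - s) (\<phi> s x w1) w2)"
      by (rule continuous_on_compose2[OF continuous_phi[OF w(2)]]) (auto intro!: continuous_intros)
  qed (auto simp: phi_0 w)
  moreover have "{0..s} \<union> {s..} = {0..}" using s by auto
  ultimately show cont: "continuous_on {0..} ?y" by simp
  let ?F = "\<lambda>r. A *v ?y r + B *v conc s w1 w2 r"
  have int: "?F integrable_on {0..t}" for t
    by (intro integrable_add integrable_B admissible_conc w integrable_continuous_real
        continuous_matrix_mult continuous_on_subset[OF cont]) auto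
  have upto: "integral {0..t} ?F = \<phi> t x w1 - x" if t: "t \<ge> 0" "t \<le> s" for t
  proof -
    have "integral {0..t} ?F = integral {0..t} (\<lambda>r. A *v \<phi> r x w1 + B *v w1 r)"
      \<comment> \<open>At the single time s the concatenation already follows
        \<open>w2\<close>.\<close>
      using t by (intro integral_spike[of "{s}"]) (auto simp: conc_def)
    then show ?thesis
      using t by (simp add: is_solutionD[OF is_solution_phi[OF w(1)]])
  qed
  fix t :: real assume t: "t \<ge> 0"
  show "?y t = x + integral {0..t} ?F"
  proof (cases "t \<le> s")
    case True
    then show ?thesis using upto t by simp
  next
    case False
    have "integral {0..t} ?F = integral {0..s} ?F + integral {s..t} ?F"
      by (rule Henstock_Kurzweil_Integration.integral_combine[symmetric, OF s _ int]) (use False in simp)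
    also have "integral {s..t} ?F = integral {s - s..t - s} (\<lambda>r. ?F (r + s))"
      by (rule integral_shift_real_ivl[symmetric])
    also have "\<dots> = integral {0..t - s} (\<lambda>r. A *v \<phi> r (\<phi> s x w1) w2 + B *v w2 r)"
    proof -
      \<comment> \<open>At r = 0 the trajectory is given by its first branch, which agrees with the
        second one there.\<close>
      have "?F (r + s) = A *v \<phi> r (\<phi> s x w1) w2 + B *v w2 r" if "r \<in> {0..t - s}" for r
        using that by (cases "r = 0") (auto simp: conc_def phi_0 w)
      then show ?thesis by (auto intro: integral_cong)
    qed
    also have "\<dots> = \<phi> (t - s) (\<phi> s x w1) w2 - \<phi> s x w1"
      using False by (simp add: is_solutionD[OF is_solution_phi[OF w(2)]])
    finally show ?thesis using False upto[OF s] by simp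
  qed
qed

lemma phi_conc_le:
  assumes "w1 \<in> adm" "w2 \<in> adm" "0 \<le> t" "t \<le> s"
  shows "\<phi> t x (conc s w1 w2) = \<phi> t x w1"
  using phi_eq[OF admissible_conc is_solution_conc, of w1 w2 s t x] assms by simp

lemma phi_conc:
  assumes "w1 \<in> adm" "w2 \<in> adm" "0 \<le> s" "0 \<le> t"
  shows "\<phi> (s + t) x (conc s w1 w2) = \<phi> t (\<phi> s x w1) w2"
  using phi_eq[OF admissible_conc is_solution_conc, of w1 w2 s "s + t" x] assms
  by (cases "t = 0") (auto simp: phi_0)

lemma phi_shift:
  assumes "w \<in> adm" "0 \<le> s" "0 \<le> t"
  shows "\<phi> (s + t) x w = \<phi> t (\<phi> s x w) (\<lambda>r. w (r + s))"
  using phi_conc[OF assms(1) admissible_shift[OF assms(1)] assms(2,3), of x s] by (simp add: conc_shift_self)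

lemma phi_bounded:
  obtains M where "M > 0" "\<And>t w. w \<in> adm \<Longrightarrow> 0 \<le> t \<Longrightarrow> t \<le> T \<Longrightarrow> norm (\<phi> t 0 w) \<le> M"
proof -
  define E where "E = exp (\<bar>T\<bar> * norm (endo_of_matrix A))"
  have fl: "norm (flow A s x) \<le> E * norm x" if "\<bar>s\<bar> \<le> \<bar>T\<bar>" for s x
    using norm_flow_le[of A s x] that unfolding E_def
    by (elim order_trans) (auto intro!: mult_right_mono)
  have E: "E \<ge> 0" by (simp add: E_def)
  obtain a where a: "a > 0" "\<And>x. norm (A *v x) \<le> norm x * a"
    using bounded_linear.pos_bounded[OF matrix_vector_mul_bounded_linear, of A] by blast
  define M where "M = KB * \<bar>T\<bar> + E * (E * (KB * \<bar>T\<bar> * a) * \<bar>T\<bar>) + 1"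
  have "norm (\<phi> t 0 w) \<le> M" if w: "w \<in> adm" and t: "0 \<le> t" "t \<le> T" for t w
  proof -
    have O: "norm (\<Omega> w s) \<le> KB * \<bar>T\<bar>" if "0 \<le> s" "s \<le> t" for s
      using norm_\<Omega>[OF w that(1)] mult_left_mono[OF _ KB(1), of s "\<bar>T\<bar>"] that t by linarith
    have "norm (flow A (- s) (A *v \<Omega> w s)) \<le> E * (KB * \<bar>T\<bar> * a)" if s: "0 \<le> s" "s \<le> t" for s
    proof -
      have "norm (A *v \<Omega> w s) \<le> KB * \<bar>T\<bar> * a"
        using a(2)[of "\<Omega> w s"] mult_right_mono[OF O[OF s], of a] a(1) by linarith
      with fl[of "- s" "A *v \<Omega> w s"] s t show ?thesis
        using mult_left_mono[OF _ E, of "norm (A *v \<Omega> w s)" "KB * \<bar>T\<bar> * a"] by auto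
    qed
    then have "norm (integral {0..t} (\<lambda>s. flow A (- s) (A *v \<Omega> w s))) \<le> integral {0..t} (\<lambda>_. E * (KB * \<bar>T\<bar> * a))"
      by (intro integral_norm_bound_integral integrable_continuous_real continuous_sol_integrand w) auto
    also have "\<dots> \<le> E * (KB * \<bar>T\<bar> * a) * \<bar>T\<bar>"
    proof -
      have "integral {0..t} (\<lambda>_. E * (KB * \<bar>T\<bar> * a)) = E * (KB * \<bar>T\<bar> * a) * t" using t by simp
      also have "\<dots> \<le> E * (KB * \<bar>T\<bar> * a) * \<bar>T\<bar>"
        using t E KB(1) a(1) by (intro mult_left_mono) auto
      finally show ?thesis .
    qed
    finally have "norm (flow A t (integral {0..t} (\<lambda>s. flow A (- s) (A *v \<Omega> w s)))) \<le> E * (E * (KB * \<bar>T\<bar> * a) * \<bar>T\<bar>)"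
      using fl[of t] t by (intro order_trans[OF fl] mult_left_mono E) auto
    then show ?thesis
      using O[OF t(1) order_refl] t unfolding phi_eq_sol[OF w t(1)] sol_def M_def
      by (intro norm_triangle_le) simp
  qed
  moreover have "M > 0" unfolding M_def using E KB(1) a(1) by (intro add_nonneg_pos) auto
  ultimately show ?thesis using that by blast
qed

end

section \<open>Reachability and the control set\<close>

locale controllable_system = control_system A B U
  for A :: "real^'d^'d" and B :: "real^'m^'d" and U +
  assumes controllable: "controllable_pair A B"
begin

text \<open>The state reached from 0, written for arbitrary continuous controls. Without the
  constraint to U it is linear in the control, so the reachable states form a subspace.\<close>

definition steer :: "real \<Rightarrow> (real \<Rightarrow> real^'m) \<Rightarrow> real^'d" where
  "steer s w = integral {0..s} (\<lambda>\<sigma>. flow A (s - \<sigma>) (B *v w \<sigma>))"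

lemma steer_integrable:
  "continuous_on UNIV w \<Longrightarrow> (\<lambda>\<sigma>. flow A (s - \<sigma>) (B *v w \<sigma>)) integrable_on {a..b}"
  by (intro integrable_continuous_real continuous_on_flow continuous_matrix_mult continuous_intros)
    (auto elim: continuous_on_subset)

lemma steer_add:
  "continuous_on UNIV w \<Longrightarrow> continuous_on UNIV v \<Longrightarrow> steer s (\<lambda>t. w t + v t) = steer s w + steer s v"
  unfolding steer_def
  by (subst integral_add[symmetric]) (simp_all add: steer_integrable matrix_vector_right_distrib flow_simps)

lemma steer_scale: "steer s (\<lambda>t. c *\<^sub>R w t) = c *\<^sub>R steer s w"
  by (simp add: steer_def matrix_vector_mult_scaleR flow_simps)

lemma steer_zero: "steer s (\<lambda>_. 0) = 0"
  by (simp add: steer_def flow_simps)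

lemma steer_sum:
  assumes "\<And>b. b \<in> S \<Longrightarrow> continuous_on UNIV (w b)"
  shows "steer s (\<lambda>t. \<Sum>b\<in>S. c b *\<^sub>R w b t) = (\<Sum>b\<in>S. c b *\<^sub>R steer s (w b))"
  using assms
  by (induction S rule: infinite_finite_induct)
    (simp_all add: steer_zero steer_add steer_scale continuous_intros)

text \<open>Differentiating \<eta> \<bullet> e^(\<tau>A) B u = 0 repeatedly on the whole interval
  and putting \<tau> = 0 makes \<eta> orthogonal to all A^k B u, which span the space by Kalman's
  condition.\<close>

lemma orthogonal_flow_image_imp_0:
  assumes s: "s > 0" and \<eta>: "\<And>\<tau> u. \<tau> \<in> {0..s} \<Longrightarrow> \<eta> \<bullet> flow A \<tau> (B *v u) = 0"
  shows "\<eta> = 0"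
proof -
  have zero: "\<forall>\<tau>\<in>{0..s}. \<eta> \<bullet> flow A \<tau> (((\<lambda>M. A ** M) ^^ k) B *v u) = 0" for k u
  proof (induction k)
    case 0
    then show ?case using \<eta> by simp
  next
    case (Suc k)
    let ?v = "((\<lambda>M. A ** M) ^^ k) B *v u"
    show ?case
    proof
      fix \<tau> assume \<tau>: "\<tau> \<in> {0..s}"
      have "((\<lambda>t. \<eta> \<bullet> flow A t ?v) has_vector_derivative \<eta> \<bullet> (A *v flow A \<tau> ?v)) (at \<tau> within {0..s})"
        by (rule bounded_linear.has_vector_derivative[OF bounded_linear_inner_right flow_vector_derivative])
      moreover have "((\<lambda>t. \<eta> \<bullet> flow A t ?v) has_vector_derivative 0) (at \<tau> within {0..s})"
        by (rule has_vector_derivative_transform[OF \<tau> _ has_vector_derivative_const[of 0]]) (use Suc in auto)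
      ultimately have "\<eta> \<bullet> (A *v flow A \<tau> ?v) = 0"
        using vector_derivative_unique_within_closed_interval[of 0 s \<tau>] s \<tau> by simp
      then show "\<eta> \<bullet> flow A \<tau> (((\<lambda>M. A ** M) ^^ Suc k) B *v u) = 0"
        by (simp add: matrix_flow flip: matrix_vector_mul_assoc)
    qed
  qed
  have "\<eta> \<bullet> x = 0" if "x \<in> {(((\<lambda>M. A ** M) ^^ k) B) *v u | k u. k < CARD('d)}" for x
    using that zero[THEN bspec, of 0] s by auto
  then have "span {(((\<lambda>M. A ** M) ^^ k) B) *v u | k u. k < CARD('d)} \<subseteq> {x. \<eta> \<bullet> x = 0}"
    by (intro span_minimal subspace_hyperplane) blast
  then have "\<eta> \<bullet> \<eta> = 0" using controllable unfolding controllable_pair_def by blast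
  then show ?thesis by simp
qed

text \<open>If the vector \<^term>\<open>\<eta>\<close> is orthogonal to everything that can be reached, then the control that is dual to
  \<^term>\<open>\<eta>\<close> has vanishing energy.\<close>

lemma steer_surj:
  assumes s: "s > 0"
  shows "\<exists>w. continuous_on UNIV w \<and> steer s w = y"
proof -
  define R where "R = {steer s w |w. continuous_on UNIV w}"
  have sub: "subspace R"
    unfolding subspace_def R_def
  proof (safe, goal_cases)
    case 1
    then show ?case by (metis continuous_on_const steer_zero)
  next
    case (2 _ _ w v)
    then show ?case by (intro exI[of _ "\<lambda>t. w t + v t"]) (simp add: steer_add continuous_intros)
  next
    case (3 c _ w)
    then show ?case by (intro exI[of _ "\<lambda>t. c *\<^sub>R w t"]) (simp add: steer_scale continuous_intros)
  qed
  have "span R = UNIV"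
  proof (rule ccontr)
    assume "span R \<noteq> UNIV"
    then obtain \<eta> where \<eta>: "\<eta> \<noteq> 0" "\<And>x. x \<in> span R \<Longrightarrow> \<eta> \<bullet> x = 0"
      using span_not_UNIV_orthogonal by blast
    define w where "w \<sigma> = (\<chi> j. \<eta> \<bullet> flow A (s - \<sigma>) (B *v axis j 1))" for \<sigma>
    have w: "continuous_on UNIV w"
      unfolding w_def
      by (intro continuous_on_vec_lambda continuous_on_inner continuous_on_const continuous_on_flow continuous_intros)
    have dual: "\<eta> \<bullet> flow A (s - \<sigma>) (B *v u) = w \<sigma> \<bullet> u" for \<sigma> u
    proof -
      have lin: "linear (\<lambda>u. flow A (s - \<sigma>) (B *v u))"
        by (intro linearI) (simp_all add: matrix_vector_right_distrib matrix_vector_mult_scaleR flow_simps)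
      have u: "u = (\<Sum>j\<in>UNIV. u $ j *\<^sub>R axis j 1)"
        using basis_expansion[of u] by (simp add: scalar_mult_eq_scaleR)
      have "flow A (s - \<sigma>) (B *v u) = flow A (s - \<sigma>) (B *v (\<Sum>j\<in>UNIV. u $ j *\<^sub>R axis j 1))"
        by (rule arg_cong[OF u])
      also have "\<dots> = (\<Sum>j\<in>UNIV. u $ j *\<^sub>R flow A (s - \<sigma>) (B *v axis j 1))"
        by (simp only: linear_sum[OF lin] linear_cmul[OF lin])
      finally have "\<eta> \<bullet> flow A (s - \<sigma>) (B *v u) =
          (\<Sum>j\<in>UNIV. u $ j * (\<eta> \<bullet> flow A (s - \<sigma>) (B *v axis j 1)))"
        by (simp add: inner_sum_right)
      also have "\<dots> = w \<sigma> \<bullet> u" unfolding inner_vec_def[of "w \<sigma>"] by (simp add: w_def mult.commute)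
      finally show ?thesis .
    qed
    have "steer s w \<in> span R" using w by (auto simp: R_def intro!: span_base)
    then have "0 = \<eta> \<bullet> steer s w" using \<eta>(2) by simp
    also have "\<dots> = integral {0..s} (\<lambda>\<sigma>. \<eta> \<bullet> flow A (s - \<sigma>) (B *v w \<sigma>))"
      unfolding steer_def
      using integral_linear[OF steer_integrable[OF w] bounded_linear_inner_right[of \<eta>]] by (simp add: o_def)
    also have "\<dots> = integral {0..s} (\<lambda>\<sigma>. w \<sigma> \<bullet> w \<sigma>)" by (simp add: dual)
    finally have "\<forall>\<sigma>\<in>{0..s}. w \<sigma> \<bullet> w \<sigma> = 0"
      using s w by (subst (asm) eq_commute, subst (asm) integral_eq_0_iff)
        (auto intro!: continuous_on_inner elim: continuous_on_subset)
    then have "\<eta> \<bullet> flow A \<tau> (B *v u) = 0" if "\<tau> \<in> {0..s}" for \<tau> u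
      using dual[of "s - \<tau>" u] that by simp
    with \<eta>(1) orthogonal_flow_image_imp_0[OF s] show False by blast
  qed
  then have "y \<in> R" using sub span_eq_iff[of R] by simp
  then show ?thesis by (auto simp: R_def)
qed

lemma phi_continuous_control:
  assumes w: "continuous_on UNIV w" "w \<in> adm" and s: "s \<ge> 0"
  shows "\<phi> s 0 w = steer s w"
proof -
  let ?I = "\<lambda>t. integral {0..t} (\<lambda>\<sigma>. flow A (- \<sigma>) (B *v w \<sigma>))"
  have cont: "continuous_on S (\<lambda>\<sigma>. flow A (- \<sigma>) (B *v w \<sigma>))" for S
    by (intro continuous_on_flow continuous_matrix_mult continuous_intros continuous_on_subset[OF w(1)]) auto
  have contI: "continuous_on {0..T} (\<lambda>t. flow A t (?I t))" for T
    by (intro continuous_on_flow continuous_on_id indefinite_integral_continuous_1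
        integrable_continuous_real cont)
  have "is_solution A B 0 w (\<lambda>t. flow A t (?I t))"
    unfolding is_solution_def
  proof (intro conjI allI impI)
    show "continuous_on {0..} (\<lambda>t. flow A t (?I t))"
      by (rule continuous_on_atLeast_if_Icc) (rule contI)
    fix T :: real assume T: "T \<ge> 0"
    have "((\<lambda>t. flow A t (?I t)) has_vector_derivative A *v flow A t (?I t) + B *v w t) (at t within {0..T})"
      if t: "t \<in> {0..T}" for t
      using flow_has_vector_derivative_comp[OF integral_has_vector_derivative[OF cont t], of A 1]
      by (simp add: flow_simps matrix_flow add.commute)
    from fundamental_theorem_of_calculus[OF T this]
    show "flow A T (?I T) = 0 + integral {0..T} (\<lambda>s. A *v flow A s (?I s) + B *v w s)"
      by (simp add: integral_unique flow_simps)
  qed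
  then have "\<phi> s 0 w = flow A s (?I s)" using w(2) s by (intro phi_eq)
  also have "\<dots> = steer s w"
    using integral_linear[OF integrable_continuous_real[OF cont] bounded_linear_flow[of A s], of 0 s]
    by (simp add: steer_def o_def flip: flow_add)
  finally show ?thesis .
qed

text \<open>Fix a continuous control steering 0 to each basis vector. The linear combination with
  the coordinates of c steers to c, and it is uniformly small if c is small, hence takes values in
  U.\<close>

lemma small_control:
  assumes s: "s > 0"
  obtains \<rho> where "\<rho> > 0" "\<And>c. norm c < \<rho> \<Longrightarrow> \<exists>w\<in>adm. \<phi> s 0 w = c"
proof -
  obtain r where r: "r > 0" "cball 0 r \<subseteq> U"
    using zero_U by (meson mem_interior_cball)
  obtain wb where wb: "\<And>b. continuous_on UNIV (wb b)" "\<And>b. steer s (wb b) = b"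
    using steer_surj[OF s] by metis
  have "\<exists>M. \<forall>t\<in>{0..s}. norm (wb b t) \<le> M" for b
  proof -
    have "compact (wb b ` {0..s})"
      by (intro compact_continuous_image continuous_on_subset[OF wb(1)]) auto
    then show ?thesis by (meson bounded_iff compact_imp_bounded image_eqI)
  qed
  then obtain M where M: "\<And>b t. t \<in> {0..s} \<Longrightarrow> norm (wb b t) \<le> M b" by metis
  define M' where "M' = (\<Sum>b\<in>Basis. \<bar>M b\<bar>) + 1"
  have M': "M' > 0" unfolding M'_def by (intro add_nonneg_pos sum_nonneg) auto
  have "\<exists>w\<in>adm. \<phi> s 0 w = c" if c: "norm c < r / M'" for c
  proof -
    define v where "v t = (\<Sum>b\<in>Basis. (c \<bullet> b) *\<^sub>R wb b t)" for t
    \<comment> \<open>Freezing the control outside [0, s] keeps it continuous and keeps its values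
      in U at all times.\<close>
    define w where "w t = v (max 0 (min s t))" for t
    have v: "continuous_on UNIV v" unfolding v_def by (intro continuous_intros wb(1))
    have w: "continuous_on UNIV w"
      unfolding w_def by (rule continuous_on_compose2[OF v]) (auto intro!: continuous_intros)
    have "norm (v t) \<le> r" if t: "t \<in> {0..s}" for t
    proof -
      have "norm (v t) \<le> (\<Sum>b\<in>Basis. norm c * \<bar>M b\<bar>)"
        unfolding v_def
      proof (intro sum_norm_le)
        fix b :: "real^'d" assume b: "b \<in> Basis"
        have "norm (wb b t) \<le> \<bar>M b\<bar>" using M[OF t, of b] by linarith
        then show "norm ((c \<bullet> b) *\<^sub>R wb b t) \<le> norm c * \<bar>M b\<bar>"
          using Basis_le_norm[OF b, of c] by (simp add: mult_mono)
      qed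
      also have "\<dots> \<le> norm c * M'" unfolding sum_distrib_left[symmetric] M'_def by (intro mult_left_mono) auto
      also have "\<dots> \<le> r" using c M' by (simp add: field_simps)
      finally show ?thesis .
    qed
    then have "w t \<in> U" for t using r(2) s by (auto simp: w_def)
    moreover have "w \<in> borel_measurable lebesgue"
      using borel_measurable_continuous_onI[OF w] by (simp add: measurable_completion)
    ultimately have adm: "w \<in> adm" by (simp add: admissible_def)
    have "\<phi> s 0 w = steer s w" using s by (intro phi_continuous_control w adm) simp
    also have "\<dots> = steer s v"
      unfolding steer_def by (rule integral_cong) (simp add: w_def)
    also have "\<dots> = (\<Sum>b\<in>Basis. (c \<bullet> b) *\<^sub>R b)" unfolding v_def by (subst steer_sum) (simp_all add: wb)
    also have "\<dots> = c" by (rule euclidean_representation)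
    finally show ?thesis using adm by blast
  qed
  moreover have "r / M' > 0" using r M' by simp
  ultimately show ?thesis using that by blast
qed

lemma small_reach:
  assumes s: "s > 0"
  obtains \<rho> where "\<rho> > 0" "\<And>x c. norm (c - flow A s x) < \<rho> \<Longrightarrow> \<exists>w\<in>adm. \<phi> s x w = c"
proof -
  obtain \<rho> where \<rho>: "\<rho> > 0" "\<And>c. norm c < \<rho> \<Longrightarrow> \<exists>w\<in>adm. \<phi> s 0 w = c"
    using small_control[OF s] by blast
  have "\<exists>w\<in>adm. \<phi> s x w = c" if c: "norm (c - flow A s x) < \<rho>" for x c
  proof -
    obtain w where w: "w \<in> adm" "\<phi> s 0 w = c - flow A s x" using \<rho>(2)[OF c] by blast
    then have "\<phi> s x w = c" using phi_affine[OF w(1), of s x] s by simp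
    with w(1) show ?thesis by blast
  qed
  with \<rho>(1) show ?thesis using that by blast
qed

section \<open>Reachability and mutual reachability\<close>

definition reach :: "real^'d \<Rightarrow> real^'d \<Rightarrow> bool" where
  "reach x y \<longleftrightarrow> (\<exists>t\<ge>0. \<exists>w\<in>adm. \<phi> t x w = y)"

lemma orbit_pos_eq: "orbit_pos A B U x = {y. reach x y}"
  by (auto simp: orbit_pos_def reach_def)

lemma reach_refl: "reach x x"
  unfolding reach_def using phi_0[OF adm_zero] adm_zero by blast

lemma reach_phi: "w \<in> adm \<Longrightarrow> t \<ge> 0 \<Longrightarrow> reach x (\<phi> t x w)"
  unfolding reach_def by blast

lemma reach_trans:
  assumes "reach x y" "reach y z"
  shows "reach x z"
proof -
  obtain s w1 t w2 where "s \<ge> 0" "w1 \<in> adm" "\<phi> s x w1 = y" "t \<ge> 0" "w2 \<in> adm" "\<phi> t y w2 = z"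
    using assms unfolding reach_def by blast
  then have "\<phi> (s + t) x (conc s w1 w2) = z" by (simp add: phi_conc)
  moreover have "s + t \<ge> 0" using \<open>s \<ge> 0\<close> \<open>t \<ge> 0\<close> by simp
  ultimately show ?thesis
    unfolding reach_def using admissible_conc[OF \<open>w1 \<in> adm\<close> \<open>w2 \<in> adm\<close>] by blast
qed

lemma reach_phi_later:
  assumes "w \<in> adm" "0 \<le> t" "t \<le> T"
  shows "reach (\<phi> t x w) (\<phi> T x w)"
  using phi_shift[OF assms(1,2), of "T - t" x] reach_phi[OF admissible_shift[OF assms(1)], of "T - t"] assms
  by simp

definition mutual :: "real^'d \<Rightarrow> real^'d \<Rightarrow> bool" where
  "mutual x y \<longleftrightarrow> reach x y \<and> reach y x"

lemma mutual_sym: "mutual x y \<Longrightarrow> mutual y x"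
  and mutual_trans: "mutual x y \<Longrightarrow> mutual y z \<Longrightarrow> mutual x z"
  by (auto simp: mutual_def intro: reach_trans)

text \<open>The last s units of the loop use the control 0, which leaves room for perturbations.
  Starting near x they can be used to hit x exactly, and starting at x to hit any given point
  nearby.\<close>

lemma loop_neighbourhood:
  assumes w: "w \<in> adm" and t: "t \<ge> 0" and s: "s > 0" and loop: "\<phi> (t + s) x (conc t w (\<lambda>_. 0)) = x"
  obtains \<delta> where "\<delta> > 0" "\<And>y. dist y x < \<delta> \<Longrightarrow> mutual y x"
proof -
  have phi: "\<phi> (t + s) y (conc t w (\<lambda>_. 0)) = flow A s (\<phi> t y w)" for y
    using w t s by (simp add: phi_conc adm_zero phi_zero_control)
  obtain \<rho> where \<rho>: "\<rho> > 0" "\<And>x c. norm (c - flow A s x) < \<rho> \<Longrightarrow> \<exists>w\<in>adm. \<phi> s x w = c"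
    using small_reach[OF s] by blast
  have "continuous_on UNIV (\<lambda>y. flow A s (\<phi> t y w))"
    using w t by (intro continuous_on_flow continuous_phi_init continuous_intros)
  then obtain \<delta> where \<delta>: "\<delta> > 0" "\<And>y. dist y x < \<delta> \<Longrightarrow> dist (flow A s (\<phi> t y w)) (flow A s (\<phi> t x w)) < \<rho>"
    unfolding continuous_on_iff using \<rho>(1) by blast
  have x: "flow A s (\<phi> t x w) = x" using loop phi by simp
  have "mutual y x" if y: "dist y x < min \<delta> \<rho>" for y
  proof -
    have "norm (x - flow A s (\<phi> t y w)) < \<rho>" using \<delta>(2)[of y] y x by (simp add: dist_norm norm_minus_commute)
    then have "reach (\<phi> t y w) x" using \<rho>(2) s unfolding reach_def by (meson less_imp_le)
    then have 1: "reach y x" using reach_phi[OF w t] reach_trans by blast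
    have "norm (y - flow A s (\<phi> t x w)) < \<rho>" using y x by (simp add: dist_norm)
    then have "reach (\<phi> t x w) y" using \<rho>(2) s unfolding reach_def by (meson less_imp_le)
    then have "reach x y" using reach_phi[OF w t] reach_trans by blast
    with 1 show ?thesis by (simp add: mutual_def)
  qed
  moreover have "min \<delta> \<rho> > 0" using \<delta>(1) \<rho>(1) by simp
  ultimately show ?thesis using that by blast
qed

end

section \<open>Periodic points of controls over a hyperbolic matrix\<close>

locale hyperbolic_control = hyperbolic_splitting A P C \<alpha> + controllable_system A B U
  for A P :: "real^'d^'d" and C \<alpha> :: real and B :: "real^'m^'d" and U
begin

lemma exp_decay_small:
  assumes "e > 0"
  obtains T where "T > 0" "\<And>t. t \<ge> T \<Longrightarrow> C * exp (- \<alpha> * t) \<le> e"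
proof -
  have "((\<lambda>t. C * exp (- \<alpha> * t)) \<longlongrightarrow> C * 0) at_top"
    by (intro tendsto_mult_left tendsto_exp_minus \<alpha>)
  then have "eventually (\<lambda>t. C * exp (- \<alpha> * t) < e) at_top"
    using assms by (intro order_tendstoD) simp_all
  then obtain T where "\<And>t. t \<ge> T \<Longrightarrow> C * exp (- \<alpha> * t) < e"
    by (auto simp: eventually_at_top_linorder)
  then show ?thesis by (intro that[of "max T 1"]) (auto intro: less_imp_le)
qed

lemma flow_mult_fixed:
  assumes "flow A T x = x"
  shows "flow A (real n * T) x = x"
proof (induction n)
  case (Suc n)
  have "flow A (real (Suc n) * T) x = flow A T (flow A (real n * T) x)"
    by (simp add: distrib_right flip: flow_add)
  then show ?case using Suc assms by simp
qed simp

text \<open>A fixed vector is fixed by all powers of e^(TA), so its stable part is shrunk forwards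
  and its unstable part backwards by arbitrarily small factors while both stay the same.\<close>

lemma flow_fixed_eq_0:
  assumes T: "T > 0" and x: "flow A T x = x"
  shows "x = 0"
proof -
  have small: "\<exists>n. C * exp (- \<alpha> * (real n * T)) * norm x \<le> e" if "e > 0" for e
  proof -
    have "e / (norm x + 1) > 0" using that by (simp add: add_nonneg_pos)
    then obtain S where S: "\<And>t. t \<ge> S \<Longrightarrow> C * exp (- \<alpha> * t) \<le> e / (norm x + 1)"
      using exp_decay_small by blast
    obtain n where "S / T \<le> real n" using real_arch_simple by blast
    then have "C * exp (- \<alpha> * (real n * T)) \<le> e / (norm x + 1)"
      using T by (intro S) (simp add: field_simps)
    then have "C * exp (- \<alpha> * (real n * T)) * norm x \<le> e / (norm x + 1) * norm x"
      by (rule mult_right_mono) simp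
    also have "\<dots> \<le> e / (norm x + 1) * (norm x + 1)" using that by (intro mult_left_mono) auto
    also have "\<dots> = e" using add_nonneg_pos[OF norm_ge_zero zero_less_one, of x] by simp
    finally show ?thesis by blast
  qed
  have s: "norm (x - P *v x) \<le> C * exp (- \<alpha> * (real n * T)) * norm x" for n
  proof -
    have "flow A (real n * T) (x - P *v x) = x - P *v x"
      using flow_mult_fixed[OF x, of n] by (simp add: flow_simps flip: P_flow)
    then show ?thesis using stable[of "real n * T" x] T by simp
  qed
  have u: "norm (P *v x) \<le> C * exp (- \<alpha> * (real n * T)) * norm x" for n
  proof -
    have "flow A (- (real n * T)) (P *v x) = P *v x"
      using flow_mult_fixed[OF x, of n] flow_minus_cancel(1)[of A "real n * T" x] by (simp flip: P_flow)
    then show ?thesis using unstable[of "real n * T" x] T by simp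
  qed
  have zero: "a \<le> 0" if "\<And>n. a \<le> C * exp (- \<alpha> * (real n * T)) * norm x" for a
  proof (rule field_le_epsilon)
    fix e :: real assume "e > 0"
    then obtain n where "C * exp (- \<alpha> * (real n * T)) * norm x \<le> e" using small by blast
    with that[of n] show "a \<le> 0 + e" by linarith
  qed
  have "norm (x - P *v x) \<le> 0" using s by (rule zero)
  moreover have "norm (P *v x) \<le> 0" using u by (rule zero)
  ultimately show ?thesis by simp
qed

text \<open>The inverse of 1 - e^(TA). Applied to the state that w reaches from 0 at time T, it
  gives the periodic point of w.\<close>

definition fixpt :: "real \<Rightarrow> real^'d \<Rightarrow> real^'d" where
  "fixpt T = inv (\<lambda>x. x - flow A T x)"

lemma fixpt:
  assumes "T > 0"
  shows "linear (fixpt T)" "fixpt T (x - flow A T x) = x" "fixpt T y - flow A T (fixpt T y) = y"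
proof -
  let ?g = "\<lambda>x. x - flow A T x"
  have lin: "linear ?g" by (intro linear_compose_sub linear_flow linear_id[unfolded id_def])
  have inj: "inj ?g"
    unfolding linear_injective_0[OF lin] using flow_fixed_eq_0[OF assms] by simp
  show "linear (fixpt T)" unfolding fixpt_def by (rule inj_linear_imp_inv_linear[OF lin inj])
  show "fixpt T (x - flow A T x) = x" unfolding fixpt_def using inv_f_f[OF inj, of x] by simp
  show "fixpt T y - flow A T (fixpt T y) = y"
    unfolding fixpt_def using surj_f_inv_f[OF linear_inj_imp_surj[OF lin inj], of y] by simp
qed

text \<open>The periodic point for the control w up to time a T followed by 0 for the rest of the
  period. The parameter a deforms the full control, a = 1, into the zero control, a = 0, whose
  periodic point is 0.\<close>

definition loop_pt :: "real \<Rightarrow> (real \<Rightarrow> real^'m) \<Rightarrow> real \<Rightarrow> real^'d" where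
  "loop_pt T w a = fixpt T (flow A ((1 - a) * T) (\<phi> (a * T) 0 w))"

lemma loop_pt_loop:
  assumes T: "T > 0" and w: "w \<in> adm" and a: "0 \<le> a" "a \<le> 1"
  shows "\<phi> T (loop_pt T w a) (conc (a * T) w (\<lambda>_. 0)) = loop_pt T w a"
proof -
  let ?x = "loop_pt T w a"
  have nn: "a * T \<ge> 0" "(1 - a) * T \<ge> 0" and sum: "a * T + (1 - a) * T = T" using T a by (auto simp: algebra_simps)
  have "\<phi> T ?x (conc (a * T) w (\<lambda>_. 0)) = flow A ((1 - a) * T) (\<phi> (a * T) ?x w)"
    using phi_conc[OF w adm_zero nn, of ?x] nn unfolding sum by (simp add: phi_zero_control)
  also have "\<dots> = flow A T ?x + flow A ((1 - a) * T) (\<phi> (a * T) 0 w)"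
    unfolding phi_affine[OF w nn(1), of ?x]
    using flow_add[of A "(1 - a) * T" "a * T" ?x] sum by (simp add: flow_simps add.commute)
  also have "\<dots> = ?x"
    using fixpt(3)[OF T, of "flow A ((1 - a) * T) (\<phi> (a * T) 0 w)"]
    unfolding loop_pt_def[symmetric] by (metis add.commute diff_add_cancel)
  finally show ?thesis .
qed

lemma loop_pt_neighbourhood:
  assumes T: "T > 0" and w: "w \<in> adm" and a: "0 \<le> a" "a < 1"
  obtains \<delta> where "\<delta> > 0" "\<And>y. dist y (loop_pt T w a) < \<delta> \<Longrightarrow> mutual y (loop_pt T w a)"
proof -
  have "\<phi> (a * T + (1 - a) * T) (loop_pt T w a) (conc (a * T) w (\<lambda>_. 0)) = loop_pt T w a"
    using loop_pt_loop[OF T w, of a] a by (simp add: algebra_simps)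
  from loop_neighbourhood[OF w _ _ this] show ?thesis using that a T by auto
qed

lemma continuous_loop_pt:
  assumes T: "T > 0" and w: "w \<in> adm"
  shows "continuous_on {0..1} (loop_pt T w)"
  unfolding loop_pt_def
proof (rule continuous_on_compose2[OF linear_continuous_on[OF linear_conv_bounded_linear[THEN iffD1, OF fixpt(1)[OF T]]]])
  show "continuous_on {0..1} (\<lambda>a. flow A ((1 - a) * T) (\<phi> (a * T) 0 w))"
    by (intro continuous_on_flow continuous_intros continuous_on_compose2[OF continuous_phi[OF w]])
      (use T in auto)
qed auto

text \<open>For a < 1 each loop point has a neighbourhood of mutually reachable points, so the
  equivalence class is locally constant along the continuous path of loop points, hence constant on
  the connected interval [0, 1).\<close>

lemma mutual_loop_pt_0:
  assumes T: "T > 0" and w: "w \<in> adm" and a: "0 \<le> a" "a < 1"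
  shows "mutual (loop_pt T w a) 0"
proof -
  let ?x = "loop_pt T w"
  have "mutual (?x a) (?x 0)"
  proof (rule connected_equivalence_relation[where S="{0..<1}" and R="\<lambda>a b. mutual (?x a) (?x b)"])
    fix a :: real assume a: "a \<in> {0..<1}"
    obtain \<delta> where \<delta>: "\<delta> > 0" "\<And>y. dist y (?x a) < \<delta> \<Longrightarrow> mutual y (?x a)"
      using loop_pt_neighbourhood[OF T w, of a] a by auto
    let ?S = "{0..<1} \<inter> ?x -` ball (?x a) \<delta>"
    have "continuous_on {0..<1} ?x"
      by (rule continuous_on_subset[OF continuous_loop_pt[OF T w]]) auto
    then have "openin (top_of_set {0..<1}) ?S"
      by (rule continuous_openin_preimage_gen) simp
    moreover have "a \<in> ?S" using a \<delta>(1) by simp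
    moreover have "\<forall>b\<in>?S. mutual (?x a) (?x b)"
      using \<delta>(2) by (auto simp: dist_commute intro: mutual_sym)
    ultimately show "\<exists>S. openin (top_of_set {0..<1}) S \<and> a \<in> S \<and> (\<forall>b\<in>S. mutual (?x a) (?x b))" by blast
  qed (use a in \<open>auto intro: mutual_sym mutual_trans\<close>)
  moreover have "?x 0 = 0"
    by (simp add: loop_pt_def phi_0[OF w] flow_simps linear_0[OF fixpt(1)[OF T]])
  ultimately show ?thesis by simp
qed

section \<open>Description of the control set by reachability from and to 0\<close>

context
  fixes D :: "(real^'d) set"
  assumes D: "control_set A B U D" and int_D: "interior D \<noteq> {}"
begin

lemma D_subset_closure_reach: "x \<in> D \<Longrightarrow> D \<subseteq> closure {y. reach x y}"
  using D unfolding control_set_def control_set_props_def orbit_pos_eq by blast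

lemma reach_open:
  assumes "x \<in> D" "open N" "N \<subseteq> D" "N \<noteq> {}"
  obtains z where "z \<in> N" "reach x z"
  using D_subset_closure_reach[OF assms(1)] assms open_Int_closure_eq_empty[OF assms(2), of "{y. reach x y}"]
  by blast

text \<open>In D other points can only be approached. A short final piece of duration s, steered
  exactly, closes the loop.\<close>

lemma ex_interior_periodic:
  obtains x T w where "x \<in> interior D" "T > 0" "w \<in> adm" "\<phi> T x w = x"
proof -
  obtain x where x: "x \<in> interior D" using int_D by blast
  have "((\<lambda>s. flow A (- s) x) \<longlongrightarrow> flow A (- 0) x) (at_right 0)"
    by (intro tendsto_flow tendsto_intros)
  then have "eventually (\<lambda>s. flow A (- s) x \<in> interior D) (at_right 0)"
    using x by (intro topological_tendstoD) simp_all
  then have "eventually (\<lambda>s. flow A (- s) x \<in> interior D \<and> s > 0) (at_right 0)"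
    by (rule eventually_conj) (simp add: eventually_at_right_less)
  then obtain s where s: "s > 0" "flow A (- s) x \<in> interior D"
    using eventually_happens trivial_limit_at_right_real by blast
  obtain \<rho> where \<rho>: "\<rho> > 0" "\<And>z c. norm (c - flow A s z) < \<rho> \<Longrightarrow> \<exists>w\<in>adm. \<phi> s z w = c"
    using small_reach[OF s(1)] by blast
  \<comment> \<open>The points of the interior from which x can be hit exactly in time s. The set
    contains e^(-sA) x, because s was chosen so small that this point is still interior.\<close>
  let ?N = "interior D \<inter> {z. norm (x - flow A s z) < \<rho>}"
  have "open {z. norm (x - flow A s z) < \<rho>}"
    by (intro open_Collect_less continuous_intros continuous_on_flow)
  then have "open ?N" by (intro open_Int) auto
  moreover have "?N \<noteq> {}" using s(2) \<rho>(1) by (auto intro!: exI[of _ "flow A (- s) x"])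
  ultimately obtain z where z: "z \<in> ?N" "reach x z"
    using reach_open[of x ?N] x interior_subset by blast
  obtain t w where t: "t \<ge> 0" "w \<in> adm" "\<phi> t x w = z" using z(2) unfolding reach_def by blast
  obtain w2 where w2: "w2 \<in> adm" "\<phi> s z w2 = x" using z(1) \<rho>(2) by blast
  have "\<phi> (t + s) x (conc t w w2) = x" using t w2 s(1) by (simp add: phi_conc)
  moreover have "t + s > 0" using t s(1) by simp
  ultimately show ?thesis using that[OF x] admissible_conc[OF t(2) w2(1)] by blast
qed

text \<open>The interior periodic point is the loop point at a = 1, where no time for corrections is
  left. Taking a slightly below 1 stays in the interior and gains such time.\<close>

lemma ex_interior_mutual_0:
  obtains q where "q \<in> interior D" "mutual q 0" "\<exists>\<delta>>0. \<forall>y. dist y q < \<delta> \<longrightarrow> mutual y q"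
proof -
  obtain x T w where x: "x \<in> interior D" "T > 0" "w \<in> adm" "\<phi> T x w = x"
    using ex_interior_periodic by blast
  have "x - flow A T x = \<phi> T 0 w"
    using phi_affine[OF x(3), of T x] x(2,4) by (simp add: algebra_simps)
  then have x1: "loop_pt T w 1 = x"
    unfolding loop_pt_def using fixpt(2)[OF x(2), of x] by simp
  have "continuous (at 1 within {0..1}) (loop_pt T w)"
    using continuous_loop_pt[OF x(2,3)] by (simp add: continuous_on_eq_continuous_within)
  then obtain d where d: "d > 0" "\<And>a. a \<in> {0..1} \<Longrightarrow> dist a 1 < d \<Longrightarrow> loop_pt T w a \<in> interior D"
    unfolding continuous_within_topological using x(1) x1
    by (metis (no_types, lifting) open_interior open_dist dist_commute)
  define a where "a = max 0 (1 - d / 2)"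
  have a: "0 \<le> a" "a < 1" "dist a 1 < d" using d(1) by (auto simp: a_def dist_real_def)
  show ?thesis
  proof (rule that)
    show "loop_pt T w a \<in> interior D" using a by (intro d(2)) auto
    show "mutual (loop_pt T w a) 0" using x a by (intro mutual_loop_pt_0)
    show "\<exists>\<delta>>0. \<forall>y. dist y (loop_pt T w a) < \<delta> \<longrightarrow> mutual y (loop_pt T w a)"
      using loop_pt_neighbourhood[OF x(2,3) a(1,2)] by metis
  qed
qed

text \<open>Approximate reachability leads into a neighbourhood of q all of whose points can be
  steered to q exactly, and from there to 0.\<close>

lemma reach_0_if_in_D: "x \<in> D \<Longrightarrow> reach x 0"
proof -
  assume x: "x \<in> D"
  obtain q \<delta> where q: "q \<in> interior D" "mutual q 0" and \<delta>: "\<delta> > 0" "\<And>y. dist y q < \<delta> \<Longrightarrow> mutual y q"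
    using ex_interior_mutual_0 by blast
  let ?N = "interior D \<inter> ball q \<delta>"
  have "q \<in> ?N" using q(1) \<delta>(1) by simp
  moreover have "?N \<subseteq> D" using interior_subset by blast
  ultimately obtain z where z: "z \<in> ?N" "reach x z"
    using reach_open[OF x, of ?N] by (metis empty_iff open_Int open_ball open_interior)
  then have "mutual z q" using \<delta>(2)[of z] by (simp add: dist_commute)
  then show ?thesis using z(2) q(2) unfolding mutual_def by (meson reach_trans)
qed

lemma D_subset_closure_reach_0: "D \<subseteq> closure {y. reach 0 y}"
proof -
  obtain q where q: "q \<in> interior D" "mutual q 0" using ex_interior_mutual_0 by blast
  have "D \<subseteq> closure {y. reach q y}" using q interior_subset by (intro D_subset_closure_reach) blast
  also have "\<dots> \<subseteq> closure {y. reach 0 y}"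
    using q(2) by (intro closure_mono) (auto simp: mutual_def intro: reach_trans)
  finally show ?thesis .
qed

lemma phi_closure_reach_0:
  assumes "x \<in> closure {y. reach 0 y}" "w \<in> adm" "t \<ge> 0"
  shows "\<phi> t x w \<in> closure {y. reach 0 y}"
proof -
  have "(\<lambda>x. \<phi> t x w) ` closure {y. reach 0 y} \<subseteq> closure {y. reach 0 y}"
  proof (rule image_closure_subset[OF continuous_phi_init[OF assms(2,3)] closed_closure])
    have "(\<lambda>x. \<phi> t x w) ` {y. reach 0 y} \<subseteq> {y. reach 0 y}"
      using reach_phi[OF assms(2,3)] by (auto intro: reach_trans)
    then show "(\<lambda>x. \<phi> t x w) ` {y. reach 0 y} \<subseteq> closure {y. reach 0 y}"
      using closure_subset by blast
  qed
  with assms(1) show ?thesis by blast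
qed

text \<open>The right-hand side contains D and has both defining properties of a control set, so
  maximality of D gives equality.\<close>

lemma control_set_eq: "D = {x. reach x 0 \<and> x \<in> closure {y. reach 0 y}}"
proof -
  let ?D = "{x. reach x 0 \<and> x \<in> closure {y. reach 0 y}}"
  have "control_set_props A B U ?D"
    unfolding control_set_props_def orbit_pos_eq
  proof (intro conjI ballI)
    fix x assume x: "x \<in> ?D"
    then obtain t w where t: "t \<ge> 0" "w \<in> adm" "\<phi> t x w = 0" unfolding reach_def by blast
    \<comment> \<open>Steering to 0 and resting there keeps the trajectory inside for all
      times.\<close>
    have "\<phi> r x (conc t w (\<lambda>_. 0)) \<in> ?D" if r: "r \<ge> 0" for r
    proof (cases "r \<le> t")
      case True
      then have "\<phi> r x (conc t w (\<lambda>_. 0)) = \<phi> r x w" using t r by (simp add: phi_conc_le adm_zero)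
      then show ?thesis
        using reach_phi_later[OF t(2) r True, of x] t(3) phi_closure_reach_0[OF _ t(2) r] x by simp
    next
      case False
      then have "\<phi> (t + (r - t)) x (conc t w (\<lambda>_. 0)) = 0"
        using t by (subst phi_conc) (simp_all add: adm_zero phi_zero_control flow_simps)
      moreover have "0 \<in> closure {y. reach 0 y}"
        using closure_subset[of "{y. reach 0 y}"] reach_refl by blast
      ultimately show ?thesis using reach_refl by simp
    qed
    then show "\<exists>w\<in>adm. \<forall>t\<ge>0. \<phi> t x w \<in> ?D" using admissible_conc[OF t(2) adm_zero] by blast
    have "closure {y. reach 0 y} \<subseteq> closure {y. reach x y}"
      using x by (intro closure_mono) (auto intro: reach_trans)
    then show "?D \<subseteq> closure {y. reach x y}" by blast
  qed
  moreover have "D \<subseteq> ?D" using reach_0_if_in_D D_subset_closure_reach_0 by blast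
  ultimately show ?thesis using D unfolding control_set_def by blast
qed

text \<open>The closure of the orbit of 0 is forward invariant, and every earlier state inherits
  controllability to 0 from the final one.\<close>

lemma trajectory_in_D:
  assumes "x \<in> D" "w \<in> adm" "0 \<le> t" "t \<le> T" "reach (\<phi> T x w) 0"
  shows "\<phi> t x w \<in> D"
proof -
  have "x \<in> closure {y. reach 0 y}" using assms(1) control_set_eq by blast
  then have "\<phi> t x w \<in> closure {y. reach 0 y}" using assms by (intro phi_closure_reach_0)
  moreover have "reach (\<phi> t x w) 0" using reach_phi_later[OF assms(2-4)] assms(5) by (rule reach_trans)
  ultimately show ?thesis using control_set_eq by blast
qed

end

end

section \<open>Volume estimates\<close>

text \<open>The library relates Lebesgue measure to determinants only for index types of class \<^class>\<open>wellorder\<close>;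
  a copy of the index type carries such an order.\<close>

typedef 'a wo = "UNIV :: 'a set" morphisms of_wo to_wo ..

lemma of_to_wo [simp]: "of_wo (to_wo x) = x" "to_wo (of_wo i) = i"
  by (simp_all add: to_wo_inverse of_wo_inverse)

lemma bij_of_wo: "bij of_wo"
  by (rule bij_betw_byWitness[of _ to_wo]) auto

instance wo :: (finite) finite
  by standard (metis bij_of_wo bij_betw_finite finite)

definition wo_index :: "'a::finite wo \<Rightarrow> nat" where
  "wo_index = (SOME f. inj f)"

lemma inj_wo_index: "inj (wo_index :: 'a::finite wo \<Rightarrow> nat)"
proof -
  have "\<exists>f :: 'a wo \<Rightarrow> nat. inj f"
    using finite_imp_inj_to_nat_seg[of "UNIV :: 'a wo set"] by auto
  then show ?thesis unfolding wo_index_def by (rule someI_ex)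
qed

instantiation wo :: (finite) wellorder
begin

definition less_eq_wo :: "'a wo \<Rightarrow> 'a wo \<Rightarrow> bool" where "less_eq_wo i j \<longleftrightarrow> wo_index i \<le> wo_index j"
definition less_wo :: "'a wo \<Rightarrow> 'a wo \<Rightarrow> bool" where "less_wo i j \<longleftrightarrow> wo_index i < wo_index j"

instance
proof
  fix i j k :: "'a wo" and Q
  show "(i < j) = (i \<le> j \<and> \<not> j \<le> i)" "i \<le> i" "i \<le> j \<Longrightarrow> j \<le> k \<Longrightarrow> i \<le> k" "i \<le> j \<or> j \<le> i"
    by (auto simp: less_eq_wo_def less_wo_def)
  show "i \<le> j \<Longrightarrow> j \<le> i \<Longrightarrow> i = j"
    using inj_wo_index by (auto simp: less_eq_wo_def inj_def)
  show "Q i" if "\<And>x. (\<And>y. y < x \<Longrightarrow> Q y) \<Longrightarrow> Q x"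
    by (rule measure_induct_rule[of wo_index]) (use that in \<open>auto simp: less_wo_def\<close>)
qed

end

lemma sign_conjugate:
  fixes r :: "'a::finite \<Rightarrow> 'b::finite"
  assumes r: "bij r" and p: "p permutes (UNIV :: 'b set)"
  shows "sign (inv r \<circ> p \<circ> r) = sign p"
  using p finite[of "UNIV :: 'b set"]
proof (induction p rule: permutes_induct)
  case id
  have "inv r \<circ> id \<circ> r = id" using r by (auto simp: bij_def)
  then show ?case by (simp add: sign_id)
next
  case (swap a b p)
  let ?q = "inv r \<circ> p \<circ> r"
  have inv_r: "inv r (r x) = x" "r (inv r y) = y" for x y
    using r by (simp_all add: bij_def surj_f_inv_f)
  have inv_eq: "r x = y \<longleftrightarrow> x = inv r y" for x y using inv_r by metis
  have eq: "inv r \<circ> (Transposition.transpose a b \<circ> p) \<circ> r = Transposition.transpose (inv r a) (inv r b) \<circ> ?q"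
  proof
    fix x
    show "(inv r \<circ> (Transposition.transpose a b \<circ> p) \<circ> r) x = (Transposition.transpose (inv r a) (inv r b) \<circ> ?q) x"
      using inv_r(2) by (simp add: Transposition.transpose_def) (metis inv_r(2))
  qed
  have p: "bij p" using swap by (simp add: permutes_bij)
  have q: "bij ?q" using p r by (intro bij_comp bij_imp_bij_inv)
  have "inv r a = inv r b \<longleftrightarrow> a = b" using inv_r(2) by metis
  then have "sign (Transposition.transpose (inv r a) (inv r b)) = sign (Transposition.transpose a b)" by (simp add: sign_swap_id)
  moreover have "sign (Transposition.transpose (inv r a) (inv r b) \<circ> ?q) =
      sign (Transposition.transpose (inv r a) (inv r b)) * sign ?q"
    by (rule sign_compose[OF permutation_swap_id]) (unfold permutation, intro conjI q finite)
  moreover have "sign (Transposition.transpose a b \<circ> p) = sign (Transposition.transpose a b) * sign p"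
    by (rule sign_compose[OF permutation_swap_id]) (unfold permutation, intro conjI p finite)
  ultimately show ?case unfolding eq using swap.IH by (simp only:)
qed

text \<open>Conjugation with r is a bijection between the permutations of the two index types that
  preserves signs.\<close>

lemma det_reindex:
  fixes r :: "'a::finite \<Rightarrow> 'b::finite" and M :: "'c::comm_ring_1^'b^'b"
  assumes r: "bij r"
  shows "det (\<chi> i j. M $ r i $ r j) = det M"
proof -
  have inv_r: "inv r (r x) = x" "r (inv r y) = y" for x y
    using r by (simp_all add: bij_def surj_f_inv_f)
  have 1: "inv r \<circ> p \<circ> r permutes UNIV" if "p permutes UNIV" for p
    using r permutes_bij[OF that] by (intro bij_imp_permutes bij_comp bij_imp_bij_inv) auto
  have 2: "r \<circ> q \<circ> inv r permutes UNIV" if "q permutes UNIV" for q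
    using r permutes_bij[OF that] by (intro bij_imp_permutes bij_comp bij_imp_bij_inv) auto
  have "bij_betw (\<lambda>p. inv r \<circ> p \<circ> r) {p. p permutes UNIV} {p. p permutes UNIV}"
    by (rule bij_betw_byWitness[of _ "\<lambda>q. r \<circ> q \<circ> inv r"]) (use 1 2 in \<open>auto simp: fun_eq_iff inv_r\<close>)
  from sum.reindex_bij_betw[OF this, of "\<lambda>p. of_int (sign p) * (\<Prod>i\<in>UNIV. M $ r i $ r (p i))"]
  have "det (\<chi> i j. M $ r i $ r j) =
      (\<Sum>p | p permutes UNIV. of_int (sign (inv r \<circ> p \<circ> r)) * (\<Prod>i\<in>UNIV. M $ r i $ p (r i)))"
    by (simp add: det_def inv_r)
  also have "\<dots> = (\<Sum>p | p permutes UNIV. of_int (sign p) * (\<Prod>i\<in>UNIV. M $ i $ p i))"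
  proof (rule sum.cong[OF refl])
    fix p :: "'b \<Rightarrow> 'b" assume "p \<in> {p. p permutes UNIV}"
    then have "sign (inv r \<circ> p \<circ> r) = sign p" using sign_conjugate[OF r] by simp
    moreover have "(\<Prod>i\<in>UNIV. M $ r i $ p (r i)) = (\<Prod>i\<in>UNIV. M $ i $ p i)"
      using prod.reindex_bij_betw[OF r, of "\<lambda>i. M $ i $ p i"] by simp
    ultimately show "of_int (sign (inv r \<circ> p \<circ> r)) * (\<Prod>i\<in>UNIV. M $ r i $ p (r i)) =
        of_int (sign p) * (\<Prod>i\<in>UNIV. M $ i $ p i)" by simp
  qed
  finally show ?thesis by (simp add: det_def)
qed

section \<open>Volume of sets of vectors with arbitrary finite index type\<close>

definition wo_vec :: "real^'d \<Rightarrow> real^'d wo" where "wo_vec x = (\<chi> i. x $ of_wo i)"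
definition un_wo_vec :: "real^'d wo \<Rightarrow> real^'d" where "un_wo_vec x = (\<chi> i. x $ to_wo i)"

lemma wo_vec_inverse [simp]: "un_wo_vec (wo_vec x) = x" "wo_vec (un_wo_vec y) = y"
  by (simp_all add: wo_vec_def un_wo_vec_def vec_eq_iff)

lemma linear_wo_vec: "linear wo_vec" "linear un_wo_vec"
  by (auto intro!: linearI simp: wo_vec_def un_wo_vec_def vec_eq_iff)

lemmas bounded_linear_wo_vec = linear_wo_vec[THEN linear_conv_bounded_linear[THEN iffD1]]

lemma continuous_wo_vec: "continuous_on S wo_vec" "continuous_on T un_wo_vec"
  by (intro linear_continuous_on bounded_linear_wo_vec)+

lemma open_wo_vec: "open S \<Longrightarrow> open (wo_vec ` S)"
proof -
  assume "open S"
  then have "open (un_wo_vec -` S)" by (rule open_vimage[OF _ continuous_wo_vec(2)])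
  moreover have "un_wo_vec -` S = wo_vec ` S"
  proof
    show "un_wo_vec -` S \<subseteq> wo_vec ` S"
    proof
      fix y assume "y \<in> un_wo_vec -` S"
      then show "y \<in> wo_vec ` S" by (intro image_eqI[of _ _ "un_wo_vec y"]) simp_all
    qed
  qed auto
  ultimately show ?thesis by simp
qed

text \<open>Since \<open>wo_vec\<close> only renames coordinates, this is ordinary Lebesgue
  measure.\<close>

definition vol :: "(real^'d) set \<Rightarrow> real" where "vol S = measure lebesgue (wo_vec ` S)"
definition vmeas :: "(real^'d) set \<Rightarrow> bool" where "vmeas S \<longleftrightarrow> wo_vec ` S \<in> lmeasurable"

lemma vmeas_compact: "compact S \<Longrightarrow> vmeas S"
  unfolding vmeas_def by (intro lmeasurable_compact compact_continuous_image continuous_wo_vec)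

lemma vmeas_open: "open S \<Longrightarrow> bounded S \<Longrightarrow> vmeas S"
  unfolding vmeas_def
  by (intro lmeasurable_open open_wo_vec bounded_linear_image bounded_linear_wo_vec)

lemma vol_mono: "S \<subseteq> T \<Longrightarrow> vmeas S \<Longrightarrow> vmeas T \<Longrightarrow> vol S \<le> vol T"
  unfolding vol_def vmeas_def by (intro measure_mono_fmeasurable image_mono) (auto simp: fmeasurableD)

lemma wo_vec_translation: "wo_vec ` ((+) c ` S) = (+) (wo_vec c) ` (wo_vec ` S)"
  by (simp add: image_image linear_add[OF linear_wo_vec(1)])

lemma vol_translation: "vol ((+) c ` S) = vol S"
  unfolding vol_def wo_vec_translation by (rule measure_translation)

lemma vmeas_translation: "vmeas S \<Longrightarrow> vmeas ((+) c ` S)"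
  unfolding vmeas_def wo_vec_translation by (rule measurable_translation)

lemma vol_linear_image:
  fixes f :: "real^'d \<Rightarrow> real^'d"
  assumes f: "linear f" and S: "vmeas S"
  shows "vmeas (f ` S)" "vol (f ` S) = \<bar>det (matrix f)\<bar> * vol S"
proof -
  let ?g = "\<lambda>x. wo_vec (f (un_wo_vec x))"
  have g: "linear ?g"
    using linear_compose[OF linear_compose[OF linear_wo_vec(2) f] linear_wo_vec(1)] by (simp add: o_def)
  have eq: "wo_vec ` (f ` S) = ?g ` (wo_vec ` S)" by (simp add: image_image)
  have ax: "un_wo_vec (axis j 1) = axis (of_wo j) 1" for j :: "'d wo"
    by (auto simp: un_wo_vec_def axis_def vec_eq_iff)
  have "matrix ?g = (\<chi> i j. matrix f $ of_wo i $ of_wo j)"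
    by (simp add: matrix_def wo_vec_def ax)
  then have det: "det (matrix ?g) = det (matrix f)" by (simp add: det_reindex[OF bij_of_wo])
  show "vmeas (f ` S)" using S measurable_linear_image[OF g] unfolding vmeas_def eq by simp
  show "vol (f ` S) = \<bar>det (matrix f)\<bar> * vol S"
    using S measure_linear_image[OF g] unfolding vmeas_def vol_def eq det by simp
qed

lemma vol_flow_image:
  assumes "vmeas S"
  shows "vmeas (flow M t ` S)" "vol (flow M t ` S) = exp (t * eig_sum M) * vol S"
  using vol_linear_image[OF linear_flow assms, of M t] by (simp_all add: det_flow)

lemma vol_UN_le:
  assumes "finite I" "\<And>i. i \<in> I \<Longrightarrow> vmeas (S i)"
  shows "vmeas (\<Union>i\<in>I. S i)" "vol (\<Union>i\<in>I. S i) \<le> (\<Sum>i\<in>I. vol (S i))"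
  using assms measure_UNION_le[of I "\<lambda>i. wo_vec ` S i" lebesgue] unfolding vmeas_def vol_def image_UN
  by (auto intro!: fmeasurable.finite_UN simp: fmeasurableD)

lemma vol_disjoint_UN:
  assumes "finite I" "\<And>i. i \<in> I \<Longrightarrow> vmeas (S i)" "pairwise (\<lambda>i j. disjnt (S i) (S j)) I"
  shows "vol (\<Union>i\<in>I. S i) = (\<Sum>i\<in>I. vol (S i))"
proof -
  have inj: "inj wo_vec" by (metis injI wo_vec_inverse(1))
  have "pairwise (\<lambda>i j. disjnt (wo_vec ` S i) (wo_vec ` S j)) I"
    using assms(3) by (simp add: pairwise_def disjnt_def image_Int[OF inj, symmetric])
  then show ?thesis
    using assms(1,2) measure_UNION'[of I "\<lambda>i. wo_vec ` S i" lebesgue] unfolding vmeas_def vol_def image_UN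
    by simp
qed

lemma vol_pos:
  assumes "vmeas S" "interior S \<noteq> {}"
  shows "vol S > 0"
proof (rule ccontr)
  assume "\<not> vol S > 0"
  then have "measure lebesgue (wo_vec ` S) = 0"
    using measure_nonneg[of lebesgue "wo_vec ` S"] unfolding vol_def by linarith
  then have "negligible (wo_vec ` S)"
    using assms(1) by (simp add: vmeas_def negligible_iff_measure)
  then have "negligible (wo_vec ` interior S)"
    by (rule negligible_subset) (intro image_mono interior_subset)
  moreover have "open (wo_vec ` interior S)" by (simp add: open_wo_vec)
  ultimately show False using assms(2) open_not_negligible by blast
qed

text \<open>Each covering set lies in a translate of e^(-tM) applied to the ball of radius r, of
  volume e^(-t eig_sum M) times that of the ball. The constant c = vol K / V is independent of M, t
  and the cover.\<close>

lemma covering_card: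
  fixes K :: "(real^'d) set"
  assumes K: "compact K" "interior K \<noteq> {}" and r: "r > 0"
  obtains c where "c > 0"
    "\<And>M t I x. finite I \<Longrightarrow> K \<subseteq> (\<Union>i\<in>I. {y. norm (flow M t (y - x i)) \<le> r}) \<Longrightarrow>
      c * exp (t * eig_sum M) \<le> real (card (I :: 'i set))"
proof -
  define V where "V = vol (cball (0 :: real^'d) r)"
  have V: "V > 0" unfolding V_def using r by (intro vol_pos vmeas_compact) (auto simp: interior_cball)
  have vK: "vol K > 0" by (intro vol_pos vmeas_compact K)
  have key: "vol K / V * exp (t * eig_sum M) \<le> real (card I)"
    if I: "finite I" and cover: "K \<subseteq> (\<Union>i\<in>I. {y. norm (flow M t (y - x i)) \<le> r})" for M t x and I :: "'i set"
  proof -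
    let ?C = "\<lambda>i. (+) (x i) ` (flow M (- t) ` cball 0 r)"
    have C: "vmeas (?C i)" "vol (?C i) = exp (- (t * eig_sum M)) * V" for i
      using vol_flow_image[OF vmeas_compact[OF compact_cball], of M "- t" 0 r]
      by (simp_all add: vmeas_translation vol_translation V_def)
    have sub: "y \<in> ?C i" if "norm (flow M t (y - x i)) \<le> r" for y i
    proof -
      have "y = x i + flow M (- t) (flow M t (y - x i))" by simp
      moreover have "flow M t (y - x i) \<in> cball 0 r" using that by simp
      ultimately show ?thesis by blast
    qed
    have "K \<subseteq> (\<Union>i\<in>I. ?C i)"
    proof
      fix y assume "y \<in> K"
      then have "y \<in> (\<Union>i\<in>I. {y. norm (flow M t (y - x i)) \<le> r})" by (rule subsetD[OF cover])
      then obtain i where i: "i \<in> I" "norm (flow M t (y - x i)) \<le> r" by (elim UN_E CollectE)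
      show "y \<in> (\<Union>i\<in>I. ?C i)" by (rule UN_I[OF i(1)], rule sub[OF i(2)])
    qed
    then have "vol K \<le> vol (\<Union>i\<in>I. ?C i)"
      by (intro vol_mono vmeas_compact[OF K(1)] vol_UN_le(1)[OF I] C(1))
    also have "\<dots> \<le> (\<Sum>i\<in>I. vol (?C i))" by (rule vol_UN_le(2)[OF I C(1)])
    also have "\<dots> = real (card I) * (exp (- (t * eig_sum M)) * V)" by (simp only: C(2) sum_constant)
    finally show ?thesis using V by (simp add: field_simps exp_minus)
  qed
  have "vol K / V > 0" using V vK by simp
  from this key show ?thesis by (rule that)
qed

text \<open>A largest \<delta>-separated subset of Y, in the distance after time t, is also a
  \<delta>-net. Its translates of e^(-tM) applied to the ball of radius \<delta>/2 are disjoint and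
  lie in one fixed ball, which bounds their number. The bound k on the inverse flow keeps that ball
  independent of t.\<close>

lemma separated_packing:
  assumes \<delta>: "\<delta> > 0"
  obtains V where "V > 0"
    "\<And>M t Y. Y \<subseteq> cball 0 a \<Longrightarrow> (\<And>x. norm (flow M (- t) x) \<le> k * norm x) \<Longrightarrow>
      \<exists>F. finite F \<and> F \<subseteq> (Y :: (real^'d) set) \<and> real (card F) \<le> V * exp (t * eig_sum M) \<and>
        (\<forall>y\<in>Y. \<exists>y'\<in>F. norm (flow M t (y - y')) \<le> \<delta>)"
proof -
  \<comment> \<open>Points of Y have norm at most |a|, and the transported small ball has radius at
    most |k| \<delta>; the summand 1 ensures R > 0.\<close>
  define R where "R = \<bar>a\<bar> + \<bar>k\<bar> * \<delta> + 1"
  define W where "W = vol (ball (0 :: real^'d) (\<delta> / 2))"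
  define V where "V = vol (cball (0 :: real^'d) R) / W"
  have R: "R > 0" unfolding R_def using \<delta> by (intro add_nonneg_pos add_nonneg_nonneg) auto
  have W: "W > 0" unfolding W_def using \<delta> by (intro vol_pos vmeas_open) auto
  have V: "V > 0" unfolding V_def using W R
    by (intro divide_pos_pos vol_pos vmeas_compact) (auto simp: interior_cball)
  have key: "\<exists>F. finite F \<and> F \<subseteq> Y \<and> real (card F) \<le> V * exp (t * eig_sum M) \<and>
      (\<forall>y\<in>Y. \<exists>y'\<in>F. norm (flow M t (y - y')) \<le> \<delta>)"
    if Y: "Y \<subseteq> cball 0 a" and k: "\<And>x. norm (flow M (- t) x) \<le> k * norm x" for M t and Y :: "(real^'d) set"
  proof -
    let ?sep = "\<lambda>F. finite F \<and> F \<subseteq> Y \<and> (\<forall>y\<in>F. \<forall>y'\<in>F. y \<noteq> y' \<longrightarrow> norm (flow M t (y - y')) > \<delta>)"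
    let ?B = "flow M (- t) ` ball 0 (\<delta> / 2)"
    have B: "vmeas ?B" "vol ?B = exp (- (t * eig_sum M)) * W"
      using vol_flow_image[OF vmeas_open[OF open_ball bounded_ball], of M "- t" 0 "\<delta> / 2"] by (simp_all add: W_def)
    have bound: "real (card F) \<le> V * exp (t * eig_sum M)" if F: "?sep F" for F
    proof -
      have "pairwise (\<lambda>y y'. disjnt ((+) y ` ?B) ((+) y' ` ?B)) F"
        unfolding pairwise_def disjnt_def
      proof (intro ballI impI, rule ccontr)
        fix y y' assume yy': "y \<in> F" "y' \<in> F" "y \<noteq> y'" "(+) y ` ?B \<inter> (+) y' ` ?B \<noteq> {}"
        then obtain u v where uv: "norm u < \<delta> / 2" "norm v < \<delta> / 2" "y + flow M (- t) u = y' + flow M (- t) v"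
          by auto
        then have "y - y' = flow M (- t) (v - u)" by (simp add: flow_simps algebra_simps)
        then have "flow M t (y - y') = v - u" by simp
        then have "norm (flow M t (y - y')) < \<delta>" using norm_triangle_ineq4[of v u] uv by simp
        moreover have "\<delta> < norm (flow M t (y - y'))" using F yy' by blast
        ultimately show False by simp
      qed
      then have "vol (\<Union>y\<in>F. (+) y ` ?B) = (\<Sum>y\<in>F. vol ((+) y ` ?B))"
        using F B(1) by (intro vol_disjoint_UN vmeas_translation) auto
      also have "\<dots> = real (card F) * (exp (- (t * eig_sum M)) * W)"
        by (simp only: vol_translation B(2) sum_constant)
      finally have eq: "vol (\<Union>y\<in>F. (+) y ` ?B) = real (card F) * (exp (- (t * eig_sum M)) * W)" .
      have "(\<Union>y\<in>F. (+) y ` ?B) \<subseteq> cball 0 R"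
      proof safe
        fix y u :: "real^'d" assume y: "y \<in> F" and u: "u \<in> ball 0 (\<delta> / 2)"
        have "norm (flow M (- t) u) \<le> k * norm u" by (rule k)
        also have "\<dots> \<le> \<bar>k\<bar> * \<delta>" using u \<delta> by (intro mult_mono) auto
        finally have "norm (flow M (- t) u) \<le> \<bar>k\<bar> * \<delta>" .
        moreover have "norm y \<le> \<bar>a\<bar>" using F Y y by fastforce
        ultimately show "y + flow M (- t) u \<in> cball 0 R"
          using norm_triangle_ineq[of y "flow M (- t) u"] by (simp add: R_def)
      qed
      then have "real (card F) * (exp (- (t * eig_sum M)) * W) \<le> vol (cball (0 :: real^'d) R)"
        unfolding eq[symmetric] using F
        by (intro vol_mono vol_UN_le(1) vmeas_translation B(1) vmeas_compact[OF compact_cball]) auto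
      then show ?thesis using W by (simp add: V_def field_simps exp_minus)
    qed
    \<comment> \<open>The existence of a maximum is drawn from a strict bound on the cardinalities,
      hence the + 1.\<close>
    have less: "card F < nat \<lceil>V * exp (t * eig_sum M)\<rceil> + 1" if "?sep F" for F
      using bound[OF that] by linarith
    have "?sep {}" by simp
    then have "\<exists>F. ?sep F \<and> (\<forall>G. ?sep G \<longrightarrow> card G \<le> card F)"
      by (rule Lattices_Big.ex_has_greatest_nat[where b="nat \<lceil>V * exp (t * eig_sum M)\<rceil> + 1"])
        (intro allI impI less)
    then obtain F where FM: "?sep F \<and> (\<forall>G. ?sep G \<longrightarrow> card G \<le> card F)" ..
    note F = FM[THEN conjunct1] and max = FM[THEN conjunct2, rule_format]
    have "\<exists>y'\<in>F. norm (flow M t (y - y')) \<le> \<delta>" if y: "y \<in> Y" for y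
    proof (rule ccontr)
      assume "\<not> ?thesis"
      then have far: "norm (flow M t (y - y')) > \<delta>" if "y' \<in> F" for y' using that by auto
      have far': "norm (flow M t (y' - y)) > \<delta>" if "y' \<in> F" for y'
      proof -
        have "flow M t (y' - y) = - flow M t (y - y')" by (simp add: flow_simps)
        then show ?thesis using far[OF that] by simp
      qed
      have "y \<notin> F" using far[of y] \<delta> by (auto simp: flow_simps)
      moreover have "?sep (insert y F)" using F y far far' by auto
      ultimately show False using max[of "insert y F"] F by simp
    qed
    then show ?thesis using F bound[OF F] by blast
  qed
  from V key show ?thesis by (rule that)
qed

section \<open>Upper and lower bounds for the pressure\<close>

context hyperbolic_control
begin

lemma norm_P: "norm (P *v x) \<le> C * norm x"
  using unstable[of 0 x] by simp

lemma norm_Q: "norm (x - P *v x) \<le> C * norm x"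
  using stable[of 0 x] by simp

lemma P_Q: "P *v (x - P *v x) = 0"
  by (simp add: matrix_vector_mult_diff_distrib P_idem)

lemma Q_flow: "flow A t x - P *v flow A t x = flow A t (x - P *v x)"
  by (simp add: P_flow flow_simps)

lemma stable_step: "t \<ge> 0 \<Longrightarrow> norm (flow A t (x - P *v x)) \<le> C * exp (- \<alpha> * t) * norm (x - P *v x)"
  using stable[of t "x - P *v x"] by (simp add: P_Q)

lemma unstable_step: "t \<ge> 0 \<Longrightarrow> norm (flow A (- t) (P *v x)) \<le> C * exp (- \<alpha> * t) * norm (P *v x)"
  using unstable[of t "P *v x"] by (simp add: P_idem)

lemma C_exp_le: "t \<ge> 0 \<Longrightarrow> C * exp (- \<alpha> * t) \<le> C"
  using mult_left_mono[OF _ C, of "exp (- \<alpha> * t)" 1] \<alpha> by simp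

text \<open>After time T contraction has gained a factor 1/2, while a control adds at most M. This
  balance bounds trajectories over all times.\<close>

lemma contraction_time:
  obtains T M where "T > 0" "C * exp (- \<alpha> * T) \<le> 1 / 2" "M > 0"
    "\<And>t w. w \<in> adm \<Longrightarrow> 0 \<le> t \<Longrightarrow> t \<le> T \<Longrightarrow> norm (\<phi> t 0 w) \<le> M"
proof -
  obtain T where T: "T > 0" "C * exp (- \<alpha> * T) \<le> 1 / 2"
    using exp_decay_small[of "1/2"] by (metis order_refl half_gt_zero zero_less_one)
  show ?thesis by (rule phi_bounded[of T]) (rule that[OF T])
qed

text \<open>One step of length T sends a stable part of norm b to at most b / 2 + C M, so the bound
  2 C M reproduces itself.\<close>

lemma stable_part_bounded:
  obtains b where "\<And>t w. w \<in> adm \<Longrightarrow> t \<ge> 0 \<Longrightarrow> norm (\<phi> t 0 w - P *v \<phi> t 0 w) \<le> b"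
proof -
  obtain T M where T: "T > 0" "C * exp (- \<alpha> * T) \<le> 1 / 2" and M: "M > 0"
    "\<And>t w. w \<in> adm \<Longrightarrow> 0 \<le> t \<Longrightarrow> t \<le> T \<Longrightarrow> norm (\<phi> t 0 w) \<le> M"
    by (rule contraction_time) blast
  let ?q = "\<lambda>x. x - P *v x"
  have short: "norm (?q (\<phi> t 0 w)) \<le> C * M" if "w \<in> adm" "0 \<le> t" "t \<le> T" for t w
    using norm_Q[of "\<phi> t 0 w"] mult_left_mono[OF M(2)[OF that] C] by linarith
  have step: "norm (?q (\<phi> t 0 w)) \<le> 2 * (C * M)" if "w \<in> adm" "0 \<le> t" "t \<le> real n * T" for n t w
    using that
  proof (induction n arbitrary: t)
    case 0
    then show ?case using phi_0[of w 0] C M(1) by simp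
  next
    case (Suc n)
    have CM: "C * M \<ge> 0" using C M(1) by simp
    show ?case
    proof (cases "t \<le> T")
      case True
      then show ?thesis using short[of w t] Suc.prems CM by linarith
    next
      case False
      let ?y = "\<phi> (t - T) 0 w" and ?w' = "\<lambda>r. w (r + (t - T))"
      have adm': "?w' \<in> adm" using Suc.prems(1) by (rule admissible_shift)
      have "\<phi> t 0 w = \<phi> T ?y ?w'"
        using phi_shift[OF Suc.prems(1), of "t - T" T 0] False T(1) by simp
      also have "\<dots> = flow A T ?y + \<phi> T 0 ?w'" using T(1) by (intro phi_affine adm') simp
      finally have eq: "?q (\<phi> t 0 w) = flow A T (?q ?y) + ?q (\<phi> T 0 ?w')"
        by (simp add: matrix_vector_right_distrib Q_flow[symmetric])
      have "norm (flow A T (?q ?y)) \<le> C * M"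
      proof -
        have "norm (?q ?y) \<le> 2 * (C * M)"
          using Suc.prems False by (intro Suc.IH) (auto simp: algebra_simps)
        then have "C * exp (- \<alpha> * T) * norm (?q ?y) \<le> 1 / 2 * (2 * (C * M))"
          by (intro mult_mono T(2)) auto
        then show ?thesis using stable_step[of T ?y] T(1) by linarith
      qed
      moreover have "norm (?q (\<phi> T 0 ?w')) \<le> C * M" using T(1) by (intro short adm') auto
      ultimately show ?thesis
        unfolding eq using norm_triangle_ineq[of "flow A T (?q ?y)" "?q (\<phi> T 0 ?w')"] by linarith
    qed
  qed
  have "norm (?q (\<phi> t 0 w)) \<le> 2 * (C * M)" if "w \<in> adm" "t \<ge> 0" for t w
  proof -
    obtain n where "t / T \<le> real n" using real_arch_simple by blast
    then have "t \<le> real n * T" using T(1) by (simp add: field_simps)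
    then show ?thesis by (rule step[OF that])
  qed
  then show ?thesis by (rule that)
qed

text \<open>The same argument backwards in time from the target 0, where the unstable part is the
  contracting one. The constant b satisfies b / 2 + M / 2 \<le> b, which closes the
  induction.\<close>

lemma unstable_part_bounded:
  obtains b where "\<And>t x w. w \<in> adm \<Longrightarrow> t \<ge> 0 \<Longrightarrow> \<phi> t x w = 0 \<Longrightarrow> norm (P *v x) \<le> b"
proof -
  obtain T M where T: "T > 0" "C * exp (- \<alpha> * T) \<le> 1 / 2" and M: "M > 0"
    "\<And>t w. w \<in> adm \<Longrightarrow> 0 \<le> t \<Longrightarrow> t \<le> T \<Longrightarrow> norm (\<phi> t 0 w) \<le> M"
    by (rule contraction_time) blast
  define b where "b = 2 * (C * M) + 2 * M"
  have CM: "C * M \<ge> 0" using C M(1) by simp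
  then have b: "1 / 2 * b + 1 / 2 * M \<le> b" using M(1) by (simp add: b_def field_simps)
  have bwd: "P *v x = flow A (- t) (P *v \<phi> t x w) - flow A (- t) (P *v \<phi> t 0 w)"
    if "w \<in> adm" "t \<ge> 0" for t x w
    using phi_affine[OF that, of x] by (simp add: matrix_vector_right_distrib P_flow flow_simps)
  have step: "norm (P *v x) \<le> b" if "w \<in> adm" "0 \<le> t" "t \<le> real n * T" "\<phi> t x w = 0" for n t x w
    using that
  proof (induction n arbitrary: t x w)
    case 0
    then show ?case using phi_0[of w x] CM M(1) by (simp add: b_def)
  next
    case (Suc n)
    show ?case
    proof (cases "t \<le> T")
      case True
      have "norm (P *v x) = norm (flow A (- t) (P *v \<phi> t 0 w))"
        using bwd[OF Suc.prems(1,2), of x] Suc.prems(4) by (simp add: flow_simps)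
      also have "\<dots> \<le> C * exp (- \<alpha> * t) * norm (\<phi> t 0 w)" using Suc.prems(2) by (rule unstable)
      also have "\<dots> \<le> C * M"
        using Suc.prems True by (intro mult_mono C_exp_le M(2) C) auto
      finally show ?thesis using CM M(1) by (simp add: b_def)
    next
      case False
      let ?y = "\<phi> T x w" and ?w' = "\<lambda>r. w (r + T)"
      have adm': "?w' \<in> adm" using Suc.prems(1) by (rule admissible_shift)
      have "\<phi> (t - T) ?y ?w' = 0"
        using phi_shift[OF Suc.prems(1), of T "t - T" x] False T(1) Suc.prems(4) by simp
      then have y: "norm (P *v ?y) \<le> b"
        using Suc.prems(3) False by (intro Suc.IH[OF adm', of "t - T"]) (auto simp: algebra_simps)
      have "norm (P *v x) \<le> norm (flow A (- T) (P *v ?y)) + norm (flow A (- T) (P *v \<phi> T 0 w))"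
        using bwd[OF Suc.prems(1), of T x] T(1) norm_triangle_ineq4 by (metis less_imp_le)
      moreover have "norm (flow A (- T) (P *v ?y)) \<le> 1 / 2 * b"
        using unstable_step[of T ?y] T(1) mult_mono[OF T(2) y] by simp
      moreover have "norm (flow A (- T) (P *v \<phi> T 0 w)) \<le> 1 / 2 * M"
        using unstable[of T "\<phi> T 0 w"] T(1) mult_mono[OF T(2) M(2)[OF Suc.prems(1), of T]] by simp
      ultimately show ?thesis using b by linarith
    qed
  qed
  have "norm (P *v x) \<le> b" if "w \<in> adm" "t \<ge> 0" "\<phi> t x w = 0" for t x w
  proof -
    obtain n where "t / T \<le> real n" using real_arch_simple by blast
    then have "t \<le> real n * T" using T(1) by (simp add: field_simps)
    from step[OF that(1,2) this that(3)] show ?thesis .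
  qed
  then show ?thesis by (rule that)
qed

lemma bounded_control_set:
  assumes "control_set A B U D" "interior D \<noteq> {}"
  obtains b where "b > 0" "\<And>x. x \<in> D \<Longrightarrow> norm x \<le> b"
proof -
  obtain b1 where b1: "\<And>t w. w \<in> adm \<Longrightarrow> t \<ge> 0 \<Longrightarrow> norm (\<phi> t 0 w - P *v \<phi> t 0 w) \<le> b1"
    using stable_part_bounded by metis
  obtain b2 where b2: "\<And>t x w. w \<in> adm \<Longrightarrow> t \<ge> 0 \<Longrightarrow> \<phi> t x w = 0 \<Longrightarrow> norm (P *v x) \<le> b2"
    using unstable_part_bounded by metis
  let ?S = "{x. norm (x - P *v x) \<le> b1}"
  have "closed ?S"
    by (intro closed_Collect_le continuous_intros continuous_matrix_mult)
  moreover have "{y. reach 0 y} \<subseteq> ?S" using b1 by (auto simp: reach_def)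
  ultimately have cl: "closure {y. reach 0 y} \<subseteq> ?S" by (rule closure_minimal[rotated])
  have "norm x \<le> \<bar>b1\<bar> + \<bar>b2\<bar> + 1" if "x \<in> D" for x
  proof -
    have x: "reach x 0" "x \<in> closure {y. reach 0 y}" using that control_set_eq[OF assms] by blast+
    have "norm (x - P *v x) \<le> b1" using x(2) cl by blast
    moreover have "norm (P *v x) \<le> b2" using x(1) b2 unfolding reach_def by blast
    ultimately show ?thesis using norm_triangle_ineq[of "x - P *v x" "P *v x"] by simp
  qed
  moreover have "\<bar>b1\<bar> + \<bar>b2\<bar> + 1 > 0" by simp
  ultimately show ?thesis by (rule that[rotated])
qed

end

text \<open>c bounds the excess over the constant rate m at every intermediate time, so a control
  built for a longer horizon may be cut off at any \<tau>.\<close>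

definition cost_le :: "(real^'m \<Rightarrow> real) \<Rightarrow> real \<Rightarrow> real \<Rightarrow> real \<Rightarrow> (real \<Rightarrow> real^'m) \<Rightarrow> bool" where
  "cost_le f m T c w \<longleftrightarrow> (\<forall>\<tau>\<in>{0..T}. integral {0..\<tau>} (\<lambda>t. f (w t)) \<le> \<tau> * m + c)"

section \<open>Cost of controls relative to the minimum of f\<close>

locale pressure_setup = hyperbolic_control A P C \<alpha> B U
  for A P :: "real^'d^'d" and C \<alpha> :: real and B :: "real^'m^'d" and U +
  fixes f :: "real^'m \<Rightarrow> real" and u0 :: "real^'m" and F :: real
  assumes f: "continuous_on U f" and u0: "u0 \<in> U" "\<And>u. u \<in> U \<Longrightarrow> f u0 \<le> f u"
    and F: "\<And>u. u \<in> U \<Longrightarrow> \<bar>f u\<bar> \<le> F"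
begin

abbreviation "m \<equiv> f u0"
abbreviation "cost \<equiv> cost_le f m"
abbreviation "payoff w \<tau> \<equiv> integral {0..\<tau>} (\<lambda>t. f (w t))"

lemma F_nonneg: "F \<ge> 0" and m_bounds: "m \<le> F" "- m \<le> F"
  using F[OF u0(1)] by linarith+

lemma f_integrable: "w \<in> adm \<Longrightarrow> (\<lambda>t. f (w t)) integrable_on {s..t}"
  by (rule admissible_integral(1)[OF _ compact_U f F_nonneg]) (use F in auto)

lemma f_integral_le: "w \<in> adm \<Longrightarrow> s \<le> t \<Longrightarrow> integral {s..t} (\<lambda>t. f (w t)) \<le> F * (t - s)"
  using admissible_integral(2)[OF _ compact_U f F_nonneg] F by (metis abs_le_D1 real_norm_def)

lemma f_integral_ge:
  assumes w: "w \<in> adm" and t: "t \<ge> 0"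
  shows "t * m \<le> payoff w t"
proof -
  \<comment> \<open>Along w the values of f lie between m and F almost everywhere; shifting by the
    midpoint turns this into a norm bound with radius (F - m) / 2.\<close>
  let ?c = "(F + m) / 2"
  have bd: "norm (integral {0..t} (\<lambda>t. f (w t) - ?c)) \<le> (F - m) / 2 * (t - 0)"
  proof (rule admissible_integral(2)[OF w compact_U])
    show "continuous_on U (\<lambda>u. f u - ?c)" using f by (intro continuous_intros)
    show "(F - m) / 2 \<ge> 0" using m_bounds by simp
    fix u assume "u \<in> U"
    then have "m \<le> f u" "f u \<le> F" using u0(2) F[of u] by auto
    then show "norm (f u - ?c) \<le> (F - m) / 2" by (simp add: abs_le_iff field_simps)
  qed (use t in auto)
  have eq: "integral {0..t} (\<lambda>t. f (w t) - ?c) = payoff w t - t * ?c"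
    using t f_integrable[OF w] by (subst integral_diff) auto
  have "- ((F - m) / 2 * t) \<le> payoff w t - t * ?c"
    using bd unfolding eq real_norm_def abs_le_iff by (simp add: minus_le_iff)
  then show ?thesis by (simp add: field_simps)
qed

lemma cost_conc:
  assumes w: "w1 \<in> adm" "w2 \<in> adm" and s: "s \<ge> 0" and c: "c2 \<ge> 0"
    and cost: "cost s c1 w1" "cost T c2 w2"
  shows "cost (s + T) (c1 + c2) (conc s w1 w2)"
  unfolding cost_le_def
proof
  fix \<tau> assume \<tau>: "\<tau> \<in> {0..s + T}"
  have upto: "payoff (conc s w1 w2) t = payoff w1 t" if "t \<le> s" for t
    using that by (intro integral_spike[of "{s}"]) (auto simp: conc_def)
  show "payoff (conc s w1 w2) \<tau> \<le> \<tau> * m + (c1 + c2)"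
  proof (cases "\<tau> \<le> s")
    case True
    then have "payoff w1 \<tau> \<le> \<tau> * m + c1"
      using cost(1) \<tau> unfolding cost_le_def by simp
    then show ?thesis using upto[OF True] c by simp
  next
    case False
    have "payoff (conc s w1 w2) \<tau> =
        payoff (conc s w1 w2) s + integral {s..\<tau>} (\<lambda>t. f (conc s w1 w2 t))"
      by (rule Henstock_Kurzweil_Integration.integral_combine[symmetric, OF s])
        (use False f_integrable[OF admissible_conc[OF w]] in auto)
    also have "integral {s..\<tau>} (\<lambda>t. f (conc s w1 w2 t)) =
        integral {s - s..\<tau> - s} (\<lambda>t. f (conc s w1 w2 (t + s)))"
      by (rule integral_shift_real_ivl[symmetric])
    also have "\<dots> = payoff w2 (\<tau> - s)"
      by (simp, rule integral_cong) (auto simp: conc_def)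
    also have "\<dots> \<le> (\<tau> - s) * m + c2" using cost(2) \<tau> False unfolding cost_le_def by simp
    also have "payoff (conc s w1 w2) s \<le> s * m + c1"
      using cost(1) s unfolding cost_le_def upto[OF order_refl] by simp
    finally show ?thesis by (simp add: algebra_simps)
  qed
qed

text \<open>The rate of an arbitrary control is at most F, and F \<le> m + 2 F because m \<ge>
  -F.\<close>

lemma cost_any:
  assumes "w \<in> adm"
  shows "cost T (2 * F * T) w"
  unfolding cost_le_def
proof
  fix \<tau> assume \<tau>: "\<tau> \<in> {0..T}"
  have "payoff w \<tau> \<le> F * \<tau>" using f_integral_le[OF assms, of 0 \<tau>] \<tau> by simp
  also have "\<dots> \<le> (m + 2 * F) * \<tau>" using m_bounds \<tau> by (intro mult_right_mono) auto
  also have "\<dots> \<le> \<tau> * m + 2 * F * T" using \<tau> F_nonneg by (simp add: algebra_simps mult_left_mono)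
  finally show "payoff w \<tau> \<le> \<tau> * m + 2 * F * T" .
qed

lemma cost_const: "cost T 0 (\<lambda>_. u0)"
  by (auto simp: cost_le_def)

section \<open>Lower bound\<close>

lemma pressure_lower_bound:
  assumes D: "control_set A B U D" "interior D \<noteq> {}"
    and K: "compact K" "K \<subseteq> D" "interior K \<noteq> {}"
  obtains c where "c > 0"
    "\<And>\<tau>. \<tau> \<ge> 0 \<Longrightarrow> ennreal (c * exp (\<tau> * (m + eig_sum (A ** P)))) \<le> a_tau A B U f \<tau> K D"
proof -
  let ?h = "eig_sum (A ** P)"
  obtain b where b: "b > 0" "\<And>x. x \<in> D \<Longrightarrow> norm x \<le> b"
    using bounded_control_set[OF D] by metis
  \<comment> \<open>Differences of two points of D have norm at most 2 b; their stable and unstable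
    parts contribute at most 2 C b each.\<close>
  define r where "r = 4 * C * b + 1"
  have r: "r > 0" unfolding r_def using C b(1) by (intro add_nonneg_pos mult_nonneg_nonneg) auto
  obtain c where c: "c > 0" "\<And>M t I x. finite I \<Longrightarrow> K \<subseteq> (\<Union>i\<in>I. {y. norm (flow M t (y - x i)) \<le> r}) \<Longrightarrow>
      c * exp (t * eig_sum M) \<le> real (card (I :: (real \<Rightarrow> real^'m) set))"
    using covering_card[OF K(1,3) r, where 'i="real \<Rightarrow> real^'m"] by metis
  have "ennreal (c * exp (\<tau> * (m + ?h))) \<le> a_tau A B U f \<tau> K D" if \<tau>: "\<tau> \<ge> 0" for \<tau>
    unfolding a_tau_def
  proof (rule INF_greatest)
    fix S assume "S \<in> {S. spanning A B U \<tau> K D S}"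
    then have S: "S \<subseteq> adm" "\<And>x. x \<in> K \<Longrightarrow> \<exists>w\<in>S. \<forall>t\<in>{0..\<tau>}. \<phi> t x w \<in> D"
      by (auto simp: spanning_def)
    let ?g = "\<lambda>w. ennreal (exp (payoff w \<tau>))"
    have g: "ennreal (exp (\<tau> * m)) \<le> ?g w" if "w \<in> S" for w
      using f_integral_ge[of w \<tau>] that S(1) \<tau> by (intro ennreal_leI) auto
    show "ennreal (c * exp (\<tau> * (m + ?h))) \<le> infsum ?g S"
    proof (cases "finite S")
      \<comment> \<open>Every summand is at least the positive constant e^(\<tau> m), so an infinite
        spanning set has infinite sum.\<close>
      case False
      then have "infsum ?g S = \<infinity>"
        using g by (intro infsum_superconst_infinite_ennreal[where b="ennreal (exp (\<tau> * m))"]) auto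
      then show ?thesis by simp
    next
      case fin: True
      let ?good = "\<lambda>w x. x \<in> K \<and> (\<forall>t\<in>{0..\<tau>}. \<phi> t x w \<in> D)"
      define x where "x w = (SOME x. ?good w x)" for w
      have near: "norm (flow (A ** P) \<tau> (y - x w)) \<le> r" if "w \<in> S" "?good w y" for w y
      proof -
        have x: "?good w (x w)" unfolding x_def using that(2) by (rule someI)
        let ?z = "y - x w"
        have "norm y \<le> b" "norm (x w) \<le> b" using b(2) K(2) x that(2) by blast+
        then have "norm ?z \<le> 2 * b" using norm_triangle_ineq4[of y "x w"] by linarith
        then have 1: "norm (?z - P *v ?z) \<le> C * (2 * b)"
          using norm_Q[of ?z] mult_left_mono[OF _ C, of "norm ?z" "2 * b"] by linarith
        have "flow A \<tau> ?z = \<phi> \<tau> y w - \<phi> \<tau> (x w) w"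
          using that(1) S(1) \<tau> by (intro phi_diff[symmetric]) auto
        moreover have "norm (\<phi> \<tau> y w) \<le> b" "norm (\<phi> \<tau> (x w) w) \<le> b"
          using x that(2) \<tau> b(2) by simp_all
        ultimately have "norm (flow A \<tau> ?z) \<le> 2 * b"
          using norm_triangle_ineq4[of "\<phi> \<tau> y w" "\<phi> \<tau> (x w) w"] by simp
        then have 2: "norm (P *v flow A \<tau> ?z) \<le> C * (2 * b)"
          using norm_P[of "flow A \<tau> ?z"] mult_left_mono[OF _ C, of "norm (flow A \<tau> ?z)" "2 * b"] by linarith
        have "flow (A ** P) \<tau> ?z = P *v flow A \<tau> ?z + (?z - P *v ?z)"
          unfolding flow_unstable_part P_flow ..
        then show ?thesis
          using norm_triangle_ineq[of "P *v flow A \<tau> ?z" "?z - P *v ?z"] 1 2 unfolding r_def by simp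
      qed
      have "K \<subseteq> (\<Union>w\<in>S. {y. norm (flow (A ** P) \<tau> (y - x w)) \<le> r})"
      proof
        fix y assume y: "y \<in> K"
        then obtain w where w: "w \<in> S" "\<forall>t\<in>{0..\<tau>}. \<phi> t y w \<in> D" using S(2) by blast
        show "y \<in> (\<Union>w\<in>S. {y. norm (flow (A ** P) \<tau> (y - x w)) \<le> r})"
          by (rule UN_I[OF w(1)]) (use near[OF w(1)] y w(2) in simp)
      qed
      then have card: "c * exp (\<tau> * ?h) \<le> real (card S)" by (rule c(2)[OF fin])
      have "c * exp (\<tau> * (m + ?h)) = c * exp (\<tau> * ?h) * exp (\<tau> * m)"
        by (simp add: distrib_left exp_add)
      also have "\<dots> \<le> real (card S) * exp (\<tau> * m)" using card by (rule mult_right_mono) simp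
      finally have "ennreal (c * exp (\<tau> * (m + ?h))) \<le> ennreal (real (card S) * exp (\<tau> * m))"
        by (rule ennreal_leI)
      also have "\<dots> = (\<Sum>w\<in>S. ennreal (exp (\<tau> * m)))"
        by (simp add: ennreal_mult ennreal_of_nat_eq_real_of_nat)
      also have "\<dots> \<le> (\<Sum>w\<in>S. ?g w)" using g by (rule sum_mono)
      also have "\<dots> = infsum ?g S" using fin by simp
      finally show ?thesis .
    qed
  qed
  with c(1) show ?thesis by (rule that)
qed

section \<open>Upper bound\<close>

lemma block_words:
  assumes W: "finite W" "W \<subseteq> adm" "\<And>w. w \<in> W \<Longrightarrow> cost T c w" and T: "T \<ge> 0" and c: "c \<ge> 0"
    and step: "\<And>x. x \<in> G \<Longrightarrow> \<exists>w\<in>W. \<phi> T x w \<in> G"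
  shows "\<exists>V. finite V \<and> V \<subseteq> adm \<and> card V \<le> card W ^ k \<and> (\<forall>w\<in>V. cost (real k * T) (real k * c) w) \<and>
    (\<forall>x\<in>G. \<exists>w\<in>V. \<phi> (real k * T) x w \<in> G)"
proof (induction k)
  case 0
  show ?case
    by (rule exI[of _ "{\<lambda>_. u0}"]) (use cost_const admissible_const[OF u0(1)] phi_0 in auto)
next
  case (Suc k)
  then obtain V where V: "finite V" "V \<subseteq> adm" "card V \<le> card W ^ k"
    "\<forall>w\<in>V. cost (real k * T) (real k * c) w" "\<forall>x\<in>G. \<exists>w\<in>V. \<phi> (real k * T) x w \<in> G"
    by (elim exE conjE)
  let ?V = "(\<lambda>(w1, w2). conc T w1 w2) ` (W \<times> V)"
  have eq: "real (Suc k) * T = T + real k * T" "real (Suc k) * c = c + real k * c"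
    by (simp_all add: algebra_simps)
  show ?case
  proof (intro exI[of _ ?V] conjI ballI)
    show "finite ?V" using W(1) V(1) by simp
    show "?V \<subseteq> adm" using W(2) V(2) by (auto intro!: admissible_conc)
    have "card ?V \<le> card W * card V"
      using card_image_le[of "W \<times> V"] W(1) V(1) by (simp add: card_cartesian_product)
    also have "\<dots> \<le> card W ^ Suc k" using V(3) by simp
    finally show "card ?V \<le> card W ^ Suc k" .
  next
    fix w assume "w \<in> ?V"
    then obtain w1 w2 where "w1 \<in> W" "w2 \<in> V" "w = conc T w1 w2" by auto
    then show "cost (real (Suc k) * T) (real (Suc k) * c) w"
      unfolding eq using W(2,3) V(2,4) T c by (auto intro!: cost_conc)
  next
    fix x assume "x \<in> G"
    then obtain w1 where w1: "w1 \<in> W" "\<phi> T x w1 \<in> G" using step by blast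
    then obtain w2 where w2: "w2 \<in> V" "\<phi> (real k * T) (\<phi> T x w1) w2 \<in> G" using V(5) by blast
    have "\<phi> (T + real k * T) x (conc T w1 w2) = \<phi> (real k * T) (\<phi> T x w1) w2"
      using w1(1) w2(1) W(2) V(2) T by (intro phi_conc) auto
    then have "\<phi> (real (Suc k) * T) x (conc T w1 w2) \<in> G" unfolding eq using w2(2) by simp
    moreover have "conc T w1 w2 \<in> ?V" using w1(1) w2(1) by auto
    ultimately show "\<exists>w\<in>?V. \<phi> (real (Suc k) * T) x w \<in> G" by (rule rev_bexI[rotated])
  qed
qed

text \<open>Each point of K can be steered through 0 to p exactly. By continuity in the initial
  value the same pair (T, w) leads all nearby points into N, and compactness leaves finitely many
  pairs.\<close>

lemma steering_family:
  assumes D: "control_set A B U D" "interior D \<noteq> {}" and K: "compact K" "K \<subseteq> D"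
    and p: "mutual p 0" and G: "open N" "p \<in> N"
  obtains J where "finite J" "\<And>T w. (T, w) \<in> J \<Longrightarrow> T \<ge> 0 \<and> w \<in> adm"
    "\<And>x. x \<in> K \<Longrightarrow> \<exists>(T, w)\<in>J. \<phi> T x w \<in> N"
proof -
  let ?I = "{(T, w). T \<ge> 0 \<and> w \<in> adm}"
  let ?O = "\<lambda>(T, w). (\<lambda>x. \<phi> T x w) -` N"
  have opn: "open (?O i)" if "i \<in> ?I" for i
    using that G(1) by (cases i) (auto intro!: open_vimage continuous_phi_init)
  have cov: "K \<subseteq> (\<Union>i\<in>?I. ?O i)"
  proof
    fix x assume "x \<in> K"
    then have "reach x 0" using K(2) reach_0_if_in_D[OF D] by blast
    then have "reach x p" using p unfolding mutual_def by (meson reach_trans)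
    then obtain T w where "T \<ge> 0" "w \<in> adm" "\<phi> T x w = p" unfolding reach_def by blast
    then show "x \<in> (\<Union>i\<in>?I. ?O i)" using G(2) by (intro UN_I[of "(T, w)"]) auto
  qed
  obtain J where J: "J \<subseteq> ?I" "finite J" "K \<subseteq> (\<Union>i\<in>J. ?O i)"
    by (rule compactE_image[OF K(1) opn cov])
  show ?thesis
  proof (rule that[OF J(2)])
    show "T \<ge> 0 \<and> w \<in> adm" if "(T, w) \<in> J" for T w using that J(1) by auto
    show "\<exists>(T, w)\<in>J. \<phi> T x w \<in> N" if "x \<in> K" for x
      using subsetD[OF J(3) that] by (auto split: prod.splits)
  qed
qed

definition block_controls :: "real \<Rightarrow> real \<Rightarrow> (real^'d) set \<Rightarrow> nat \<Rightarrow> (real \<Rightarrow> real^'m) set \<Rightarrow> bool" where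
  "block_controls c V G n W \<longleftrightarrow> finite W \<and> W \<subseteq> adm \<and>
    real (card W) \<le> V * exp (real n * eig_sum (A ** P)) \<and>
    (\<forall>w\<in>W. cost (real n) (real n * c) w) \<and> (\<forall>x\<in>G. \<exists>w\<in>W. \<phi> (real n) x w \<in> G)"

text \<open>G is a box around p in the coordinates of the splitting. During the first period the
  unstable deviation is corrected to one of finitely many choices of accuracy \<delta> as measured n
  - 1 periods later; the remaining periods run uncorrected and the stable deviation contracts by
  itself.\<close>

lemma block_family:
  assumes eps: "0 < \<epsilon>" "\<epsilon> < 1" and h: "eig_sum (A ** P) \<ge> 0"
  obtains p N G V n0 where "mutual p 0" "open N" "p \<in> N" "N \<subseteq> G" "\<And>x. x \<in> G \<Longrightarrow> mutual x 0" "V > 0"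
    "\<And>n. n \<ge> n0 \<Longrightarrow> \<exists>W. block_controls (2 * F * \<epsilon>) V G n W"
proof -
  let ?h = "eig_sum (A ** P)"
  define a where "a = 1 - \<epsilon>"
  define w0 where "w0 = (\<lambda>_::real. u0)"
  define base where "base = conc a w0 (\<lambda>_. 0)"
  define p where "p = loop_pt 1 w0 a"
  have a: "0 \<le> a" "a < 1" "a + \<epsilon> = 1" using eps by (auto simp: a_def)
  have w0: "w0 \<in> adm" unfolding w0_def by (rule admissible_const[OF u0(1)])
  have base: "base \<in> adm" unfolding base_def by (intro admissible_conc w0 adm_zero)
  have base_p: "\<phi> 1 p base = p"
    using loop_pt_loop[OF zero_less_one w0, of a] a unfolding p_def base_def by simp
  have base_z: "\<phi> 1 (p + z) base = p + flow A 1 z" for z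
    using phi_diff[OF base, of 1 "p + z" p] base_p by (simp add: algebra_simps)
  have p0: "mutual p 0" unfolding p_def using a by (intro mutual_loop_pt_0 w0) auto
  obtain \<delta>0 where \<delta>0: "\<delta>0 > 0" "\<And>y. dist y p < \<delta>0 \<Longrightarrow> mutual y p"
    unfolding p_def using loop_pt_neighbourhood[OF zero_less_one w0 a(1,2)] by metis
  obtain \<rho> where \<rho>: "\<rho> > 0" "\<And>c. norm c < \<rho> \<Longrightarrow> \<exists>w\<in>adm. \<phi> \<epsilon> 0 w = c"
    using small_control[OF eps(1)] by metis
  define corr where "corr c = (SOME w. w \<in> adm \<and> \<phi> \<epsilon> 0 w = c)" for c
  have corr: "corr c \<in> adm" "\<phi> \<epsilon> 0 (corr c) = c" if "norm c < \<rho>" for c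
    using someI_ex[of "\<lambda>w. w \<in> adm \<and> \<phi> \<epsilon> 0 w = c"] \<rho>(2)[OF that] unfolding corr_def by blast+
  define E where "E = exp (norm (endo_of_matrix A))"
  have E: "norm (flow A 1 x) \<le> E * norm x" for x using norm_flow_le[of A 1 x] by (simp add: E_def)
  have E0: "E > 0" by (simp add: E_def)
  \<comment> \<open>The first bound keeps the box among the points mutually reachable with p, the
    second makes every correction needed after one period realisable.\<close>
  define \<delta> where "\<delta> = min (\<delta>0 / 4) (\<rho> / (2 * C * E + 1))"
  have CE: "2 * C * E + 1 > 0" using C E0 by (intro add_nonneg_pos mult_nonneg_nonneg) auto
  have "\<delta> \<le> \<delta>0 / 4" unfolding \<delta>_def by (rule min.cobounded1)
  then have \<delta>: "\<delta> > 0" "2 * \<delta> < \<delta>0" using \<delta>0(1) \<rho>(1) CE by (simp_all add: \<delta>_def)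
  have CE\<delta>: "C * E * (2 * \<delta>) < \<rho>"
  proof -
    have "\<delta> * (2 * C * E + 1) \<le> \<rho>" using CE unfolding pos_le_divide_eq[OF CE, symmetric] \<delta>_def by (intro min.cobounded2)
    then show ?thesis using \<delta>(1) by (simp add: algebra_simps)
  qed
  define Z where "Z = {z. norm (P *v z) \<le> \<delta> \<and> norm (z - P *v z) \<le> \<delta>}"
  have Z: "norm z \<le> 2 * \<delta>" if "z \<in> Z" for z
    using that norm_triangle_ineq[of "P *v z" "z - P *v z"] by (simp add: Z_def)
  define G where "G = {x. x - p \<in> Z}"
  have G0: "mutual x 0" if "x \<in> G" for x
  proof -
    have "dist x p < \<delta>0" using Z[of "x - p"] that \<delta>(2) by (simp add: G_def dist_norm)
    from \<delta>0(2)[OF this] p0 show ?thesis by (rule mutual_trans)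
  qed
  \<comment> \<open>Both projections have norm at most C, so this ball lies in the box.\<close>
  define N where "N = ball p (\<delta> / (C + 1))"
  have N: "open N" "p \<in> N" using \<delta>(1) C by (auto simp: N_def)
  have NG: "N \<subseteq> G"
  proof
    fix x assume "x \<in> N"
    then have "norm (x - p) \<le> \<delta> / (C + 1)" by (simp add: N_def dist_norm norm_minus_commute)
    then have "C * norm (x - p) \<le> C * (\<delta> / (C + 1))" using C by (rule mult_left_mono)
    also have "\<dots> \<le> \<delta>" using C \<delta>(1) by (simp add: field_simps)
    finally show "x \<in> G" using norm_P[of "x - p"] norm_Q[of "x - p"] by (simp add: G_def Z_def)
  qed
  obtain V where V: "V > 0" "\<And>M t Y. Y \<subseteq> cball 0 \<rho> \<Longrightarrow> (\<And>x. norm (flow M (- t) x) \<le> (2 * C) * norm x) \<Longrightarrow>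
      \<exists>F. finite F \<and> F \<subseteq> (Y :: (real^'d) set) \<and> real (card F) \<le> V * exp (t * eig_sum M) \<and>
        (\<forall>y\<in>Y. \<exists>y'\<in>F. norm (flow M t (y - y')) \<le> \<delta>)"
    by (rule separated_packing[OF \<delta>(1), of \<rho> "2 * C"]) blast
  obtain T1 where T1: "\<And>t. t \<ge> T1 \<Longrightarrow> C * exp (- \<alpha> * t) \<le> 1"
    using exp_decay_small[of 1] by (metis zero_less_one)
  \<comment> \<open>k uncorrected periods; deviations from p then evolve by the linear flow
    alone.\<close>
  define rep where "rep k = (conc 1 base ^^ k) w0" for k
  have rep: "rep k \<in> adm" for k
    unfolding rep_def by (induction k) (auto intro!: admissible_conc base w0)
  have rep_phi: "\<phi> (real k) (p + z) (rep k) = p + flow A (real k) z" for k z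
  proof (induction k arbitrary: z)
    case 0
    then show ?case by (simp add: phi_0 rep)
  next
    case (Suc k)
    have "\<phi> (1 + real k) (p + z) (rep (Suc k)) = \<phi> (real k) (\<phi> 1 (p + z) base) (rep k)"
      using phi_conc[OF base rep, of 1 "real k" "p + z" k] by (simp add: rep_def)
    also note base_z
    also have "\<phi> (real k) (p + flow A 1 z) (rep k) = p + flow A (real k) (flow A 1 z)" by (rule Suc)
    finally show ?case by (simp add: add.commute flip: flow_add)
  qed
  \<comment> \<open>Excess arises only on the last \<epsilon> of the period, at rate at most 2
    F.\<close>
  have unit_cost: "cost 1 (2 * F * \<epsilon>) (conc a w0 v)" if "v \<in> adm" for v
    using cost_conc[OF w0 that a(1) _ _ cost_any[OF that, of \<epsilon>], of 0] cost_const[of a] eps F_nonneg a(3)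
    by (simp add: w0_def)
  have rep_cost: "cost (real k) (real k * (2 * F * \<epsilon>)) (rep k)" for k
  proof (induction k)
    case 0
    then show ?case using cost_const[of 0] by (simp add: rep_def w0_def)
  next
    case (Suc k)
    have "cost (1 + real k) (2 * F * \<epsilon> + real k * (2 * F * \<epsilon>)) (conc 1 base (rep k))"
      unfolding base_def using Suc eps F_nonneg
      by (intro cost_conc unit_cost adm_zero rep admissible_conc w0) (auto simp: base_def)
    then show ?case by (simp add: rep_def algebra_simps)
  qed
  have perturbed: "\<phi> 1 (p + z) (conc a w0 (corr c)) = p + (flow A 1 z + c)" if c: "norm c < \<rho>" for z c
  proof -
    let ?y = "\<phi> a (p + z) w0"
    have "\<phi> (a + \<epsilon>) (p + z) (conc a w0 (corr c)) = flow A \<epsilon> ?y + c"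
      using eps a w0 corr[OF c] by (subst phi_conc) (simp_all add: phi_affine[of "corr c" \<epsilon> ?y])
    moreover have "\<phi> (a + \<epsilon>) (p + z) base = flow A \<epsilon> ?y"
      unfolding base_def using eps a w0 by (subst phi_conc) (simp_all add: adm_zero phi_zero_control)
    ultimately show ?thesis using base_z[of z] unfolding a(3) by simp
  qed
  \<comment> \<open>From this n on, the stable deviation does not grow over a whole block; n \<ge> 1
    leaves a period for the correction.\<close>
  have blocks: "\<exists>W. block_controls (2 * F * \<epsilon>) V G n W"
    if n: "n \<ge> max 1 (nat \<lceil>T1\<rceil>)" for n
  proof -
    obtain j where j: "n = Suc j" using n by (cases n) auto
    have Cn: "C * exp (- \<alpha> * real n) \<le> 1" using n by (intro T1) linarith
    \<comment> \<open>The unstable deviations, after one period, of all points of the box; these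
      have to be cancelled up to an error that n - 1 further periods expand to at most
      \<delta>.\<close>
    define Y where "Y = (\<lambda>z. P *v flow A 1 z) ` Z"
    have PY: "P *v y = y" if "y \<in> Y" for y using that by (auto simp: Y_def P_idem)
    have Y\<rho>: "norm y < \<rho>" if y: "y \<in> Y" for y
    proof -
      obtain z where z: "z \<in> Z" "y = P *v flow A 1 z" using y unfolding Y_def by blast
      have "norm y \<le> C * norm (flow A 1 z)" unfolding z(2) by (rule norm_P)
      also have "\<dots> \<le> C * (E * norm z)" using E C by (rule mult_left_mono)
      also have "\<dots> \<le> C * (E * (2 * \<delta>))" using Z[OF z(1)] C E0 by (intro mult_left_mono) auto
      also have "\<dots> < \<rho>" using CE\<delta> by (simp add: mult.assoc)
      finally show ?thesis .
    qed
    \<comment> \<open>Backwards, the unstable part contracts and the stable part is frozen; each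
      contributes C.\<close>
    have "norm (flow (A ** P) (- real j) x) \<le> (2 * C) * norm x" for x
    proof -
      have "norm (flow A (- real j) (P *v x)) \<le> C * norm x"
        using unstable[of "real j" x] mult_right_mono[OF C_exp_le, of "real j" "norm x"] by simp
      moreover have "norm (flow (A ** P) (- real j) x) \<le> norm (flow A (- real j) (P *v x)) + norm (x - P *v x)"
        unfolding flow_unstable_part by (rule norm_triangle_ineq)
      ultimately show ?thesis using norm_Q[of x] by (simp add: algebra_simps)
    qed
    moreover have "Y \<subseteq> cball 0 \<rho>"
      unfolding subset_iff mem_cball_0 using Y\<rho> less_imp_le by blast
    ultimately obtain S where S: "finite S" "S \<subseteq> Y" "real (card S) \<le> V * exp (real j * ?h)"
      "\<forall>y\<in>Y. \<exists>y'\<in>S. norm (flow (A ** P) (real j) (y - y')) \<le> \<delta>"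
      using V(2)[of Y "A ** P" "real j"] by metis
    define ctl where "ctl y = conc 1 (conc a w0 (corr (- y))) (rep j)" for y
    have wS: "corr (- y) \<in> adm" if "y \<in> S" for y using Y\<rho>[of y] S(2) that by (intro corr) auto
    have ctl: "ctl y \<in> adm" if "y \<in> S" for y
      unfolding ctl_def by (intro admissible_conc w0 rep wS that)
    show ?thesis
      unfolding block_controls_def
    proof (intro exI[of _ "ctl ` S"] conjI ballI)
      show "finite (ctl ` S)" using S(1) by simp
      show "ctl ` S \<subseteq> adm" using ctl by auto
      have "real (card (ctl ` S)) \<le> real (card S)" using card_image_le[OF S(1)] by simp
      also have "\<dots> \<le> V * exp (real j * ?h)" by (rule S(3))
      also have "\<dots> \<le> V * exp (real n * ?h)" using V(1) h by (simp add: j mult_right_mono)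
      finally show "real (card (ctl ` S)) \<le> V * exp (real n * ?h)" .
    next
      fix w assume "w \<in> ctl ` S"
      then obtain y where y: "y \<in> S" "w = ctl y" by auto
      have "cost (1 + real j) (2 * F * \<epsilon> + real j * (2 * F * \<epsilon>)) w"
        unfolding y(2) ctl_def using eps F_nonneg
        by (intro cost_conc unit_cost rep_cost wS[OF y(1)] rep admissible_conc w0) auto
      then show "cost (real n) (real n * (2 * F * \<epsilon>)) w" by (simp add: j algebra_simps)
    next
      fix x assume "x \<in> G"
      define z where "z = x - p"
      have z: "z \<in> Z" "x = p + z" using \<open>x \<in> G\<close> by (auto simp: G_def z_def)
      let ?y = "P *v flow A 1 z"
      have "?y \<in> Y" using z(1) by (auto simp: Y_def)
      then obtain y' where y': "y' \<in> S" "norm (flow (A ** P) (real j) (?y - y')) \<le> \<delta>" using S(4) by blast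
      have Py': "P *v y' = y'" using y'(1) S(2) PY by blast
      let ?z' = "flow A (real j) (flow A 1 z - y')"
      have "\<phi> (1 + real j) x (ctl y') = \<phi> (real j) (\<phi> 1 (p + z) (conc a w0 (corr (- y')))) (rep j)"
        unfolding ctl_def z(2) by (intro phi_conc admissible_conc w0 wS[OF y'(1)] rep) auto
      also have "\<phi> 1 (p + z) (conc a w0 (corr (- y'))) = p + (flow A 1 z - y')"
        using perturbed[of "- y'" z] Y\<rho>[of y'] S(2) y'(1) by auto
      finally have phi: "\<phi> (real n) x (ctl y') = p + ?z'" by (simp add: j rep_phi)
      have Pz': "P *v ?z' = flow (A ** P) (real j) (?y - y')"
        unfolding flow_unstable_part by (simp add: P_flow matrix_vector_mult_diff_distrib P_idem Py')
      have "?z' - P *v ?z' = flow A (real j) ((flow A 1 z - y') - P *v (flow A 1 z - y'))"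
        by (rule Q_flow)
      also have "\<dots> = flow A (real j) (flow A 1 z - P *v flow A 1 z)"
        by (simp add: matrix_vector_mult_diff_distrib Py')
      also have "\<dots> = flow A (real j) (flow A 1 (z - P *v z))"
        by (simp only: Q_flow)
      also have "\<dots> = flow A (real n) (z - P *v z)"
        by (simp add: j add.commute flip: flow_add)
      finally have "norm (?z' - P *v ?z') \<le> C * exp (- \<alpha> * real n) * norm (z - P *v z)"
        using stable_step[of "real n" z] by simp
      also have "\<dots> \<le> 1 * \<delta>" using Cn z(1) by (intro mult_mono) (auto simp: Z_def)
      finally have "?z' \<in> Z" using y'(2) by (simp add: Z_def Pz')
      then have "\<phi> (real n) x (ctl y') \<in> G" by (simp add: phi G_def)
      then show "\<exists>w\<in>ctl ` S. \<phi> (real n) x w \<in> G" using y'(1) by blast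
    qed
  qed
  show ?thesis by (rule that[OF p0 N NG G0 V(1) blocks])
qed

lemma pressure_upper_bound:
  assumes D: "control_set A B U D" "interior D \<noteq> {}"
    and K: "compact K" "K \<subseteq> D"
    and h: "eig_sum (A ** P) \<ge> 0" and e: "e > 0"
  obtains c where "c > 0"
    "\<And>\<tau>. \<tau> \<ge> 0 \<Longrightarrow> a_tau A B U f \<tau> K D \<le> ennreal (c * exp (\<tau> * (m + eig_sum (A ** P) + e)))"
proof -
  let ?h = "eig_sum (A ** P)"
  \<comment> \<open>Makes the excess rate \<kappa> = 2 F \<epsilon> at most e / 2. The other half of
    e pays for the constant V.\<close>
  define \<epsilon> where "\<epsilon> = min (1/2) (e / (4 * (F + 1)))"
  define \<kappa> where "\<kappa> = 2 * F * \<epsilon>"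
  have eps: "0 < \<epsilon>" "\<epsilon> < 1" using e F_nonneg by (auto simp: \<epsilon>_def)
  have \<kappa>: "0 \<le> \<kappa>" "\<kappa> \<le> e / 2"
  proof -
    show "0 \<le> \<kappa>" using F_nonneg eps by (simp add: \<kappa>_def)
    have "\<kappa> \<le> 2 * F * (e / (4 * (F + 1)))"
      unfolding \<kappa>_def using F_nonneg by (intro mult_left_mono) (auto simp: \<epsilon>_def)
    also have "\<dots> \<le> e / 2" using F_nonneg e by (simp add: field_simps)
    finally show "\<kappa> \<le> e / 2" .
  qed
  obtain p N G V n0 where p: "mutual p 0" "open N" "p \<in> N" "N \<subseteq> G" and G0: "\<And>x. x \<in> G \<Longrightarrow> mutual x 0"
    and V: "V > 0"
    and blocks: "\<And>n. n \<ge> n0 \<Longrightarrow> \<exists>W. block_controls (2 * F * \<epsilon>) V G n W"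
    using block_family[OF eps h] by metis
  obtain J where J: "finite J" "\<And>T w. (T, w) \<in> J \<Longrightarrow> T \<ge> 0 \<and> w \<in> adm"
    "\<And>x. x \<in> K \<Longrightarrow> \<exists>(T, w)\<in>J. \<phi> T x w \<in> N"
    using steering_family[OF D K p(1-3)] by metis
  \<comment> \<open>A common bound for the nonnegative steering times that also makes sense for
    empty J.\<close>
  define Tm where "Tm = (\<Sum>(T, w)\<in>J. T)"
  have Tm: "T \<le> Tm" if "(T, w) \<in> J" for T w
    using member_le_sum[of "(T, w)" J "\<lambda>(T, w). T"] that J by (auto simp: Tm_def)
  define lV where "lV = ln (max V 1)"
  have lV: "lV \<ge> 0" "V \<le> exp lV" by (auto simp: lV_def)
  \<comment> \<open>Each block multiplies the number of controls by V e^(n h); with this n the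
    factor V raises the growth rate by at most e / 2.\<close>
  define n where "n = max (max n0 1) (nat \<lceil>2 * lV / e\<rceil>)"
  have n: "n \<ge> n0" "n \<ge> 1" "2 * lV / e \<le> real n" unfolding n_def by (auto simp: le_max_iff_disj) linarith
  have lVn: "lV / real n \<le> e / 2" using n(2,3) e by (simp add: field_simps)
  obtain W where W: "finite W" "W \<subseteq> adm" "real (card W) \<le> V * exp (real n * ?h)"
    "\<forall>w\<in>W. cost (real n) (real n * \<kappa>) w" "\<forall>x\<in>G. \<exists>w\<in>W. \<phi> (real n) x w \<in> G"
    using blocks[OF n(1)] unfolding \<kappa>_def block_controls_def by metis
  define L where "L = lV + real n * ?h"
  have L: "L \<ge> 0" unfolding L_def using lV(1) h by simp
  have cardW: "real (card W) \<le> exp L"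
  proof -
    have "V * exp (real n * ?h) \<le> exp lV * exp (real n * ?h)" using lV(2) by (rule mult_right_mono) simp
    with W(3) show ?thesis unfolding L_def exp_add by (rule order_trans)
  qed
  define c where "c = real (card J + 1) * exp (L + 2 * F * Tm + real n * \<kappa>)"
  have c: "c > 0" by (simp add: c_def)
  have "a_tau A B U f \<tau> K D \<le> ennreal (c * exp (\<tau> * (m + ?h + e)))" if \<tau>: "\<tau> \<ge> 0" for \<tau>
  proof -
    \<comment> \<open>Enough blocks to cover the time \<tau>, overshooting it by at most n; the
      initial steering time only lengthens the horizon.\<close>
    define k where "k = nat \<lceil>\<tau> / real n\<rceil>"
    have k: "\<tau> / real n \<le> real k" "real k \<le> \<tau> / real n + 1"
      using \<tau> by (auto simp: k_def of_nat_ceiling)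
    have kn: "\<tau> \<le> real k * real n" "real k * real n \<le> \<tau> + real n"
      using k n(2) by (simp_all add: field_simps)
    obtain X where X: "finite X" "X \<subseteq> adm" "card X \<le> card W ^ k"
      "\<forall>w\<in>X. cost (real k * real n) (real k * (real n * \<kappa>)) w" "\<forall>x\<in>G. \<exists>w\<in>X. \<phi> (real k * real n) x w \<in> G"
      using block_words[OF W(1,2) W(4)[rule_format] _ _ W(5)[rule_format], of k] \<kappa>(1) by auto
    define S where "S = (\<lambda>((T, w1), w2). conc T w1 w2) ` (J \<times> X)"
    have finS: "finite S" using J(1) X(1) by (simp add: S_def)
    have "card S \<le> card J * card X"
      unfolding S_def using card_image_le[of "J \<times> X"] J(1) X(1) by (simp add: card_cartesian_product)
    also have "\<dots> \<le> card J * card W ^ k" using X(3) by simp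
    finally have "real (card S) \<le> real (card J) * real (card W) ^ k"
      by (metis of_nat_le_iff of_nat_mult of_nat_power)
    also have "\<dots> \<le> real (card J + 1) * exp L ^ k"
      using cardW by (intro mult_mono power_mono) auto
    finally have cardS: "real (card S) \<le> real (card J + 1) * exp (real k * L)"
      by (simp add: exp_of_nat_mult)
    have "real k * L \<le> (\<tau> / real n + 1) * L" using k(2) L by (rule mult_right_mono)
    also have "\<dots> = \<tau> * (?h + lV / real n) + L" using n(2) by (simp add: L_def field_simps)
    also have "\<dots> \<le> \<tau> * (?h + e / 2) + L" using lVn \<tau> by (simp add: mult_left_mono)
    finally have kL: "real k * L \<le> \<tau> * (?h + e / 2) + L" .
    have S: "w \<in> adm \<and> payoff w \<tau> \<le> \<tau> * m + (2 * F * Tm + (\<tau> * (e / 2) + real n * \<kappa>))"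
      if wS: "w \<in> S" for w
    proof -
      obtain T w1 w2 where w: "(T, w1) \<in> J" "w2 \<in> X" "w = conc T w1 w2"
        using wS by (auto simp: S_def)
      have T: "T \<ge> 0" "w1 \<in> adm" "w2 \<in> adm" using J(2)[OF w(1)] w(2) X(2) by auto
      have "cost (T + real k * real n) (2 * F * T + real k * (real n * \<kappa>)) w"
        unfolding w(3) using T X(4) w(2) \<kappa>(1) by (intro cost_conc cost_any) auto
      then have "payoff w \<tau> \<le> \<tau> * m + (2 * F * T + real k * (real n * \<kappa>))"
        using \<tau> kn(1) T(1) unfolding cost_le_def by auto
      moreover have "2 * F * T \<le> 2 * F * Tm" using Tm[OF w(1)] F_nonneg by (intro mult_left_mono) auto
      moreover have "real k * (real n * \<kappa>) \<le> \<tau> * (e / 2) + real n * \<kappa>"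
      proof -
        have "real k * (real n * \<kappa>) \<le> (\<tau> + real n) * \<kappa>"
          using mult_right_mono[OF kn(2) \<kappa>(1)] by (simp add: mult.assoc)
        also have "\<dots> \<le> \<tau> * (e / 2) + real n * \<kappa>"
          using mult_left_mono[OF \<kappa>(2) \<tau>] by (simp add: distrib_right)
        finally show ?thesis .
      qed
      ultimately show ?thesis using T w(3) by (auto intro: admissible_conc)
    qed
    have "spanning A B U \<tau> K D S"
      unfolding spanning_def
    proof (intro conjI ballI)
      show "S \<subseteq> adm" using S by blast
      fix x assume x: "x \<in> K"
      obtain T w1 where T: "(T, w1) \<in> J" "\<phi> T x w1 \<in> N" using J(3)[OF x] by auto
      obtain w2 where w2: "w2 \<in> X" "\<phi> (real k * real n) (\<phi> T x w1) w2 \<in> G"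
        using X(5) T(2) p(4) by blast
      let ?w = "conc T w1 w2"
      have T': "T \<ge> 0" "w1 \<in> adm" "w2 \<in> adm" using J(2)[OF T(1)] w2(1) X(2) by auto
      have "\<phi> (T + real k * real n) x ?w \<in> G" using w2(2) T' by (simp add: phi_conc)
      \<comment> \<open>The end point in G can be steered to 0, which confines the whole trajectory
        to D.\<close>
      then have r: "reach (\<phi> (T + real k * real n) x ?w) 0" using G0 unfolding mutual_def by blast
      have "\<phi> t x ?w \<in> D" if "t \<in> {0..\<tau>}" for t
        by (rule trajectory_in_D[OF D _ _ _ _ r])
          (use that x K(2) T' kn(1) in \<open>auto intro: admissible_conc\<close>)
      moreover have "?w \<in> S" using T(1) w2(1) unfolding S_def by force
      ultimately show "\<exists>w\<in>S. \<forall>t\<in>{0..\<tau>}. \<phi> t x w \<in> D" by blast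
    qed
    then have "a_tau A B U f \<tau> K D \<le> infsum (\<lambda>w. ennreal (exp (payoff w \<tau>))) S"
      unfolding a_tau_def by (intro INF_lower) simp
    also have "\<dots> = (\<Sum>w\<in>S. ennreal (exp (payoff w \<tau>)))"
      using finS by simp
    also have "\<dots> \<le> (\<Sum>w\<in>S. ennreal (exp (\<tau> * m + (2 * F * Tm + (\<tau> * (e / 2) + real n * \<kappa>)))))"
      using S by (intro sum_mono ennreal_leI) auto
    also have "\<dots> = ennreal (real (card S) * exp (\<tau> * m + (2 * F * Tm + (\<tau> * (e / 2) + real n * \<kappa>))))"
      by (simp add: ennreal_mult ennreal_of_nat_eq_real_of_nat)
    also have "\<dots> \<le> ennreal (c * exp (\<tau> * (m + ?h + e)))"
    proof (rule ennreal_leI)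
      have "real (card S) * exp (\<tau> * m + (2 * F * Tm + (\<tau> * (e / 2) + real n * \<kappa>))) \<le>
          (real (card J + 1) * exp (\<tau> * (?h + e / 2) + L)) * exp (\<tau> * m + (2 * F * Tm + (\<tau> * (e / 2) + real n * \<kappa>)))"
        using order_trans[OF cardS, of "real (card J + 1) * exp (\<tau> * (?h + e / 2) + L)"] kL
        by (intro mult_right_mono) auto
      also have "\<dots> = c * exp (\<tau> * (m + ?h + e))"
        unfolding c_def mult.assoc exp_add[symmetric] by (simp add: algebra_simps)
      finally show "real (card S) * exp (\<tau> * m + (2 * F * Tm + (\<tau> * (e / 2) + real n * \<kappa>))) \<le>
          c * exp (\<tau> * (m + ?h + e))" .
    qed
    finally show ?thesis .
  qed
  with c show ?thesis by (rule that)
qed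

end

section \<open>From exponential bounds to the pressure\<close>

lemma log_enn_ge: "0 < l \<Longrightarrow> ennreal l \<le> a \<Longrightarrow> ereal (ln l) \<le> log_enn a"
  by (cases a) (auto simp: log_enn_def ennreal_le_iff2 top_ennreal.rep_eq)

lemma log_enn_le: "0 < u \<Longrightarrow> a \<le> ennreal u \<Longrightarrow> log_enn a \<le> ereal (ln u)"
  by (cases a) (auto simp: log_enn_def ennreal_le_iff2 top_unique)

text \<open>The factor c contributes (ln c) / \<tau>, which vanishes in the limit; hence constants
  independent of \<tau> are harmless in both bounds.\<close>

lemma tendsto_log_rate:
  assumes "c > 0"
  shows "((\<lambda>\<tau>. ereal (1 / \<tau>) * ereal (ln (c * exp (\<tau> * q)))) \<longlongrightarrow> ereal q) at_top"
proof -
  have "((\<lambda>\<tau>. ln c * inverse \<tau> + q) \<longlongrightarrow> ln c * 0 + q) at_top"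
    by (intro tendsto_intros tendsto_inverse_0_at_top filterlim_ident)
  moreover have "eventually (\<lambda>\<tau>. ln c * inverse \<tau> + q = 1 / \<tau> * ln (c * exp (\<tau> * q))) at_top"
    using eventually_gt_at_top[of 0] by eventually_elim (use assms in \<open>simp add: ln_mult field_simps\<close>)
  ultimately have "((\<lambda>\<tau>. 1 / \<tau> * ln (c * exp (\<tau> * q))) \<longlongrightarrow> q) at_top"
    by (simp add: tendsto_cong)
  then show ?thesis by simp
qed

theorem theorem5p2:
  fixes A :: "real^'d^'d" and B :: "real^'m^'d" and U :: "(real^'m) set"
    and D K :: "(real^'d) set" and f :: "real^'m \<Rightarrow> real"
  assumes "controllable_pair A B"
    and "hyperbolic A"
    and "compact U" and "0 \<in> interior U"
    and "control_set A B U D" and "interior D \<noteq> {}"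
    and "compact K" and "K \<subseteq> D" and "interior K \<noteq> {}"
    and "continuous_on U f"
  shows "P_inv A B U f K D =
    ereal (Inf (f ` U) + (\<Sum>z\<in>eigenvalues_c A. real (alg_mult A z) * max 0 (Re z)))"
proof -
  obtain P C \<alpha> where split: "hyperbolic_splitting A P C \<alpha>"
    and sum: "eig_sum (A ** P) = (\<Sum>z\<in>eigenvalues_c A. real (alg_mult A z) * max 0 (Re z))"
    using ex_hyperbolic_splitting[OF assms(2)] by metis
  have "U \<noteq> {}" using assms(4) interior_subset by blast
  then obtain u0 where u0: "u0 \<in> U" "\<And>u. u \<in> U \<Longrightarrow> f u0 \<le> f u"
    using continuous_attains_inf[OF assms(3) _ assms(10)] by metis
  have "bounded (f ` U)" by (intro compact_imp_bounded compact_continuous_image assms)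
  then obtain F where F: "\<And>u. u \<in> U \<Longrightarrow> \<bar>f u\<bar> \<le> F" by (auto simp: bounded_real)
  interpret pressure_setup A P C \<alpha> B U f u0 F
    using split assms u0 F
    by (intro pressure_setup.intro hyperbolic_control.intro controllable_system.intro control_system.intro
        controllable_system_axioms.intro pressure_setup_axioms.intro)
  define h where "h = eig_sum (A ** P)"
  have h: "h \<ge> 0" unfolding h_def sum by (intro sum_nonneg) auto
  let ?a = "\<lambda>\<tau>. a_tau A B U f \<tau> K D"
  have lower: "ereal (m + h) \<le> P_inv A B U f K D"
  proof -
    obtain c where c: "c > 0" "\<And>\<tau>. \<tau> \<ge> 0 \<Longrightarrow> ennreal (c * exp (\<tau> * (m + h))) \<le> ?a \<tau>"
      using pressure_lower_bound[OF assms(5-9)] unfolding h_def by metis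
    have "ereal (m + h) = Limsup at_top (\<lambda>\<tau>. ereal (1 / \<tau>) * ereal (ln (c * exp (\<tau> * (m + h)))))"
      by (rule lim_imp_Limsup[symmetric, OF _ tendsto_log_rate[OF c(1)]]) simp
    also have "\<dots> \<le> P_inv A B U f K D"
      unfolding P_inv_def
    proof (rule Limsup_mono)
      show "\<forall>\<^sub>F \<tau> in at_top. ereal (1 / \<tau>) * ereal (ln (c * exp (\<tau> * (m + h)))) \<le> ereal (1 / \<tau>) * log_enn (?a \<tau>)"
        using eventually_gt_at_top[of 0]
        by eventually_elim (use c in \<open>intro ereal_mult_left_mono log_enn_ge; simp\<close>)
    qed
    finally show ?thesis .
  qed
  have upper: "P_inv A B U f K D \<le> ereal (m + h)"
  \<comment> \<open>Periods containing time under zero control exceed the minimal rate in general,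
    so the upper bound is reached only up to an arbitrary e > 0.\<close>
  proof (rule ereal_le_epsilon2)
    fix e :: real assume "e > 0"
    then obtain c where c: "c > 0" "\<And>\<tau>. \<tau> \<ge> 0 \<Longrightarrow> ?a \<tau> \<le> ennreal (c * exp (\<tau> * (m + h + e)))"
      using pressure_upper_bound[OF assms(5-8) h[unfolded h_def]] unfolding h_def by metis
    have "P_inv A B U f K D \<le> Limsup at_top (\<lambda>\<tau>. ereal (1 / \<tau>) * ereal (ln (c * exp (\<tau> * (m + h + e)))))"
      unfolding P_inv_def
    proof (rule Limsup_mono)
      show "\<forall>\<^sub>F \<tau> in at_top. ereal (1 / \<tau>) * log_enn (?a \<tau>) \<le> ereal (1 / \<tau>) * ereal (ln (c * exp (\<tau> * (m + h + e))))"
        using eventually_gt_at_top[of 0]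
        by eventually_elim (use c in \<open>intro ereal_mult_left_mono log_enn_le; simp\<close>)
    qed
    also have "\<dots> = ereal (m + h + e)"
      by (rule lim_imp_Limsup[OF _ tendsto_log_rate[OF c(1)]]) simp
    finally show "P_inv A B U f K D \<le> ereal (m + h) + ereal e" by simp
  qed
  have "Inf (f ` U) = m"
    using u0 by (intro cInf_eq_minimum) auto
  then show ?thesis using lower upper sum by (simp add: h_def)
qed

end
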